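(* Consider the extended stochastic approximation recursion described in the context. Suppose the step-size, compactness, ergodicity, kernel-continuity, growth, interior-target, quasi-strong-monotonicity and error conditions of the context hold, with $0<\delta\le1$. When $\delta=1$, suppose also $2\zeta\alpha_0>1$. Suppose the exponents in the error condition satisfy $0\le\omega_{\mathsf M}<\delta/2$ and $\omega_{\mathsf B}>0$. Then there are positive constants $C$ and $K$ such that, for all $k\ge K$, $$\mathbb E\bigl[\|\theta_k-\theta^\star\|^2\mid\mathcal G_0^+\bigr]\le C\,U_2(W_0)\bigl[(1+\log k)k^{-\delta}+(1+\log k)k^{-\delta+2\omega_{\mathsf M}}+k^{-2\omega_{\mathsf B}}\bigr].$$
   Context: Setting. $\|\cdot\|$ is the Euclidean norm and $\langle\cdot,\cdot\rangle$ the Euclidean inner product. $\Theta\subseteq\mathbb R^d$ and $\Pi_\Theta$ is Euclidean projection onto $\Theta$. $\mathcal W$ is a Borel subset of a Euclidean space, $F:\Theta\times\mathcal W\to\mathbb R^d$ is jointly Borel measurable, and $\{P_\theta:\theta\in\Theta\}$ is a family of Markov transition kernels on $\mathcal W$ with $(\theta,w)\mapsto P_\theta(w,E)$ Borel measurable for each Borel $E$. Write $(P_\theta f)(w):=\int f(y)P_\theta(w,dy)$, $P_\theta^k$ for the $k$-step kernel, $U_p(w):=1+\|w\|^p$ for $p\in\{1,2\}$. Extended recursion. On a probability space, $(\theta_0,W_0)$ is $\Theta\times\mathcal W$-valued and $$\theta_{k+1}=\Pi_\Theta\bigl(\theta_k+\alpha_k(F(\theta_k,W_k)+M_{k+1}+B_k)\bigr),\qquad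 k\ge0,$$ with $\mathbb R^d$-valued random vectors $M_{k+1},B_k$. Let $\chi_{k+1}$ be a random element collecting all information revealed during update $k$, including $M_{k+1}$, and set $\mathcal G_0^-:=\sigma(\theta_0,W_0)$, $\mathcal G_k^+:=\mathcal G_k^-\vee\sigma(\chi_{k+1})$, $\mathcal G_{k+1}^-:=\mathcal G_k^+\vee\sigma(W_{k+1})$ for $k\ge0$. The variables $\theta_k,W_k,B_k$ are $\mathcal G_k^-$-measurable, and $\mathbb P(W_{k+1}\in E\mid\mathcal G_k^+)=P_{\theta_k}(W_k,E)$ for all Borel $E$ and $k\ge0$. (In)equalities between random quantities hold almost surely. Constants are deterministic; they may depend on fixed model and result parameters but not on running indices, sample paths or realizations of the initial variables. Conditions. - Step sizes: $\alpha_0>0$, $\delta\in(0,1]$, and $\alpha_k=\alpha_0k^{-\delta}$ for all $k\ge1$ (the step size at $k=0$ is $\alpha_0$). - Compactness: $\Theta$ is nonempty, compact and convex. - Ergodicity: (i) each $P_\theta$ is irreducible and aperiodic (as a general-state-space chain); there are a positive integer $N$, a nonempty Borel set $\mathcal W_0\subseteq\mathcal W$, $\epsilon_0>0$ and a probability measure $\varphi$ on $\mathcal W$ with $P_\theta^N(w,E)\ge\epsilon_0\varphi(E)$ for all $\theta\in\Theta$, $w\in\mathcal W_0$ and Borel $E$; and there are constants $0\le\lambda<1$, $b\ge0$ with $(P_\theta U_2)(w)\le\lambda U_2(w)+b\,\mathbb I_{\mathcal W_0}(w)$ for all $\theta\in\Theta$, $w\in\mathcal W$. (ii) $\mathbb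 E[U_2(W_0)]<\infty$. Part (i) ensures that each $P_\theta$ has a unique stationary distribution $\nu_\theta$ with $\sup_\theta\nu_\theta(U_2)<\infty$; set $\bar F(\theta):=\int_{\mathcal W}F(\theta,w)\,\nu_\theta(dw)$. - Kernel continuity: there is $L_P>0$ with $|(P_\theta f)(w)-(P_{\theta'}f)(w)|\le L_PU_1(w)\|\theta-\theta'\|$ for all $\theta,\theta'\in\Theta$, $w\in\mathcal W$ and Borel $f:\mathcal W\to\mathbb R$ with $|f|\le U_1$. - Growth: there are $L_F,C_F>0$ with $\|F(\theta,w)-F(\theta',w)\|\le L_F(1+\|w\|)\|\theta-\theta'\|$ and $\sup_{\theta\in\Theta}\|F(\theta,w)\|\le C_F(1+\|w\|)$ for all $\theta,\theta'\in\Theta$, $w\in\mathcal W$. - Interior target: there is $\theta^\star\in\operatorname{int}(\Theta)$ with $\bar F(\theta^\star)=0$. - Quasi-strong monotonicity: there is $\zeta>0$ with $\langle\theta-\theta^\star,\bar F(\theta)\rangle\le-\zeta\|\theta-\theta^\star\|^2$ for all $\theta\in\Theta$. - Error condition: (i) for all $k\ge0$, $M_{k+1}$ is $\mathcal G_k^+$-measurable and conditionally square integrable, $\mathbb E[M_{k+1}\mid\mathcal G_k^-]=0$ and $\mathbb E[\|M_{k+1}\|^2\mid\mathcal G_k^-]\le\mathsf m_k^2U_2(W_k)$; (ii) for all $k\ge0$, $B_k$ is $\mathcal G_k^-$-measurable and $\|B_k\|\le\mathsf b_k$; (iii) there are constants $C_{\mathsf M},C_{\mathsf B},\omega_{\mathsf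 M}\ge0$ and $\omega_{\mathsf B}>0$ such that the deterministic scales satisfy $\mathsf m_k\le C_{\mathsf M}(k+1)^{\omega_{\mathsf M}}$ and $\mathsf b_k\le C_{\mathsf B}(k+1)^{-\omega_{\mathsf B}}$ for all $k\ge0$. *)

theory Defs
  imports "HOL-Probability.Probability"
begin


text \<open>A Markov kernel on the measurable space \<open>S\<close> is an element of
  \<open>S \<rightarrow>\<^sub>M prob_algebra S\<close>.\<close>

primrec kernel_pow :: "'w measure \<Rightarrow> ('w \<Rightarrow> 'w measure) \<Rightarrow> nat \<Rightarrow> 'w \<Rightarrow> 'w measure" where
  "kernel_pow S K 0 = return S"
| "kernel_pow S K (Suc n) = (\<lambda>w. K w \<bind> kernel_pow S K n)"

definition irreducibility_measure ::
    "'w measure \<Rightarrow> ('w \<Rightarrow> 'w measure) \<Rightarrow> 'w measure \<Rightarrow> bool" where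
  "irreducibility_measure S K \<psi> \<longleftrightarrow>
     sets \<psi> = sets S \<and> sigma_finite_measure \<psi> \<and> emeasure \<psi> (space S) \<noteq> 0 \<and>
     (\<forall>w\<in>space S. \<forall>E\<in>sets S. emeasure \<psi> E > 0 \<longrightarrow>
        (\<exists>n\<ge>1. measure (kernel_pow S K n w) E > 0))"

definition irreducible_kernel :: "'w measure \<Rightarrow> ('w \<Rightarrow> 'w measure) \<Rightarrow> bool" where
  "irreducible_kernel S K \<longleftrightarrow> (\<exists>\<psi>. irreducibility_measure S K \<psi>)"

definition d_cycle ::
    "'w measure \<Rightarrow> ('w \<Rightarrow> 'w measure) \<Rightarrow> 'w measure \<Rightarrow> nat \<Rightarrow> (nat \<Rightarrow> 'w set) \<Rightarrow> bool" where
  "d_cycle S K \<psi> d D \<longleftrightarrow>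
     (\<forall>i<d. D i \<in> sets S) \<and> disjoint_family_on D {..<d} \<and>
     (\<forall>i<d. \<forall>w\<in>D i. measure (K w) (D (Suc i mod d)) = 1) \<and>
     emeasure \<psi> (space S - (\<Union>i<d. D i)) = 0"

text \<open>The irreducibility measure below need not be maximal. The union of a \<open>d\<close>-cycle is
  absorbing, and a nonempty absorbing set has a complement which is null for every irreducibility
  measure, so being a \<open>d\<close>-cycle does not depend on the choice of \<open>\<psi>\<close>.\<close>

definition aperiodic_kernel :: "'w measure \<Rightarrow> ('w \<Rightarrow> 'w measure) \<Rightarrow> bool" where
  "aperiodic_kernel S K \<longleftrightarrow>
     (\<forall>\<psi> d D. irreducibility_measure S K \<psi> \<longrightarrow> d \<ge> 2 \<longrightarrow> \<not> d_cycle S K \<psi> d D)"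

definition stationary :: "'w measure \<Rightarrow> ('w \<Rightarrow> 'w measure) \<Rightarrow> 'w measure \<Rightarrow> bool" where
  "stationary S K \<nu> \<longleftrightarrow> \<nu> \<in> space (prob_algebra S) \<and> \<nu> \<bind> K = \<nu>"

text \<open>Only meaningful when the stationary distribution exists and is unique.\<close>

definition stationary_distr :: "'w measure \<Rightarrow> ('w \<Rightarrow> 'w measure) \<Rightarrow> 'w measure" where
  "stationary_distr S K = (THE \<nu>. stationary S K \<nu>)"



definition U :: "nat \<Rightarrow> 'w::real_normed_vector \<Rightarrow> real" where
  "U p w = 1 + norm w ^ p"

definition step_size :: "real \<Rightarrow> real \<Rightarrow> nat \<Rightarrow> real" where
  "step_size \<alpha>\<^sub>0 \<delta> k = (if k = 0 then \<alpha>\<^sub>0 else \<alpha>\<^sub>0 * real k powr (- \<delta>))"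

definition model ::
    "'d::euclidean_space set \<Rightarrow> 'w::euclidean_space set \<Rightarrow> ('d \<Rightarrow> 'w \<Rightarrow> 'd) \<Rightarrow>
     ('d \<Rightarrow> 'w \<Rightarrow> 'w measure) \<Rightarrow> bool" where
  "model \<Theta> \<W> F P \<longleftrightarrow>
     \<W> \<in> sets borel \<and>
     (\<lambda>(\<theta>, w). F \<theta> w) \<in> borel_measurable (restrict_space borel \<Theta> \<Otimes>\<^sub>M restrict_space borel \<W>) \<and>
     (\<lambda>(\<theta>, w). P \<theta> w) \<in>
       restrict_space borel \<Theta> \<Otimes>\<^sub>M restrict_space borel \<W> \<rightarrow>\<^sub>M prob_algebra (restrict_space borel \<W>)"

definition mean_field ::
    "'w::euclidean_space set \<Rightarrow> ('d \<Rightarrow> 'w \<Rightarrow> 'd::euclidean_space) \<Rightarrow>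
     ('d \<Rightarrow> 'w \<Rightarrow> 'w measure) \<Rightarrow> 'd \<Rightarrow> 'd" where
  "mean_field \<W> F P \<theta> =
     (\<integral>w. F \<theta> w \<partial>stationary_distr (restrict_space borel \<W>) (P \<theta>))"

text \<open>The drift inequality is stated with the nonnegative integral, so that it includes
  \<open>P\<^sub>\<theta> U\<^sub>2 < \<infinity>\<close>; a Bochner integral would be \<open>0\<close> for non-integrable \<open>U\<^sub>2\<close>.\<close>

definition uniform_ergodicity ::
    "'d set \<Rightarrow> 'w::euclidean_space set \<Rightarrow> ('d \<Rightarrow> 'w \<Rightarrow> 'w measure) \<Rightarrow>
     nat \<Rightarrow> 'w set \<Rightarrow> real \<Rightarrow> 'w measure \<Rightarrow> real \<Rightarrow> real \<Rightarrow> bool" where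
  "uniform_ergodicity \<Theta> \<W> P N \<W>\<^sub>0 \<epsilon>\<^sub>0 \<phi> lam b \<longleftrightarrow>
     (let S = restrict_space borel \<W> in
       (\<forall>\<theta>\<in>\<Theta>. irreducible_kernel S (P \<theta>) \<and> aperiodic_kernel S (P \<theta>)) \<and>
       N > 0 \<and> \<W>\<^sub>0 \<noteq> {} \<and> \<W>\<^sub>0 \<in> sets S \<and> \<epsilon>\<^sub>0 > 0 \<and> \<phi> \<in> space (prob_algebra S) \<and>
       (\<forall>\<theta>\<in>\<Theta>. \<forall>w\<in>\<W>\<^sub>0. \<forall>E\<in>sets S.
          measure (kernel_pow S (P \<theta>) N w) E \<ge> \<epsilon>\<^sub>0 * measure \<phi> E) \<and>
       0 \<le> lam \<and> lam < 1 \<and> b \<ge> 0 \<and>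
       (\<forall>\<theta>\<in>\<Theta>. \<forall>w\<in>\<W>.
          (\<integral>\<^sup>+y. ennreal (U 2 y) \<partial>P \<theta> w) \<le> ennreal (lam * U 2 w + b * indicator \<W>\<^sub>0 w)))"

definition kernel_continuity ::
    "'d::euclidean_space set \<Rightarrow> 'w::euclidean_space set \<Rightarrow> ('d \<Rightarrow> 'w \<Rightarrow> 'w measure) \<Rightarrow>
     real \<Rightarrow> bool" where
  "kernel_continuity \<Theta> \<W> P L\<^sub>P \<longleftrightarrow>
     L\<^sub>P > 0 \<and>
     (\<forall>\<theta>\<in>\<Theta>. \<forall>\<theta>'\<in>\<Theta>. \<forall>w\<in>\<W>. \<forall>f :: 'w \<Rightarrow> real.
        f \<in> borel_measurable (restrict_space borel \<W>) \<longrightarrow> (\<forall>y\<in>\<W>. \<bar>f y\<bar> \<le> U 1 y) \<longrightarrow>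
        \<bar>(\<integral>y. f y \<partial>P \<theta> w) - (\<integral>y. f y \<partial>P \<theta>' w)\<bar> \<le> L\<^sub>P * U 1 w * norm (\<theta> - \<theta>'))"

definition growth ::
    "'d::euclidean_space set \<Rightarrow> 'w::euclidean_space set \<Rightarrow> ('d \<Rightarrow> 'w \<Rightarrow> 'd) \<Rightarrow>
     real \<Rightarrow> real \<Rightarrow> bool" where
  "growth \<Theta> \<W> F L\<^sub>F C\<^sub>F \<longleftrightarrow>
     L\<^sub>F > 0 \<and> C\<^sub>F > 0 \<and>
     (\<forall>\<theta>\<in>\<Theta>. \<forall>\<theta>'\<in>\<Theta>. \<forall>w\<in>\<W>. norm (F \<theta> w - F \<theta>' w) \<le> L\<^sub>F * (1 + norm w) * norm (\<theta> - \<theta>')) \<and>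
     (\<forall>\<theta>\<in>\<Theta>. \<forall>w\<in>\<W>. norm (F \<theta> w) \<le> C\<^sub>F * (1 + norm w))"

definition error_scales ::
    "(nat \<Rightarrow> real) \<Rightarrow> (nat \<Rightarrow> real) \<Rightarrow> real \<Rightarrow> real \<Rightarrow> real \<Rightarrow> real \<Rightarrow> bool" where
  "error_scales m b C\<^sub>M C\<^sub>B \<omega>\<^sub>M \<omega>\<^sub>B \<longleftrightarrow>
     C\<^sub>M \<ge> 0 \<and> C\<^sub>B \<ge> 0 \<and> \<omega>\<^sub>M \<ge> 0 \<and> \<omega>\<^sub>B > 0 \<and>
     (\<forall>k. 0 \<le> m k \<and> m k \<le> C\<^sub>M * real (k + 1) powr \<omega>\<^sub>M) \<and>
     (\<forall>k. 0 \<le> b k \<and> b k \<le> C\<^sub>B * real (k + 1) powr (- \<omega>\<^sub>B))"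



definition join_sigma :: "'a measure \<Rightarrow> ('a \<Rightarrow> 'c) \<Rightarrow> 'c measure \<Rightarrow> 'a measure" where
  "join_sigma G f X = sigma (space G) (sets G \<union> sets (vimage_algebra (space G) f X))"

text \<open>The variable \<open>\<xi> (Suc k)\<close> takes values in the measurable space \<open>X (Suc k)\<close>.\<close>

primrec Gminus ::
    "'a measure \<Rightarrow> (nat \<Rightarrow> 'a \<Rightarrow> 'd::euclidean_space) \<Rightarrow> (nat \<Rightarrow> 'a \<Rightarrow> 'w::euclidean_space) \<Rightarrow>
     (nat \<Rightarrow> 'a \<Rightarrow> 'c) \<Rightarrow> (nat \<Rightarrow> 'c measure) \<Rightarrow> nat \<Rightarrow> 'a measure" where
  "Gminus \<Omega> \<theta> W \<xi> X 0 = vimage_algebra (space \<Omega>) (\<lambda>x. (\<theta> 0 x, W 0 x)) (borel \<Otimes>\<^sub>M borel)"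
| "Gminus \<Omega> \<theta> W \<xi> X (Suc k) =
     join_sigma (join_sigma (Gminus \<Omega> \<theta> W \<xi> X k) (\<xi> (Suc k)) (X (Suc k))) (W (Suc k)) borel"

definition Gplus ::
    "'a measure \<Rightarrow> (nat \<Rightarrow> 'a \<Rightarrow> 'd::euclidean_space) \<Rightarrow> (nat \<Rightarrow> 'a \<Rightarrow> 'w::euclidean_space) \<Rightarrow>
     (nat \<Rightarrow> 'a \<Rightarrow> 'c) \<Rightarrow> (nat \<Rightarrow> 'c measure) \<Rightarrow> nat \<Rightarrow> 'a measure" where
  "Gplus \<Omega> \<theta> W \<xi> X k = join_sigma (Gminus \<Omega> \<theta> W \<xi> X k) (\<xi> (Suc k)) (X (Suc k))"

definition extended_recursion ::
    "'a measure \<Rightarrow> 'd::euclidean_space set \<Rightarrow> 'w::euclidean_space set \<Rightarrow> ('d \<Rightarrow> 'w \<Rightarrow> 'd) \<Rightarrow>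
     ('d \<Rightarrow> 'w \<Rightarrow> 'w measure) \<Rightarrow> (nat \<Rightarrow> real) \<Rightarrow>
     (nat \<Rightarrow> 'a \<Rightarrow> 'd) \<Rightarrow> (nat \<Rightarrow> 'a \<Rightarrow> 'w) \<Rightarrow> (nat \<Rightarrow> 'a \<Rightarrow> 'c) \<Rightarrow> (nat \<Rightarrow> 'c measure) \<Rightarrow>
     (nat \<Rightarrow> 'a \<Rightarrow> 'd) \<Rightarrow> (nat \<Rightarrow> 'a \<Rightarrow> 'd) \<Rightarrow> bool" where
  "extended_recursion \<Omega> \<Theta> \<W> F P \<alpha> \<theta> W \<xi> X M B \<longleftrightarrow>
     prob_space \<Omega> \<and>
     (\<forall>k. \<theta> k \<in> \<Omega> \<rightarrow>\<^sub>M restrict_space borel \<Theta>) \<and>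
     (\<forall>k. W k \<in> \<Omega> \<rightarrow>\<^sub>M restrict_space borel \<W>) \<and>
     (\<forall>k. \<xi> (Suc k) \<in> \<Omega> \<rightarrow>\<^sub>M X (Suc k)) \<and>
     (\<forall>k. M (Suc k) \<in> borel_measurable \<Omega>) \<and>
     (\<forall>k. M (Suc k) \<in> borel_measurable (vimage_algebra (space \<Omega>) (\<xi> (Suc k)) (X (Suc k)))) \<and>
     (\<forall>k. B k \<in> borel_measurable \<Omega>) \<and>
     (\<forall>k. AE x in \<Omega>. \<theta> (Suc k) x =
        closest_point \<Theta> (\<theta> k x + \<alpha> k *\<^sub>R (F (\<theta> k x) (W k x) + M (Suc k) x + B k x))) \<and>
     (\<forall>k. \<theta> k \<in> borel_measurable (Gminus \<Omega> \<theta> W \<xi> X k)) \<and>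
     (\<forall>k. W k \<in> borel_measurable (Gminus \<Omega> \<theta> W \<xi> X k)) \<and>
     (\<forall>k. B k \<in> borel_measurable (Gminus \<Omega> \<theta> W \<xi> X k)) \<and>
     (\<forall>k. \<forall>E\<in>sets (restrict_space borel \<W>). AE x in \<Omega>.
        real_cond_exp \<Omega> (Gplus \<Omega> \<theta> W \<xi> X k) (\<lambda>x'. indicator E (W (Suc k) x')) x
          = measure (P (\<theta> k x) (W k x)) E)"

text \<open>The conditional mean of the vector \<open>M (Suc k)\<close> is taken coordinatewise. Its conditional second
  moment is an extended nonnegative function, so its finiteness is conditional square
  integrability.\<close>

definition error_process ::
    "'a measure \<Rightarrow> (nat \<Rightarrow> 'a measure) \<Rightarrow> (nat \<Rightarrow> 'a measure) \<Rightarrow> (nat \<Rightarrow> 'a \<Rightarrow> 'w::euclidean_space) \<Rightarrow>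
     (nat \<Rightarrow> 'a \<Rightarrow> 'd::euclidean_space) \<Rightarrow> (nat \<Rightarrow> 'a \<Rightarrow> 'd) \<Rightarrow>
     (nat \<Rightarrow> real) \<Rightarrow> (nat \<Rightarrow> real) \<Rightarrow> bool" where
  "error_process \<Omega> Gm Gp W M B m b \<longleftrightarrow>
     (\<forall>k. M (Suc k) \<in> borel_measurable (Gp k) \<and>
        (AE x in \<Omega>. nn_cond_exp \<Omega> (Gm k) (\<lambda>x'. ennreal (norm (M (Suc k) x') ^ 2)) x < \<infinity>) \<and>
        (\<forall>i\<in>Basis. AE x in \<Omega>. real_cond_exp \<Omega> (Gm k) (\<lambda>x'. M (Suc k) x' \<bullet> i) x = 0) \<and>
        (AE x in \<Omega>. nn_cond_exp \<Omega> (Gm k) (\<lambda>x'. ennreal (norm (M (Suc k) x') ^ 2)) x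
           \<le> ennreal ((m k)\<^sup>2 * U 2 (W k x)))) \<and>
     (\<forall>k. B k \<in> borel_measurable (Gm k) \<and> (AE x in \<Omega>. norm (B k x) \<le> b k))"

end

theory Submission
  imports Defs
begin

text \<open>Let \<open>D\<^sub>k\<close> be the squared distance of \<open>\<theta>\<^sub>k\<close> from the target. The projection does not increase this
distance, so one step changes \<open>D\<^sub>k\<close> by at most twice the step size \<open>\<alpha>\<^sub>k\<close> times the inner product of
\<open>\<theta>\<^sub>k - \<theta>\<^sup>*\<close> with the increment \<open>F(\<theta>\<^sub>k, W\<^sub>k) + M + B\<close>, plus \<open>\<alpha>\<^sub>k\<^sup>2\<close> times the square of the increment.
If \<open>F(\<theta>\<^sub>k, W\<^sub>k)\<close> could be replaced by the mean field, quasi-strong monotonicity would contract \<open>D\<^sub>k\<close> by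
the factor \<open>1 - 2 \<zeta> \<alpha>\<^sub>k\<close>; the noise would be orthogonal and enter only through its second moment, the
bias would enter through Young's inequality, and the rate would follow from the scalar recursion
\<open>recursion_rate\<close>.

The replacement is made by the Poisson equation. The function \<open>f\<^sub>\<theta>(w) = (\<theta> - \<theta>\<^sup>*) \<bullet> F(\<theta>, w)\<close> has a
corrector \<open>u\<^sub>\<theta>\<close> with \<open>u\<^sub>\<theta> - P\<^sub>\<theta> u\<^sub>\<theta> = f\<^sub>\<theta> - \<nu>\<^sub>\<theta>(f\<^sub>\<theta>)\<close>. As the next state has conditional law
\<open>P\<close> at the current parameter and state, the expected fluctuation of \<open>f\<close> about its mean is the expected
difference of \<open>u\<close> at two consecutive states. Up to the change of the parameter in one step this
telescopes, so that \<open>D\<^sub>k\<close> plus \<open>2 \<alpha>\<^sub>k u\<close> satisfies the recursion of the mean field with errors of order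
\<open>\<alpha>\<^sub>k\<^sup>2\<close> (\<open>one_step\<close>, \<open>dev_rate\<close>). This needs correctors that are bounded by a multiple of \<open>1 + |w|\<close>
and, with this weight, Lipschitz in the parameter, uniformly over the compact parameter set
(\<open>poisson_family\<close>).

To construct the corrector of a single kernel, pass to its resolvent \<open>K\<close>. It has the same stationary
laws, it inherits the drift condition with the image \<open>s\<close> of the indicator of the small set under \<open>K\<close> in
place of that indicator, and it satisfies a one-step minorization \<open>K \<ge> \<epsilon> s \<otimes> \<phi>\<close>. Hence
\<open>Q = K - \<epsilon> s \<otimes> \<phi>\<close> is a positive operator, and after a suitable constant is added to the drift function
the drift makes \<open>Q\<close> a strict contraction in the weighted supremum norm (\<open>Q_weight\<close>). The Neumann series
\<open>G\<close> of \<open>Q\<close> then gives everything: the law proportional to \<open>\<phi> G\<close> is stationary and is the only one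
(\<open>nu_stationary\<close>, \<open>stationary_unique\<close>), and \<open>G\<close> yields solutions of the Poisson equation with a
bound in terms of the drift and minorization constants alone (\<open>poisson_eq\<close>, \<open>poisson_dominated\<close>). The
difference of two correctors solves a Poisson equation whose right-hand side is small by kernel
continuity, which yields the Lipschitz bound.

All estimates are integrated over an arbitrary event of the initial sigma-algebra and bounded by the
integral of \<open>U 2 (W 0)\<close> over the same event; this is equivalent to the conditional bound.\<close>

section \<open>Kernel operators on functions bounded by a weight\<close>

locale weighted_functions =
  fixes S :: "'w measure" and V :: "'w \<Rightarrow> real"
  assumes V_measurable [measurable]: "V \<in> borel_measurable S"
    and V_ge_1: "x \<in> space S \<Longrightarrow> 1 \<le> V x"
begin

definition dominated :: "real \<Rightarrow> ('w \<Rightarrow> real) \<Rightarrow> bool" where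
  "dominated c f \<longleftrightarrow> f \<in> borel_measurable S \<and> (\<forall>x\<in>space S. \<bar>f x\<bar> \<le> c * V x)"

definition wfun :: "('w \<Rightarrow> real) \<Rightarrow> bool" where
  "wfun f \<longleftrightarrow> (\<exists>c. dominated c f)"

text \<open>A positive kernel acts on such functions boundedly and linearly, and dominated convergence makes it
continuous along dominated sequences. The last clause keeps this continuity because a set function
\<open>E \<mapsto> T (indicator E) x\<close> is countably additive only through it; differences of kernels satisfy the
three clauses too, so they need no separate treatment.\<close>

definition kernel_op :: "real \<Rightarrow> (('w \<Rightarrow> real) \<Rightarrow> 'w \<Rightarrow> real) \<Rightarrow> bool" where
  "kernel_op C T \<longleftrightarrow>
     (\<forall>c f. dominated c f \<longrightarrow> dominated (C * c) (T f)) \<and>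
     (\<forall>f g a. wfun f \<longrightarrow> wfun g \<longrightarrow>
        (\<forall>x\<in>space S. T (\<lambda>y. a * f y + g y) x = a * T f x + T g x)) \<and>
     (\<forall>c f. (\<forall>i::nat. dominated c (f i)) \<longrightarrow> (\<forall>x\<in>space S. (\<lambda>i. f i x) \<longlonglongrightarrow> 0) \<longrightarrow>
        (\<forall>x\<in>space S. (\<lambda>i. T (f i) x) \<longlonglongrightarrow> 0))"

lemma V_nonneg: "x \<in> space S \<Longrightarrow> 0 \<le> V x"
  using V_ge_1[of x] by simp

lemma dominated_wfun: "dominated c f \<Longrightarrow> wfun f"
  by (auto simp: wfun_def)

lemma dominated_measurable [measurable_dest]: "dominated c f \<Longrightarrow> f \<in> borel_measurable S"
  by (simp add: dominated_def)

lemma wfun_measurable [measurable_dest]: "wfun f \<Longrightarrow> f \<in> borel_measurable S"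
  by (auto simp: wfun_def dominated_def)

lemma dominatedD: "dominated c f \<Longrightarrow> x \<in> space S \<Longrightarrow> \<bar>f x\<bar> \<le> c * V x"
  by (simp add: dominated_def)

lemma dominated_const_nonneg: "dominated c f \<Longrightarrow> x \<in> space S \<Longrightarrow> 0 \<le> c"
  using dominatedD[of c f x] V_ge_1[of x] zero_le_mult_iff[of c "V x"] by linarith

lemma dominated_mono: "dominated c f \<Longrightarrow> c \<le> d \<Longrightarrow> dominated d f"
  unfolding dominated_def using V_nonneg mult_right_mono[of c d] by fastforce

lemma dominated_mult_mono:
  assumes f: "dominated (C * c) f" and "C \<le> D" and g: "dominated c g"
  shows "dominated (D * c) f"
proof -
  have "C * c * V x \<le> D * c * V x" if "x \<in> space S" for x
    using \<open>C \<le> D\<close> dominated_const_nonneg[OF g that] V_nonneg[OF that] by (intro mult_right_mono) auto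
  with f show ?thesis unfolding dominated_def by (meson order_trans)
qed

lemma dominated_lincomb:
  assumes "dominated c f" "dominated d g"
  shows "dominated (\<bar>a\<bar> * c + d) (\<lambda>x. a * f x + g x)"
  unfolding dominated_def
proof (intro conjI ballI)
  show "(\<lambda>x. a * f x + g x) \<in> borel_measurable S" using assms by measurable
  fix x assume x: "x \<in> space S"
  have "\<bar>a * f x + g x\<bar> \<le> \<bar>a\<bar> * \<bar>f x\<bar> + \<bar>g x\<bar>" by (metis abs_mult abs_triangle_ineq)
  also have "\<dots> \<le> \<bar>a\<bar> * (c * V x) + d * V x"
    using dominatedD[OF assms(1) x] dominatedD[OF assms(2) x] by (intro add_mono mult_left_mono) auto
  finally show "\<bar>a * f x + g x\<bar> \<le> (\<bar>a\<bar> * c + d) * V x" by (simp add: algebra_simps)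
qed

lemma wfun_lincomb: "wfun f \<Longrightarrow> wfun g \<Longrightarrow> wfun (\<lambda>x. a * f x + g x)"
  using dominated_lincomb unfolding wfun_def by blast

lemma dominated_const: "dominated \<bar>k\<bar> (\<lambda>_. k)"
  unfolding dominated_def using mult_left_mono[OF V_ge_1, of _ "\<bar>k\<bar>"] by simp

lemma wfun_const: "wfun (\<lambda>_. k)" using dominated_const wfun_def by blast

lemma dominated_zero: "dominated 0 (\<lambda>_. 0)" by (simp add: dominated_def)

lemma wfun_cmult: "wfun f \<Longrightarrow> wfun (\<lambda>x. a * f x)"
  using wfun_lincomb[of f "\<lambda>_. 0" a] wfun_const by simp

lemma wfun_diff: "wfun f \<Longrightarrow> wfun g \<Longrightarrow> wfun (\<lambda>x. f x - g x)"
  using wfun_lincomb[of g f "-1"] by simp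

lemma dominated_diff: "dominated c f \<Longrightarrow> dominated d g \<Longrightarrow> dominated (c + d) (\<lambda>x. f x - g x)"
  using dominated_lincomb[of d g c f "-1"] by (simp add: add.commute)

lemma dominated_cmult: "dominated c f \<Longrightarrow> dominated (\<bar>a\<bar> * c) (\<lambda>x. a * f x)"
  using dominated_lincomb[of c f 0 "\<lambda>_. 0" a] dominated_zero by simp

lemma dominated_weight: "dominated 1 V"
  unfolding dominated_def using V_nonneg by auto

lemma wfun_weight: "wfun V" using dominated_weight wfun_def by blast

lemma dominated_bounded:
  assumes f: "f \<in> borel_measurable S" "\<And>x. x \<in> space S \<Longrightarrow> \<bar>f x\<bar> \<le> c"
  shows "dominated \<bar>c\<bar> f"
proof -
  have "\<bar>f x\<bar> \<le> \<bar>c\<bar> * V x" if "x \<in> space S" for x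
    using f(2)[OF that] mult_left_mono[OF V_ge_1[OF that], of "\<bar>c\<bar>"] by linarith
  with f(1) show ?thesis by (simp add: dominated_def)
qed

lemma wfun_indicator: "E \<in> sets S \<Longrightarrow> wfun (indicator E)"
  unfolding wfun_def by (rule exI, rule dominated_bounded[of _ 1]) (auto simp: indicator_def)

lemma dominated_indicator: "E \<in> sets S \<Longrightarrow> dominated 1 (indicator E)"
  using dominated_bounded[of "indicator E" 1] by (auto simp: indicator_def)

subsection \<open>Closure properties\<close>

lemma kernel_op_dominated: "kernel_op C T \<Longrightarrow> dominated c f \<Longrightarrow> dominated (C * c) (T f)"
  by (simp add: kernel_op_def)

lemma kernel_op_wfun: "kernel_op C T \<Longrightarrow> wfun f \<Longrightarrow> wfun (T f)"
  unfolding wfun_def using kernel_op_dominated by blast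

lemma kernel_op_lincomb:
  "kernel_op C T \<Longrightarrow> wfun f \<Longrightarrow> wfun g \<Longrightarrow> x \<in> space S \<Longrightarrow>
   T (\<lambda>y. a * f y + g y) x = a * T f x + T g x"
  by (simp add: kernel_op_def)

lemma kernel_op_null:
  "kernel_op C T \<Longrightarrow> (\<And>i::nat. dominated c (f i)) \<Longrightarrow> (\<And>x. x \<in> space S \<Longrightarrow> (\<lambda>i. f i x) \<longlonglongrightarrow> 0) \<Longrightarrow>
   x \<in> space S \<Longrightarrow> (\<lambda>i. T (f i) x) \<longlonglongrightarrow> 0"
  unfolding kernel_op_def by blast

lemma kernel_op_zero: "kernel_op C T \<Longrightarrow> x \<in> space S \<Longrightarrow> T (\<lambda>_. 0) x = 0"
  using dominatedD[OF kernel_op_dominated[OF _ dominated_zero], of C T x] by simp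

lemma kernel_op_add:
  "kernel_op C T \<Longrightarrow> wfun f \<Longrightarrow> wfun g \<Longrightarrow> x \<in> space S \<Longrightarrow> T (\<lambda>y. f y + g y) x = T f x + T g x"
  using kernel_op_lincomb[of C T f g x 1] by simp

lemma kernel_op_cmult:
  "kernel_op C T \<Longrightarrow> wfun f \<Longrightarrow> x \<in> space S \<Longrightarrow> T (\<lambda>y. a * f y) x = a * T f x"
  using kernel_op_lincomb[of C T f "\<lambda>_. 0" x a] wfun_const kernel_op_zero[of C T x] by simp

lemma kernel_op_diff:
  "kernel_op C T \<Longrightarrow> wfun f \<Longrightarrow> wfun g \<Longrightarrow> x \<in> space S \<Longrightarrow> T (\<lambda>y. f y - g y) x = T f x - T g x"
  using kernel_op_lincomb[of C T g f x "-1"] by simp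

lemma kernel_op_cong:
  assumes "kernel_op C T" "wfun f" "wfun g" "\<And>y. y \<in> space S \<Longrightarrow> f y = g y" "x \<in> space S"
  shows "T f x = T g x"
proof -
  have "dominated 0 (\<lambda>y. f y - g y)"
    using wfun_diff[OF assms(2,3)] assms(4) by (auto simp: dominated_def wfun_def)
  from dominatedD[OF kernel_op_dominated[OF assms(1) this] assms(5)] have "T (\<lambda>y. f y - g y) x = 0"
    by simp
  with kernel_op_diff[OF assms(1,2,3,5)] show ?thesis by simp
qed

lemma kernel_op_tendsto:
  assumes "kernel_op C T" "\<And>i::nat. dominated c (f i)" "dominated d g"
    and "\<And>x. x \<in> space S \<Longrightarrow> (\<lambda>i. f i x) \<longlonglongrightarrow> g x" and x: "x \<in> space S"
  shows "(\<lambda>i. T (f i) x) \<longlonglongrightarrow> T g x"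
proof -
  have "(\<lambda>i. T (\<lambda>y. f i y - g y) x) \<longlonglongrightarrow> 0"
    by (rule kernel_op_null[OF assms(1) dominated_diff[OF assms(2,3)] _ x])
       (use assms(4) LIM_zero in blast)
  then have "(\<lambda>i. T (f i) x - T g x) \<longlonglongrightarrow> 0"
    by (simp add: kernel_op_diff[OF assms(1) dominated_wfun[OF assms(2)] dominated_wfun[OF assms(3)] x])
  then show ?thesis by (rule LIM_zero_cancel)
qed

lemma kernel_op_mono_const: "kernel_op C T \<Longrightarrow> C \<le> D \<Longrightarrow> kernel_op D T"
  unfolding kernel_op_def using dominated_mult_mono[of C _ _ D] by blast

lemma kernel_op_id: "kernel_op 1 (\<lambda>f. f)"
  by (simp add: kernel_op_def)

lemma kernel_op_comp:
  assumes "kernel_op C T" "kernel_op D R"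
  shows "kernel_op (C * D) (\<lambda>f. T (R f))"
  unfolding kernel_op_def
proof (intro conjI allI impI ballI)
  show "dominated (C * D * c) (T (R f))" if "dominated c f" for c f
    using kernel_op_dominated[OF assms(1) kernel_op_dominated[OF assms(2) that]] by (simp add: mult.assoc)
next
  fix f g a x assume fg: "wfun f" "wfun g" and x: "x \<in> space S"
  have "T (R (\<lambda>y. a * f y + g y)) x = T (\<lambda>y. a * R f y + R g y) x"
    by (rule kernel_op_cong[OF assms(1) _ _ _ x])
       (auto intro!: kernel_op_wfun[OF assms(2)] wfun_lincomb fg kernel_op_lincomb[OF assms(2)])
  also have "\<dots> = a * T (R f) x + T (R g) x"
    by (intro kernel_op_lincomb[OF assms(1)] kernel_op_wfun[OF assms(2)] fg x)
  finally show "T (R (\<lambda>y. a * f y + g y)) x = a * T (R f) x + T (R g) x" .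
next
  fix c f x assume "\<forall>i::nat. dominated c (f i)" "\<forall>x\<in>space S. (\<lambda>i. f i x) \<longlonglongrightarrow> 0" "x \<in> space S"
  then show "(\<lambda>i. T (R (f i)) x) \<longlonglongrightarrow> 0"
    by (intro kernel_op_null[OF assms(1) kernel_op_dominated[OF assms(2)]] kernel_op_null[OF assms(2)]) auto
qed

lemma kernel_op_lincomb_op:
  assumes "kernel_op C T" "kernel_op D R"
  shows "kernel_op (\<bar>a\<bar> * C + D) (\<lambda>f x. a * T f x + R f x)"
  unfolding kernel_op_def
proof (intro conjI allI impI ballI)
  show "dominated ((\<bar>a\<bar> * C + D) * c) (\<lambda>x. a * T f x + R f x)" if "dominated c f" for c f
    using dominated_lincomb[OF kernel_op_dominated[OF assms(1) that] kernel_op_dominated[OF assms(2) that]]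
    by (simp add: algebra_simps)
next
  fix f g b x assume fg: "wfun f" "wfun g" and x: "x \<in> space S"
  show "a * T (\<lambda>y. b * f y + g y) x + R (\<lambda>y. b * f y + g y) x = b * (a * T f x + R f x) + (a * T g x + R g x)"
    unfolding kernel_op_lincomb[OF assms(1) fg x] kernel_op_lincomb[OF assms(2) fg x] by (simp add: algebra_simps)
next
  fix c f x assume "\<forall>i::nat. dominated c (f i)" "\<forall>x\<in>space S. (\<lambda>i. f i x) \<longlonglongrightarrow> 0" "x \<in> space S"
  then have "(\<lambda>i. T (f i) x) \<longlonglongrightarrow> 0" "(\<lambda>i. R (f i) x) \<longlonglongrightarrow> 0"
    using kernel_op_null[OF assms(1)] kernel_op_null[OF assms(2)] by blast+
  then show "(\<lambda>i. a * T (f i) x + R (f i) x) \<longlonglongrightarrow> 0"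
    using tendsto_add[OF tendsto_mult_left[of _ 0 _ a], of "\<lambda>i. T (f i) x" sequentially "\<lambda>i. R (f i) x" 0] by simp
qed

lemma kernel_op_scale: "kernel_op C T \<Longrightarrow> kernel_op (\<bar>a\<bar> * C) (\<lambda>f x. a * T f x)"
  using kernel_op_lincomb_op[of C T 0 "\<lambda>f x. 0" a] by (simp add: kernel_op_def dominated_zero)

lemma kernel_op_funpow: "kernel_op C T \<Longrightarrow> kernel_op (C ^ n) (T ^^ n)"
proof (induction n)
  case 0 then show ?case using kernel_op_id by (simp add: id_def)
next
  case (Suc n)
  from kernel_op_comp[OF Suc.prems Suc.IH[OF Suc.prems]] show ?case by (simp add: comp_def)
qed

lemma integrable_wfun:
  assumes "sets M = sets S" "integrable M V" "wfun f"
  shows "integrable M f"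
proof -
  obtain c where c: "dominated c f" using assms(3) wfun_def by blast
  have sp: "space M = space S" using assms(1) sets_eq_imp_space_eq by blast
  show ?thesis
  proof (rule Bochner_Integration.integrable_bound[of M "\<lambda>x. c * V x"])
    show "f \<in> borel_measurable M" using dominated_measurable[OF c] by (simp add: measurable_cong_sets[OF assms(1) refl])
    show "AE x in M. norm (f x) \<le> norm (c * V x)"
      using dominatedD[OF c] by (intro AE_I2) (auto simp: sp intro: order_trans[OF _ abs_ge_self])
  qed (use assms(2) in simp)
qed

text \<open>Dominated convergence, with a multiple of the weight as the integrable majorant.\<close>

lemma integral_null:
  assumes M: "sets M = sets S" "integrable M V"
    and "\<And>i::nat. dominated c (f i)" "\<And>x. x \<in> space S \<Longrightarrow> (\<lambda>i. f i x) \<longlonglongrightarrow> 0"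
  shows "(\<lambda>i. \<integral>x. f i x \<partial>M) \<longlonglongrightarrow> 0"
proof -
  have sp: "space M = space S" using M(1) sets_eq_imp_space_eq by blast
  have "(\<lambda>i. \<integral>x. f i x \<partial>M) \<longlonglongrightarrow> (\<integral>x. 0 \<partial>M)"
  proof (rule integral_dominated_convergence[where w="\<lambda>x. c * V x"])
    show "f i \<in> borel_measurable M" for i
      using dominated_measurable[OF assms(3)] by (simp add: measurable_cong_sets[OF M(1) refl])
    show "AE x in M. norm (f i x) \<le> c * V x" for i
      using dominatedD[OF assms(3)] by (intro AE_I2) (auto simp: sp)
    show "AE x in M. (\<lambda>i. f i x) \<longlonglongrightarrow> 0" using assms(4) by (intro AE_I2) (auto simp: sp)
  qed (use M in auto)
  then show ?thesis by simp
qed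

lemma abs_integral_le:
  assumes "sets M = sets S" "integrable M V" "dominated c f"
  shows "\<bar>\<integral>x. f x \<partial>M\<bar> \<le> c * (\<integral>x. V x \<partial>M)"
proof -
  have sp: "space M = space S" using assms(1) sets_eq_imp_space_eq by blast
  have "\<bar>\<integral>x. f x \<partial>M\<bar> \<le> (\<integral>x. c * V x \<partial>M)"
    using dominatedD[OF assms(3)] assms(2) integrable_wfun[OF assms(1,2) dominated_wfun[OF assms(3)]]
    by (intro integral_abs_bound[THEN order_trans] integral_mono) (auto simp: sp)
  then show ?thesis by simp
qed

lemma kernel_op_integral:
  assumes p: "p \<in> S \<rightarrow>\<^sub>M prob_algebra S"
    and V: "\<And>x. x \<in> space S \<Longrightarrow> (\<integral>\<^sup>+y. ennreal (V y) \<partial>p x) \<le> ennreal (C * V x)" and C: "0 \<le> C"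
  shows "kernel_op C (\<lambda>f x. \<integral>y. f y \<partial>p x)"
    and "x \<in> space S \<Longrightarrow> integrable (p x) V"
proof -
  have st: "sets (p x) = sets S" if "x \<in> space S" for x
    using measurable_space[OF p that] by (simp add: space_prob_algebra)
  have sp: "space (p x) = space S" if "x \<in> space S" for x
    using st[OF that] sets_eq_imp_space_eq by blast
  have int: "integrable (p x) V" if x: "x \<in> space S" for x
  proof (rule integrableI_nonneg)
    show "V \<in> borel_measurable (p x)" using V_measurable by (simp add: measurable_cong_sets[OF st[OF x] refl])
    show "AE y in p x. 0 \<le> V y" using V_nonneg sp[OF x] by (intro AE_I2) auto
    show "(\<integral>\<^sup>+y. ennreal (V y) \<partial>p x) < \<infinity>" using V[OF x] by (simp add: order_le_less_trans)
  qed
  then show "x \<in> space S \<Longrightarrow> integrable (p x) V" .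
  have le: "(\<integral>y. V y \<partial>p x) \<le> C * V x" if x: "x \<in> space S" for x
  proof -
    have "ennreal (\<integral>y. V y \<partial>p x) = (\<integral>\<^sup>+y. ennreal (V y) \<partial>p x)"
      using int[OF x] V_nonneg sp[OF x] by (intro nn_integral_eq_integral[symmetric] AE_I2) auto
    also note V[OF x]
    finally show ?thesis using C V_nonneg[OF x] by (simp add: ennreal_le_iff)
  qed
  show "kernel_op C (\<lambda>f x. \<integral>y. f y \<partial>p x)"
    unfolding kernel_op_def
  proof (intro conjI allI impI ballI)
    fix c f assume f: "dominated c f"
    note [measurable] = measurable_prob_algebraD[OF p] dominated_measurable[OF f]
    show "dominated (C * c) (\<lambda>x. \<integral>y. f y \<partial>p x)"
      unfolding dominated_def
    proof (intro conjI ballI)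
      show "(\<lambda>x. \<integral>y. f y \<partial>p x) \<in> borel_measurable S" by measurable
      fix x assume x: "x \<in> space S"
      have "\<bar>\<integral>y. f y \<partial>p x\<bar> \<le> c * (\<integral>y. V y \<partial>p x)" by (rule abs_integral_le[OF st[OF x] int[OF x] f])
      also have "\<dots> \<le> c * (C * V x)" using le[OF x] dominated_const_nonneg[OF f x] by (rule mult_left_mono)
      finally show "\<bar>\<integral>y. f y \<partial>p x\<bar> \<le> C * c * V x" by (simp add: ac_simps)
    qed
  next
    fix f g a x assume fg: "wfun f" "wfun g" and x: "x \<in> space S"
    show "(\<integral>y. a * f y + g y \<partial>p x) = a * (\<integral>y. f y \<partial>p x) + (\<integral>y. g y \<partial>p x)"
      using integrable_wfun[OF st[OF x] int[OF x]] fg by simp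
  next
    fix c f x assume "\<forall>i::nat. dominated c (f i)" "\<forall>x\<in>space S. (\<lambda>i. f i x) \<longlonglongrightarrow> 0" and x: "x \<in> space S"
    then show "(\<lambda>i. \<integral>y. f i y \<partial>p x) \<longlonglongrightarrow> 0"
      by (intro integral_null[OF st[OF x] int[OF x]]) auto
  qed
qed

lemma kernel_op_rank_one:
  assumes "sets M = sets S" "integrable M V" "dominated d s"
  shows "kernel_op (d * (\<integral>x. V x \<partial>M)) (\<lambda>f x. (\<integral>y. f y \<partial>M) * s x)"
  unfolding kernel_op_def
proof (intro conjI allI impI ballI)
  fix c f assume f: "dominated c f"
  show "dominated (d * (\<integral>x. V x \<partial>M) * c) (\<lambda>x. (\<integral>y. f y \<partial>M) * s x)"
    unfolding dominated_def
  proof (intro conjI ballI)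
    show "(\<lambda>x. (\<integral>y. f y \<partial>M) * s x) \<in> borel_measurable S" using assms(3) by measurable
    fix x assume x: "x \<in> space S"
    have "\<bar>(\<integral>y. f y \<partial>M) * s x\<bar> \<le> (c * (\<integral>x. V x \<partial>M)) * (d * V x)"
      unfolding abs_mult using abs_integral_le[OF assms(1,2) f] dominatedD[OF assms(3) x]
      by (intro mult_mono) auto
    then show "\<bar>(\<integral>y. f y \<partial>M) * s x\<bar> \<le> d * (\<integral>x. V x \<partial>M) * c * V x" by (simp add: ac_simps)
  qed
next
  fix f g a x assume fg: "wfun f" "wfun g" and x: "x \<in> space S"
  show "(\<integral>y. a * f y + g y \<partial>M) * s x = a * ((\<integral>y. f y \<partial>M) * s x) + (\<integral>y. g y \<partial>M) * s x"
    using integrable_wfun[OF assms(1,2)] fg by (simp add: algebra_simps)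
next
  fix c f x assume "\<forall>i::nat. dominated c (f i)" "\<forall>x\<in>space S. (\<lambda>i. f i x) \<longlonglongrightarrow> 0"
  then have "(\<lambda>i. \<integral>y. f i y \<partial>M) \<longlonglongrightarrow> 0" by (intro integral_null[OF assms(1,2)]) auto
  then show "(\<lambda>i. (\<integral>y. f i y \<partial>M) * s x) \<longlonglongrightarrow> 0" by (rule tendsto_mult_left_zero)
qed

subsection \<open>Neumann series\<close>

definition neumann :: "(('w \<Rightarrow> real) \<Rightarrow> 'w \<Rightarrow> real) \<Rightarrow> ('w \<Rightarrow> real) \<Rightarrow> 'w \<Rightarrow> real" where
  "neumann T f x = (\<Sum>n. (T ^^ n) f x)"

context
  fixes T r
  assumes T: "kernel_op r T" and r: "0 \<le> r" "r < 1"
begin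

lemma funpow_dominated: "dominated c f \<Longrightarrow> dominated (r ^ n * c) ((T ^^ n) f)"
  by (rule kernel_op_dominated[OF kernel_op_funpow[OF T]])

lemma geometric_summable: "summable (\<lambda>n. r ^ n * c)"
  using r by (intro summable_mult2 summable_geometric) auto

lemma neumann_summable:
  assumes "wfun f" "x \<in> space S" shows "summable (\<lambda>n. (T ^^ n) f x)"
proof -
  obtain c where c: "dominated c f" using assms wfun_def by blast
  show ?thesis
  proof (rule summable_comparison_test')
    show "summable (\<lambda>n. r ^ n * c * V x)" by (rule summable_mult2[OF geometric_summable])
    show "norm ((T ^^ n) f x) \<le> r ^ n * c * V x" for n
      using dominatedD[OF funpow_dominated[OF c] assms(2)] by simp
  qed
qed

lemma neumann_dominated:
  assumes f: "dominated c f" shows "dominated (1 / (1 - r) * c) (neumann T f)"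
  unfolding dominated_def
proof (intro conjI ballI)
  have [measurable]: "(T ^^ n) f \<in> borel_measurable S" for n
    using dominated_measurable[OF funpow_dominated[OF f]] .
  show "neumann T f \<in> borel_measurable S" unfolding neumann_def[abs_def] by measurable
  fix x assume x: "x \<in> space S"
  have "\<bar>neumann T f x\<bar> \<le> (\<Sum>n. r ^ n * c * V x)"
    unfolding neumann_def real_norm_def[symmetric]
  proof (rule norm_suminf_le)
    show "norm ((T ^^ n) f x) \<le> r ^ n * c * V x" for n
      using dominatedD[OF funpow_dominated[OF f] x] by simp
    show "summable (\<lambda>n. r ^ n * c * V x)" by (rule summable_mult2[OF geometric_summable])
  qed
  also have "\<dots> = (\<Sum>n. r ^ n * (c * V x))" by (simp add: mult.assoc)
  also have "\<dots> = (\<Sum>n. r ^ n) * (c * V x)"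
    using r by (simp add: suminf_mult2[symmetric] summable_geometric)
  also have "\<dots> = 1 / (1 - r) * c * V x"
    using r suminf_geometric[of r] by simp
  finally show "\<bar>neumann T f x\<bar> \<le> 1 / (1 - r) * c * V x" .
qed

text \<open>Continuity passes to the series by Tannery's theorem, the terms being dominated by a geometric
series.\<close>

lemma kernel_op_neumann: "kernel_op (1 / (1 - r)) (neumann T)"
  unfolding kernel_op_def
proof (intro conjI allI impI ballI neumann_dominated)
  fix f g a x assume fg: "wfun f" "wfun g" and x: "x \<in> space S"
  show "neumann T (\<lambda>y. a * f y + g y) x = a * neumann T f x + neumann T g x"
    unfolding neumann_def kernel_op_lincomb[OF kernel_op_funpow[OF T] fg x]
    using neumann_summable[OF fg(1) x] neumann_summable[OF fg(2) x]
    by (subst suminf_add[symmetric]) (auto simp: suminf_mult summable_mult)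
next
  fix c f x assume f: "\<forall>i::nat. dominated c (f i)" "\<forall>x\<in>space S. (\<lambda>i. f i x) \<longlonglongrightarrow> 0" and x: "x \<in> space S"
  have "(\<lambda>i. \<Sum>n. (T ^^ n) (f i) x) \<longlonglongrightarrow> (\<Sum>n. 0)"
  proof (rule tannerys_theorem[where M="\<lambda>n. r ^ n * c * V x", THEN conjunct2, THEN conjunct2])
    show "(\<lambda>i. (T ^^ n) (f i) x) \<longlonglongrightarrow> 0" for n
      using f x by (intro kernel_op_null[OF kernel_op_funpow[OF T]]) auto
    show "\<forall>\<^sub>F (n, i) in at_top \<times>\<^sub>F sequentially. norm ((T ^^ n) (f i) x) \<le> r ^ n * c * V x"
      using dominatedD[OF funpow_dominated[OF f(1)[rule_format]] x] by (intro always_eventually) auto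
    show "summable (\<lambda>n. r ^ n * c * V x)" by (rule summable_mult2[OF geometric_summable])
  qed simp
  then show "(\<lambda>i. neumann T (f i) x) \<longlonglongrightarrow> 0" by (simp add: neumann_def)
qed

lemma neumann_right:
  assumes f: "wfun f" and x: "x \<in> space S"
  shows "neumann T (T f) x = neumann T f x - f x"
  unfolding neumann_def using suminf_split_head[OF neumann_summable[OF f x]]
  by (simp add: funpow_swap1)

text \<open>The partial sums are dominated by one multiple of the weight, so continuity of \<open>T\<close> allows it to be
applied to the series term by term.\<close>

lemma neumann_left:
  assumes f: "wfun f" and x: "x \<in> space S"
  shows "T (neumann T f) x = neumann T f x - f x"
proof -
  obtain c where c: "dominated c f" using f wfun_def by blast
  define g where "g m y = (\<Sum>n<m. (T ^^ n) f y)" for m y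
  have dom: "dominated (c / (1 - r)) (g m)" for m
    unfolding dominated_def
  proof (intro conjI ballI)
    have [measurable]: "(T ^^ n) f \<in> borel_measurable S" for n
      using dominated_measurable[OF funpow_dominated[OF c]] .
    show "g m \<in> borel_measurable S" unfolding g_def[abs_def] by measurable
    fix y assume y: "y \<in> space S"
    have cV: "0 \<le> c * V y" using dominatedD[OF c y] by linarith
    have "\<bar>g m y\<bar> \<le> (\<Sum>n<m. r ^ n * c * V y)"
      unfolding g_def using dominatedD[OF funpow_dominated[OF c] y] by (intro sum_abs[THEN order_trans] sum_mono) auto
    also have "\<dots> = (\<Sum>n<m. r ^ n) * (c * V y)" by (simp add: sum_distrib_right mult.assoc)
    also have "\<dots> \<le> (1 / (1 - r)) * (c * V y)"
      using r cV by (intro mult_right_mono) (auto simp: sum_gp_strict divide_right_mono)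
    finally show "\<bar>g m y\<bar> \<le> c / (1 - r) * V y" by simp
  qed
  have gS: "g (Suc m) = (\<lambda>y. g m y + (T ^^ m) f y)" for m by (simp add: g_def fun_eq_iff)
  have step: "T (g m) y = g (Suc m) y - f y" if y: "y \<in> space S" for m y
  proof (induction m)
    case 0 then show ?case using kernel_op_zero[OF T y] by (simp add: g_def[abs_def])
  next
    case (Suc m)
    have "T (g (Suc m)) y = T (\<lambda>y. g m y + (T ^^ m) f y) y" by (simp only: gS)
    also have "\<dots> = T (g m) y + T ((T ^^ m) f) y"
      by (intro kernel_op_add[OF T] dominated_wfun[OF dom] dominated_wfun[OF funpow_dominated[OF c]] y)
    finally show ?case using Suc gS[of m, THEN fun_cong, of y] gS[of "Suc m", THEN fun_cong, of y] by simp
  qed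
  have lim: "(\<lambda>m. g m y) \<longlonglongrightarrow> neumann T f y" if "y \<in> space S" for y
    unfolding g_def neumann_def using neumann_summable[OF f that] by (rule summable_LIMSEQ)
  have "(\<lambda>m. T (g m) x) \<longlonglongrightarrow> T (neumann T f) x"
    by (rule kernel_op_tendsto[OF T dom neumann_dominated[OF c] lim x])
  moreover have "(\<lambda>m. T (g m) x) \<longlonglongrightarrow> neumann T f x - f x"
    unfolding step[OF x] by (rule tendsto_diff[OF LIMSEQ_Suc[OF lim[OF x]] tendsto_const])
  ultimately show ?thesis using LIMSEQ_unique by blast
qed

lemma neumann_nonneg:
  assumes "\<And>f x. wfun f \<Longrightarrow> (\<And>y. y \<in> space S \<Longrightarrow> 0 \<le> f y) \<Longrightarrow> x \<in> space S \<Longrightarrow> 0 \<le> T f x"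
    and f: "wfun f" "\<And>y. y \<in> space S \<Longrightarrow> 0 \<le> f y" and x: "x \<in> space S"
  shows "0 \<le> neumann T f x"
proof -
  have "wfun ((T ^^ n) f) \<and> (\<forall>y\<in>space S. 0 \<le> (T ^^ n) f y)" for n
    by (induction n) (use f assms(1) kernel_op_wfun[OF T] in auto)
  then show ?thesis unfolding neumann_def using neumann_summable[OF f(1) x] x by (intro suminf_nonneg) auto
qed

text \<open>Since \<open>neumann T (T f) = neumann T f - f\<close>, the identity \<open>T f = f\<close> leaves only \<open>f = 0\<close>.\<close>

lemma fixed_point_zero:
  assumes f: "wfun f" and fp: "\<And>y. y \<in> space S \<Longrightarrow> T f y = f y" and x: "x \<in> space S"
  shows "f x = 0"
proof -
  have "neumann T (T f) x = neumann T f x"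
    by (rule kernel_op_cong[OF kernel_op_neumann kernel_op_wfun[OF T f] f fp x])
  then show ?thesis using neumann_right[OF f x] by simp
qed

end

end

section \<open>Stationary law and Poisson equation of a kernel with drift and a small set\<close>

text \<open>The drift function \<open>V\<close> may be unbounded on the small set \<open>W0\<close>, and the minorization concerns the
\<open>N\<close>-step kernel while the drift concerns one step. The point \<open>w0\<close> witnesses that the small set is
nonempty; solutions of the Poisson equation are later normalised there.\<close>

locale small_set_kernel =
  fixes S :: "'w measure" and p :: "'w \<Rightarrow> 'w measure" and V :: "'w \<Rightarrow> real"
    and W0 :: "'w set" and w0 :: 'w and \<phi> :: "'w measure"
    and lam b eps :: real and N :: nat
  assumes kernel: "p \<in> S \<rightarrow>\<^sub>M prob_algebra S"
    and V_meas: "V \<in> borel_measurable S" and V_ge: "x \<in> space S \<Longrightarrow> 1 \<le> V x"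
    and W0_sets [measurable]: "W0 \<in> sets S" and w0_in: "w0 \<in> W0"
    and phi: "\<phi> \<in> space (prob_algebra S)" and eps_pos: "0 < eps"
    and minorization: "x \<in> W0 \<Longrightarrow> E \<in> sets S \<Longrightarrow> eps * measure \<phi> E \<le> measure (kernel_pow S p N x) E"
    and lam: "0 \<le> lam" "lam < 1" and b_nonneg: "0 \<le> b"
    and drift: "x \<in> space S \<Longrightarrow>
      (\<integral>\<^sup>+y. ennreal (V y) \<partial>p x) \<le> ennreal (lam * V x + b * indicator W0 x)"
begin

text \<open>The parameter \<open>a\<close> of the resolvent is so small that \<open>a\<close> times the kernel has norm at most \<open>1 / 2\<close> for
every weight \<open>V + k\<close> with a constant \<open>k \<ge> 0\<close>. The resolvent has drift constants \<open>lamK\<close>, \<open>bK\<close> and minorization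
constant \<open>epsK\<close>. The shift \<open>c0\<close> solves \<open>epsK * c0 = bK\<close>: the mass that the minorizing part removes
from the constant \<open>c0\<close> then pays for the drift term \<open>bK\<close>, and \<open>rho\<close> is the resulting contraction
factor for the weight \<open>V'\<close>. None of these numbers involves the kernel itself, so bounds in terms of
them are uniform over a family of kernels with common drift and minorization constants.\<close>

definition a :: real where "a = 1 / (2 + 2 * b)"
definition epsK :: real where "epsK = a ^ N * eps"
definition lamK :: real where "lamK = (1 - a) / (1 - a * lam)"
definition bK :: real where "bK = a * b / (1 - a * lam)"
definition c0 :: real where "c0 = bK / epsK"
definition rho :: real where "rho = (lamK + c0) / (1 + c0)"
definition V' :: "'w \<Rightarrow> real" where "V' x = V x + c0"

lemma a_bounds: "0 < a" "a \<le> 1/2" "a * (1 + b) = 1/2"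
  using b_nonneg by (auto simp: a_def field_simps)

lemma a_lam: "a * lam < 1" "0 < 1 - a * lam"
proof -
  have "a * lam \<le> 1/2 * 1" using a_bounds lam by (intro mult_mono) auto
  then show "a * lam < 1" "0 < 1 - a * lam" by auto
qed

lemma const_bounds: "0 < epsK" "0 \<le> lamK" "lamK < 1" "0 \<le> bK" "0 \<le> c0" "epsK * c0 = bK"
  "0 \<le> rho" "rho < 1"
proof -
  show e: "0 < epsK" using a_bounds eps_pos by (simp add: epsK_def)
  show lK: "0 \<le> lamK" using a_bounds a_lam by (simp add: lamK_def)
  show lK1: "lamK < 1" using a_bounds a_lam lam by (simp add: lamK_def)
  show bK: "0 \<le> bK" using a_bounds a_lam b_nonneg by (simp add: bK_def)
  show c0: "0 \<le> c0" using e bK by (simp add: c0_def)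
  show "epsK * c0 = bK" using e by (simp add: c0_def)
  show "0 \<le> rho" "rho < 1" using lK lK1 c0 by (simp_all add: rho_def)
qed

sublocale weighted_functions S V'
proof
  show "V' \<in> borel_measurable S" unfolding V'_def[abs_def] using V_meas by measurable
  show "1 \<le> V' x" if "x \<in> space S" for x using V_ge[OF that] const_bounds by (simp add: V'_def)
qed

lemma w0_space: "w0 \<in> space S" using w0_in sets.sets_into_space[OF W0_sets] by blast

lemma p_sets: "x \<in> space S \<Longrightarrow> sets (p x) = sets S"
  and p_prob: "x \<in> space S \<Longrightarrow> prob_space (p x)"
  using measurable_space[OF kernel] by (auto simp: space_prob_algebra)

lemma phi_sets: "sets \<phi> = sets S" and phi_prob: "prob_space \<phi>"
  using phi by (auto simp: space_prob_algebra)

lemma p_space: "x \<in> space S \<Longrightarrow> space (p x) = space S"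
  using p_sets sets_eq_imp_space_eq by blast

lemma phi_space: "space \<phi> = space S" using phi_sets sets_eq_imp_space_eq by blast

lemma wfun_V: "wfun V"
proof -
  have "dominated 1 V" unfolding dominated_def using V_meas V_ge const_bounds by (force simp: V'_def)
  then show ?thesis by (rule dominated_wfun)
qed

subsection \<open>The kernel as an operator\<close>

definition A :: "('w \<Rightarrow> real) \<Rightarrow> 'w \<Rightarrow> real" where "A f x = (\<integral>y. f y \<partial>p x)"

lemma nn_drift':
  assumes x: "x \<in> space S"
  shows "(\<integral>\<^sup>+y. ennreal (V' y) \<partial>p x) \<le> ennreal ((1 + b) * V' x)"
proof -
  interpret prob_space "p x" by (rule p_prob[OF x])
  have [measurable]: "V \<in> borel_measurable (p x)"
    using V_meas by (simp add: measurable_cong_sets[OF p_sets[OF x] refl])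
  have V0: "0 \<le> V y" if "y \<in> space S" for y using V_ge[OF that] by simp
  have "(\<integral>\<^sup>+y. ennreal (V' y) \<partial>p x) = (\<integral>\<^sup>+y. ennreal (V y) + ennreal c0 \<partial>p x)"
    using V0 const_bounds by (intro nn_integral_cong) (simp add: V'_def p_space[OF x] ennreal_plus)
  also have "\<dots> = (\<integral>\<^sup>+y. ennreal (V y) \<partial>p x) + ennreal c0"
    by (subst nn_integral_add) (auto simp: emeasure_space_1)
  also have "\<dots> \<le> ennreal (lam * V x + b * indicator W0 x) + ennreal c0"
    using drift[OF x] by (rule add_right_mono)
  also have "\<dots> = ennreal (lam * V x + b * indicator W0 x + c0)"
    using V0[OF x] lam b_nonneg const_bounds by (simp add: ennreal_plus)
  also have "\<dots> \<le> ennreal ((1 + b) * V' x)"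
  proof (rule ennreal_leI)
    have "lam * V x \<le> 1 * V x" using lam V0[OF x] by (intro mult_right_mono) auto
    moreover have "b * indicator W0 x \<le> b * V' x"
      using b_nonneg V_ge_1[OF x] by (intro mult_left_mono) (auto simp: indicator_def)
    ultimately show "lam * V x + b * indicator W0 x + c0 \<le> (1 + b) * V' x"
      by (simp add: V'_def algebra_simps)
  qed
  finally show ?thesis .
qed

lemma A_op: "kernel_op (1 + b) A" and p_integrable: "x \<in> space S \<Longrightarrow> integrable (p x) V'"
  using kernel_op_integral[OF kernel nn_drift'] b_nonneg by (auto simp: A_def[abs_def])

lemma wfun_integrable: "x \<in> space S \<Longrightarrow> wfun f \<Longrightarrow> integrable (p x) f"
  by (rule integrable_wfun[OF p_sets p_integrable])

lemma A_mono:
  assumes "wfun f" "wfun g" "\<And>y. y \<in> space S \<Longrightarrow> f y \<le> g y" "x \<in> space S"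
  shows "A f x \<le> A g x"
  unfolding A_def using assms by (intro integral_mono wfun_integrable) (auto simp: p_space)

lemma A_nonneg: "(\<And>y. y \<in> space S \<Longrightarrow> 0 \<le> f y) \<Longrightarrow> x \<in> space S \<Longrightarrow> 0 \<le> A f x"
  unfolding A_def by (intro Bochner_Integration.integral_nonneg) (auto simp: p_space)

lemma A_const: "x \<in> space S \<Longrightarrow> A (\<lambda>_. k) x = k"
  using p_prob[of x] by (simp add: A_def prob_space.prob_space)

lemma A_drift:
  assumes x: "x \<in> space S" shows "A V x \<le> lam * V x + b * indicator W0 x"
proof -
  have V0: "0 \<le> V y" if "y \<in> space S" for y using V_ge[OF that] by simp
  have "ennreal (A V x) = (\<integral>\<^sup>+y. ennreal (V y) \<partial>p x)"
    unfolding A_def using V0 wfun_integrable[OF x wfun_V]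
    by (intro nn_integral_eq_integral[symmetric] AE_I2) (auto simp: p_space[OF x])
  also note drift[OF x]
  finally have "ennreal (A V x) \<le> ennreal (lam * V x + b * indicator W0 x)" .
  moreover have "0 \<le> lam * V x + b * indicator W0 x" using V0[OF x] lam b_nonneg by simp
  ultimately show ?thesis by (simp only: ennreal_le_iff)
qed

subsection \<open>The resolvent\<close>

text \<open>The resolvent \<open>(1 - a) * (\<Sum>n. a ^ n * A ^ n)\<close> sees all times at once; this is what reconciles the
one-step drift with the \<open>N\<close>-step minorization.\<close>

definition K :: "('w \<Rightarrow> real) \<Rightarrow> 'w \<Rightarrow> real" where
  "K f x = (1 - a) * neumann (\<lambda>f x. a * A f x) f x"

lemma aA_op: "kernel_op (1/2) (\<lambda>f x. a * A f x)"
  using kernel_op_scale[OF A_op, of a] a_bounds by simp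

lemma K_op: "kernel_op 2 K"
proof -
  have "kernel_op (\<bar>1 - a\<bar> * (1 / (1 - 1/2))) K"
    unfolding K_def[abs_def] by (rule kernel_op_scale[OF kernel_op_neumann[OF aA_op]]) auto
  then show ?thesis by (rule kernel_op_mono_const) (use a_bounds in auto)
qed

lemma K_left:
  assumes f: "wfun f" and x: "x \<in> space S"
  shows "K f x = (1 - a) * f x + a * A (K f) x"
proof -
  let ?n = "neumann (\<lambda>f x. a * A f x)"
  have w: "wfun (?n f)" by (rule kernel_op_wfun[OF kernel_op_neumann[OF aA_op] f]) auto
  have "a * A (K f) x = (1 - a) * (a * A (?n f) x)"
    unfolding K_def[abs_def] by (simp add: kernel_op_cmult[OF A_op w x])
  also have "\<dots> = (1 - a) * (?n f x - f x)"
    using neumann_left[OF aA_op _ _ f x] by simp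
  finally show ?thesis by (simp add: K_def algebra_simps)
qed

lemma K_right:
  assumes f: "wfun f" and x: "x \<in> space S"
  shows "K f x = (1 - a) * f x + a * K (A f) x"
proof -
  let ?n = "neumann (\<lambda>f x. a * A f x)"
  have "a * K (A f) x = K (\<lambda>x. a * A f x) x"
    by (rule kernel_op_cmult[OF K_op kernel_op_wfun[OF A_op f] x, symmetric])
  also have "\<dots> = (1 - a) * (?n f x - f x)"
    unfolding K_def using neumann_right[OF aA_op _ _ f x] by simp
  finally show ?thesis by (simp add: K_def algebra_simps)
qed

lemma K_nonneg:
  assumes "wfun f" "\<And>y. y \<in> space S \<Longrightarrow> 0 \<le> f y" "x \<in> space S"
  shows "0 \<le> K f x"
  unfolding K_def using a_bounds
  by (intro mult_nonneg_nonneg neumann_nonneg[OF aA_op _ _ _ assms]) (auto intro!: A_nonneg)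

lemma K_mono:
  assumes "wfun f" "wfun g" "\<And>y. y \<in> space S \<Longrightarrow> f y \<le> g y" "x \<in> space S"
  shows "K f x \<le> K g x"
  using K_nonneg[OF wfun_diff[OF assms(2,1)] _ assms(4)] kernel_op_diff[OF K_op assms(2,1,4)] assms(3)
  by simp

lemma K_const:
  assumes x: "x \<in> space S" shows "K (\<lambda>_. k) x = k"
proof -
  have "K (A (\<lambda>_. k)) x = K (\<lambda>_. k) x"
    by (rule kernel_op_cong[OF K_op kernel_op_wfun[OF A_op wfun_const] wfun_const A_const x])
  with K_right[OF wfun_const x, of k] have "(1 - a) * K (\<lambda>_. k) x = (1 - a) * k" by (simp add: algebra_simps)
  then show ?thesis using a_bounds by simp
qed

definition s :: "'w \<Rightarrow> real" where "s = K (indicator W0)"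

lemma s_wfun: "wfun s" unfolding s_def by (rule kernel_op_wfun[OF K_op wfun_indicator]) simp

lemma s_nonneg: "x \<in> space S \<Longrightarrow> 0 \<le> s x"
  unfolding s_def by (rule K_nonneg[OF wfun_indicator]) auto

text \<open>Apply \<open>K\<close> to the drift inequality, insert the result into \<open>K V = (1 - a) V + a K A V\<close> and solve for
\<open>K V\<close>. The role of the indicator of the small set is taken over by \<open>s\<close>.\<close>

lemma K_drift:
  assumes x: "x \<in> space S" shows "K V x \<le> lamK * V x + bK * s x"
proof -
  have "K (A V) x \<le> K (\<lambda>y. lam * V y + b * indicator W0 y) x"
    by (rule K_mono[OF _ _ A_drift x])
       (auto intro!: kernel_op_wfun[OF A_op] wfun_V wfun_lincomb wfun_cmult wfun_indicator)
  also have "\<dots> = lam * K V x + b * s x"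
    by (simp add: s_def kernel_op_lincomb[OF K_op wfun_V wfun_cmult[OF wfun_indicator] x]
        kernel_op_cmult[OF K_op wfun_indicator x])
  finally have "K V x \<le> (1 - a) * V x + a * (lam * K V x + b * s x)"
    using K_right[OF wfun_V x] a_bounds by simp
  then have "K V x * (1 - a * lam) \<le> (1 - a) * V x + a * b * s x" by (simp add: algebra_simps)
  then have "K V x \<le> ((1 - a) * V x + a * b * s x) / (1 - a * lam)"
    using a_lam by (simp add: pos_le_divide_eq)
  then show ?thesis by (simp add: lamK_def bK_def add_divide_distrib)
qed

subsection \<open>Minorization of the resolvent\<close>

lemma kernel_pow_measurable: "kernel_pow S p n \<in> S \<rightarrow>\<^sub>M prob_algebra S"
  by (induction n) (auto intro: measurable_bind_prob_space[OF kernel])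

lemma A_pow_nonneg:
  assumes "wfun f" "\<And>y. y \<in> space S \<Longrightarrow> 0 \<le> f y" "x \<in> space S"
  shows "0 \<le> (A ^^ n) f x"
  using assms(3) by (induction n arbitrary: x) (use assms(2) A_nonneg in auto)

lemma A_pow_nn_integral:
  assumes f: "wfun f" "\<And>y. y \<in> space S \<Longrightarrow> 0 \<le> f y" and x: "x \<in> space S"
  shows "(\<integral>\<^sup>+y. ennreal (f y) \<partial>kernel_pow S p n x) = ennreal ((A ^^ n) f x)"
  using x
proof (induction n arbitrary: x)
  case 0
  have [measurable]: "f \<in> borel_measurable S" using f(1) by measurable
  show ?case using 0 by (simp add: nn_integral_return)
next
  case (Suc n)
  have [measurable]: "f \<in> borel_measurable S" using f(1) by measurable
  have "(\<integral>\<^sup>+y. ennreal (f y) \<partial>kernel_pow S p (Suc n) x)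
      = (\<integral>\<^sup>+z. \<integral>\<^sup>+y. ennreal (f y) \<partial>kernel_pow S p n z \<partial>p x)"
    unfolding kernel_pow.simps
    by (rule nn_integral_bind[where B=S])
       (use measurable_prob_algebraD[OF kernel_pow_measurable[of n]] in
         \<open>simp_all add: measurable_cong_sets[OF p_sets[OF Suc.prems] refl]\<close>)
  also have "\<dots> = (\<integral>\<^sup>+z. ennreal ((A ^^ n) f z) \<partial>p x)"
    using Suc.IH by (intro nn_integral_cong) (simp add: p_space[OF Suc.prems])
  also have "\<dots> = ennreal (\<integral>z. (A ^^ n) f z \<partial>p x)"
    using A_pow_nonneg[OF f] wfun_integrable[OF Suc.prems kernel_op_wfun[OF kernel_op_funpow[OF A_op] f(1)]]
    by (intro nn_integral_eq_integral AE_I2) (auto simp: p_space[OF Suc.prems])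
  finally show ?case by (simp only: funpow.simps comp_def A_def[of "(A ^^ n) f"])
qed

lemma nn_minorization:
  assumes f: "wfun f" "\<And>y. y \<in> space S \<Longrightarrow> 0 \<le> f y" and x: "x \<in> W0"
  shows "ennreal eps * (\<integral>\<^sup>+y. ennreal (f y) \<partial>\<phi>) \<le> ennreal ((A ^^ N) f x)"
proof -
  have xS: "x \<in> space S" using x sets.sets_into_space[OF W0_sets] by blast
  let ?k = "kernel_pow S p N x"
  have k: "sets ?k = sets S" "prob_space ?k"
    using measurable_space[OF kernel_pow_measurable xS] by (auto simp: space_prob_algebra)
  interpret k: prob_space ?k by fact
  interpret ph: prob_space \<phi> by (rule phi_prob)
  have le: "scale_measure (ennreal eps) \<phi> \<le> ?k"
  proof (subst le_measure)
    show "sets (scale_measure (ennreal eps) \<phi>) = sets ?k" by (simp add: phi_sets k(1))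
    have "emeasure (scale_measure (ennreal eps) \<phi>) E \<le> emeasure ?k E" if "E \<in> sets \<phi>" for E
    proof -
      from that have "ennreal (eps * measure \<phi> E) \<le> ennreal (measure ?k E)"
      using minorization[OF x] by (intro ennreal_leI) (simp add: phi_sets)
      then show ?thesis
        using eps_pos by (simp add: ph.emeasure_eq_measure k.emeasure_eq_measure ennreal_mult)
    qed
    then show "\<forall>E\<in>sets (scale_measure (ennreal eps) \<phi>).
        emeasure (scale_measure (ennreal eps) \<phi>) E \<le> emeasure ?k E"
      by (simp only: sets_scale_measure) blast
  qed
  have [measurable]: "f \<in> borel_measurable \<phi>"
    using f(1) by (simp add: measurable_cong_sets[OF phi_sets refl] wfun_measurable)
  have "ennreal eps * (\<integral>\<^sup>+y. ennreal (f y) \<partial>\<phi>) = (\<integral>\<^sup>+y. ennreal (f y) \<partial>scale_measure (ennreal eps) \<phi>)"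
    by (simp add: nn_integral_scale_measure)
  also have "\<dots> \<le> (\<integral>\<^sup>+y. ennreal (f y) \<partial>?k)"
    by (rule nn_integral_mono_measure) (use le k phi_sets in auto)
  also have "\<dots> = ennreal ((A ^^ N) f x)" by (rule A_pow_nn_integral[OF f xS])
  finally show ?thesis .
qed

text \<open>The measure \<open>eps * \<phi>\<close> lies below the \<open>N\<close>-step law from the point \<open>w0\<close>, which integrates the weight.\<close>

lemma phi_V: "integrable \<phi> V'"
proof (rule integrableI_nonneg)
  show "V' \<in> borel_measurable \<phi>" by (simp add: measurable_cong_sets[OF phi_sets refl])
  show "AE x in \<phi>. 0 \<le> V' x" using V_nonneg by (intro AE_I2) (simp add: phi_space)
  have "ennreal eps * (\<integral>\<^sup>+y. ennreal (V' y) \<partial>\<phi>) < \<infinity>"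
    by (rule le_less_trans[OF nn_minorization[OF wfun_weight V_nonneg w0_in]]) auto
  then show "(\<integral>\<^sup>+y. ennreal (V' y) \<partial>\<phi>) < \<infinity>"
    using eps_pos by (auto simp: ennreal_mult_less_top)
qed

lemma phi_integrable: "wfun f \<Longrightarrow> integrable \<phi> f"
  by (rule integrable_wfun[OF phi_sets phi_V])

lemma A_minorization:
  assumes f: "wfun f" "\<And>y. y \<in> space S \<Longrightarrow> 0 \<le> f y" and x: "x \<in> space S"
  shows "eps * (\<integral>y. f y \<partial>\<phi>) * indicator W0 x \<le> (A ^^ N) f x"
proof (cases "x \<in> W0")
  case True
  have "ennreal (\<integral>y. f y \<partial>\<phi>) = (\<integral>\<^sup>+y. ennreal (f y) \<partial>\<phi>)"
    using f(2) phi_integrable[OF f(1)]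
    by (intro nn_integral_eq_integral[symmetric] AE_I2) (auto simp: phi_space)
  moreover have "0 \<le> (\<integral>y. f y \<partial>\<phi>)" using f(2) by (intro Bochner_Integration.integral_nonneg) (auto simp: phi_space)
  ultimately have "ennreal (eps * (\<integral>y. f y \<partial>\<phi>)) \<le> ennreal ((A ^^ N) f x)"
    using nn_minorization[OF f True] eps_pos by (simp add: ennreal_mult)
  then show ?thesis using True A_pow_nonneg[OF f x, of N] by (simp add: ennreal_le_iff)
qed (use A_pow_nonneg[OF f x] in auto)

text \<open>For nonnegative \<open>f\<close> the resolvent identity gives \<open>K f \<ge> a K A f\<close>; after \<open>N\<close> steps of this the
minorization of \<open>A ^ N\<close> can be used under \<open>K\<close>, where it turns the indicator into \<open>s\<close>.\<close>

lemma K_minorization: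
  assumes f: "wfun f" "\<And>y. y \<in> space S \<Longrightarrow> 0 \<le> f y" and x: "x \<in> space S"
  shows "epsK * (\<integral>y. f y \<partial>\<phi>) * s x \<le> K f x"
proof -
  have wA: "wfun ((A ^^ n) f)" for n by (rule kernel_op_wfun[OF kernel_op_funpow[OF A_op] f(1)])
  have "a ^ n * K ((A ^^ n) f) x \<le> K f x" for n
  proof (induction n)
    case (Suc n)
    have "a * K (A ((A ^^ n) f)) x \<le> K ((A ^^ n) f) x"
      using K_right[OF wA x, of n] A_pow_nonneg[OF f x, of n] a_bounds by simp
    then have "a ^ n * (a * K (A ((A ^^ n) f)) x) \<le> a ^ n * K ((A ^^ n) f) x"
      using a_bounds by (intro mult_left_mono) auto
    with Suc show ?case by (simp add: mult.assoc mult.left_commute)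
  qed simp
  moreover have "eps * (\<integral>y. f y \<partial>\<phi>) * s x \<le> K ((A ^^ N) f) x"
  proof -
    have "eps * (\<integral>y. f y \<partial>\<phi>) * s x = K (\<lambda>y. eps * (\<integral>y. f y \<partial>\<phi>) * indicator W0 y) x"
      by (simp add: s_def kernel_op_cmult[OF K_op wfun_indicator x])
    also have "\<dots> \<le> K ((A ^^ N) f) x"
      by (rule K_mono[OF wfun_cmult[OF wfun_indicator] wA A_minorization[OF f] x]) auto
    finally show ?thesis .
  qed
  then have "a ^ N * (eps * (\<integral>y. f y \<partial>\<phi>) * s x) \<le> a ^ N * K ((A ^^ N) f) x"
    using a_bounds by (intro mult_left_mono) auto
  ultimately show ?thesis by (force simp: epsK_def mult.assoc intro: order_trans)
qed

subsection \<open>The defective kernel and its potential\<close>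

text \<open>\<open>Q\<close> is the resolvent chain killed at its regeneration times, at which it restarts from \<open>\<phi>\<close>; \<open>G\<close>
below sums over one regeneration cycle.\<close>

definition Q :: "('w \<Rightarrow> real) \<Rightarrow> 'w \<Rightarrow> real" where
  "Q f x = K f x - epsK * ((\<integral>y. f y \<partial>\<phi>) * s x)"

lemma Q_nonneg:
  assumes "wfun f" "\<And>y. y \<in> space S \<Longrightarrow> 0 \<le> f y" "x \<in> space S"
  shows "0 \<le> Q f x"
  using K_minorization[OF assms] by (simp add: Q_def mult.assoc)

text \<open>The crucial estimate. Both \<open>K V \<le> lamK V + bK s\<close> and \<open>epsK \<phi>(V') s \<ge> epsK c0 s = bK s\<close> contain the
same multiple of \<open>s\<close>, which cancels; what remains is \<open>lamK V + c0 \<le> rho (V + c0)\<close>, true because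
\<open>V \<ge> 1\<close>.\<close>

lemma Q_weight:
  assumes x: "x \<in> space S" shows "Q V' x \<le> rho * V' x"
proof -
  interpret ph: prob_space \<phi> by (rule phi_prob)
  have "(\<integral>y. c0 \<partial>\<phi>) \<le> (\<integral>y. V' y \<partial>\<phi>)"
    using V_ge phi_V by (intro integral_mono) (force simp: V'_def phi_space)+
  then have c: "c0 \<le> (\<integral>y. V' y \<partial>\<phi>)" by (simp add: ph.prob_space)
  have "K V' x = K V x + c0"
    unfolding V'_def[abs_def] by (simp add: kernel_op_add[OF K_op wfun_V wfun_const x] K_const[OF x])
  then have "K V' x \<le> lamK * V x + c0 + epsK * (c0 * s x)"
    using K_drift[OF x] const_bounds(6) by (simp add: mult.assoc[symmetric])
  also have "epsK * (c0 * s x) \<le> epsK * ((\<integral>y. V' y \<partial>\<phi>) * s x)"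
    using c s_nonneg[OF x] const_bounds by (intro mult_left_mono mult_right_mono) auto
  finally have "Q V' x \<le> lamK * V x + c0" by (simp add: Q_def)
  also have "\<dots> \<le> rho * V' x"
  proof -
    have "lamK * V x * (1 + c0) + c0 * (1 + c0) \<le> (lamK + c0) * (V x + c0)"
    proof -
      have "c0 * (1 - lamK) * 1 \<le> c0 * (1 - lamK) * V x"
        using V_ge[OF x] const_bounds by (intro mult_left_mono) auto
      then show ?thesis by (simp add: algebra_simps)
    qed
    then have "(lamK * V x + c0) * (1 + c0) \<le> (lamK + c0) * (V x + c0)" by (simp add: algebra_simps)
    then show ?thesis using const_bounds by (simp add: rho_def V'_def pos_le_divide_eq)
  qed
  finally show ?thesis .
qed

lemma Q_op: "kernel_op rho Q"
proof -
  obtain d where d: "dominated d s" using s_wfun wfun_def by blast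
  have "\<exists>C. kernel_op C Q"
    using kernel_op_lincomb_op[OF kernel_op_rank_one[OF phi_sets phi_V d] K_op, of "- epsK"]
    by (auto simp: Q_def[abs_def])
  then obtain C where C: "kernel_op C Q" by blast
  have "dominated (rho * c) (Q f)" if f: "dominated c f" for c f
    unfolding dominated_def
  proof (intro conjI ballI)
    show "Q f \<in> borel_measurable S" using kernel_op_dominated[OF C f] by (rule dominated_measurable)
    fix x assume x: "x \<in> space S"
    have c: "0 \<le> c" by (rule dominated_const_nonneg[OF f x])
    note wf = dominated_wfun[OF f]
    have "\<bar>f y\<bar> \<le> c * V' y" if "y \<in> space S" for y using dominatedD[OF f that] .
    then have *: "0 \<le> c * V' y + f y" "0 \<le> c * V' y - f y" if "y \<in> space S" for y
      using that by (force simp: abs_le_iff)+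
    have "0 \<le> Q (\<lambda>y. c * V' y + f y) x" "0 \<le> Q (\<lambda>y. c * V' y - f y) x"
      using * x by (auto intro!: Q_nonneg wfun_lincomb wfun_diff wfun_cmult wfun_weight wf)
    then have "\<bar>Q f x\<bar> \<le> c * Q V' x"
      by (simp add: kernel_op_lincomb[OF C wfun_weight wf x] kernel_op_diff[OF C wfun_cmult[OF wfun_weight] wf x]
          kernel_op_cmult[OF C wfun_weight x] abs_le_iff)
    also have "\<dots> \<le> c * (rho * V' x)" using Q_weight[OF x] c by (rule mult_left_mono)
    finally show "\<bar>Q f x\<bar> \<le> rho * c * V' x" by (simp add: ac_simps)
  qed
  with C show ?thesis by (simp add: kernel_op_def)
qed

definition G :: "('w \<Rightarrow> real) \<Rightarrow> 'w \<Rightarrow> real" where "G = neumann Q"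

lemma G_op: "kernel_op (1 / (1 - rho)) G"
  unfolding G_def using kernel_op_neumann[OF Q_op] const_bounds by simp

lemma G_nonneg:
  assumes "wfun f" "\<And>y. y \<in> space S \<Longrightarrow> 0 \<le> f y" "x \<in> space S"
  shows "0 \<le> G f x"
  unfolding G_def using neumann_nonneg[OF Q_op _ _ Q_nonneg assms] const_bounds by blast

lemma Q_G: "wfun f \<Longrightarrow> x \<in> space S \<Longrightarrow> Q (G f) x = G f x - f x"
  unfolding G_def using neumann_left[OF Q_op] const_bounds by simp

lemma G_Q: "wfun f \<Longrightarrow> x \<in> space S \<Longrightarrow> G (Q f) x = G f x - f x"
  unfolding G_def using neumann_right[OF Q_op] const_bounds by simp

lemma wfun_G: "wfun f \<Longrightarrow> wfun (G f)" by (rule kernel_op_wfun[OF G_op])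
lemma wfun_Q: "wfun f \<Longrightarrow> wfun (Q f)" by (rule kernel_op_wfun[OF Q_op])
lemma wfun_K: "wfun f \<Longrightarrow> wfun (K f)" by (rule kernel_op_wfun[OF K_op])
lemma wfun_A: "wfun f \<Longrightarrow> wfun (A f)" by (rule kernel_op_wfun[OF A_op])

lemma Q_one: "x \<in> space S \<Longrightarrow> Q (\<lambda>_. 1) x = 1 - epsK * s x"
  using phi_prob by (simp add: Q_def K_const prob_space.prob_space)

text \<open>The mass lost by \<open>Q\<close> is \<open>1 - Q 1 = epsK s\<close>, and \<open>G (1 - Q 1) = 1\<close>: regeneration occurs almost
surely.\<close>

lemma G_s:
  assumes x: "x \<in> space S" shows "epsK * G s x = 1"
proof -
  have "G (Q (\<lambda>_. 1)) x = G (\<lambda>y. 1 - epsK * s y) x"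
    by (rule kernel_op_cong[OF G_op _ _ Q_one x])
       (auto intro!: wfun_Q wfun_diff wfun_const wfun_cmult s_wfun)
  also have "\<dots> = G (\<lambda>_. 1) x - epsK * G s x"
    by (simp add: kernel_op_diff[OF G_op wfun_const wfun_cmult[OF s_wfun] x] kernel_op_cmult[OF G_op s_wfun x])
  finally show ?thesis using G_Q[OF wfun_const x, of 1] by simp
qed

subsection \<open>The stationary law\<close>

text \<open>The expected sum of \<open>f\<close> over a regeneration cycle started from \<open>\<phi>\<close>. By the cycle formula of renewal
theory this is an unnormalised stationary functional.\<close>

definition pot :: "('w \<Rightarrow> real) \<Rightarrow> real" where "pot f = (\<integral>x. G f x \<partial>\<phi>)"

lemma pot_lincomb: "wfun f \<Longrightarrow> wfun g \<Longrightarrow> pot (\<lambda>x. k * f x + g x) = k * pot f + pot g"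
proof -
  assume fg: "wfun f" "wfun g"
  have "pot (\<lambda>x. k * f x + g x) = (\<integral>x. k * G f x + G g x \<partial>\<phi>)"
    unfolding pot_def
    by (intro Bochner_Integration.integral_cong) (auto simp: phi_space kernel_op_lincomb[OF G_op fg])
  then show ?thesis using phi_integrable wfun_G fg by (simp add: pot_def)
qed

lemma pot_cong: "wfun f \<Longrightarrow> wfun g \<Longrightarrow> (\<And>x. x \<in> space S \<Longrightarrow> f x = g x) \<Longrightarrow> pot f = pot g"
  unfolding pot_def
  by (intro Bochner_Integration.integral_cong) (auto simp: phi_space intro: kernel_op_cong[OF G_op])

lemma pot_zero: "pot (\<lambda>_. 0) = 0"
proof -
  have "pot (\<lambda>_. 0) = (\<integral>x. 0 \<partial>\<phi>)"
    unfolding pot_def by (intro Bochner_Integration.integral_cong) (auto simp: phi_space kernel_op_zero[OF G_op])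
  then show ?thesis by simp
qed

lemma pot_cmult: "wfun f \<Longrightarrow> pot (\<lambda>x. k * f x) = k * pot f"
  using pot_lincomb[of f "\<lambda>_. 0" k] wfun_const pot_zero by simp

lemma pot_add: "wfun f \<Longrightarrow> wfun g \<Longrightarrow> pot (\<lambda>x. f x + g x) = pot f + pot g"
  using pot_lincomb[of f g 1] by simp

lemma pot_diff: "wfun f \<Longrightarrow> wfun g \<Longrightarrow> pot (\<lambda>x. f x - g x) = pot f - pot g"
  using pot_lincomb[of g f "-1"] by simp

lemma pot_nonneg: "wfun f \<Longrightarrow> (\<And>x. x \<in> space S \<Longrightarrow> 0 \<le> f x) \<Longrightarrow> 0 \<le> pot f"
  unfolding pot_def by (intro Bochner_Integration.integral_nonneg) (simp add: G_nonneg phi_space)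

lemma pot_null:
  assumes "\<And>i::nat. dominated c (f i)" "\<And>x. x \<in> space S \<Longrightarrow> (\<lambda>i. f i x) \<longlonglongrightarrow> 0"
  shows "(\<lambda>i. pot (f i)) \<longlonglongrightarrow> 0"
  unfolding pot_def
  by (rule integral_null[OF phi_sets phi_V kernel_op_dominated[OF G_op assms(1)]])
     (rule kernel_op_null[OF G_op assms])

lemma pot_tendsto:
  assumes "\<And>i::nat. dominated c (f i)" "dominated d g" "\<And>x. x \<in> space S \<Longrightarrow> (\<lambda>i. f i x) \<longlonglongrightarrow> g x"
  shows "(\<lambda>i. pot (f i)) \<longlonglongrightarrow> pot g"
proof -
  have "(\<lambda>i. pot (\<lambda>x. f i x - g x)) \<longlonglongrightarrow> 0"
    by (rule pot_null[OF dominated_diff[OF assms(1,2)]]) (use assms(3) LIM_zero in blast)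
  then have "(\<lambda>i. pot (f i) - pot g) \<longlonglongrightarrow> 0"
    by (simp add: pot_diff[OF dominated_wfun[OF assms(1)] dominated_wfun[OF assms(2)]])
  then show ?thesis by (rule LIM_zero_cancel)
qed

lemma pot_s: "epsK * pot s = 1"
proof -
  have "epsK * pot s = (\<integral>x. epsK * G s x \<partial>\<phi>)" by (simp add: pot_def)
  also have "\<dots> = (\<integral>x. 1 \<partial>\<phi>)"
    by (intro Bochner_Integration.integral_cong) (auto simp: phi_space G_s)
  finally show ?thesis using phi_prob by (simp add: prob_space.prob_space)
qed

lemma pot_Q: "wfun f \<Longrightarrow> pot (Q f) = pot f - (\<integral>x. f x \<partial>\<phi>)"
proof -
  assume f: "wfun f"
  have "pot (Q f) = (\<integral>x. G f x - f x \<partial>\<phi>)"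
    unfolding pot_def by (intro Bochner_Integration.integral_cong) (auto simp: phi_space G_Q f)
  then show ?thesis using phi_integrable f wfun_G[OF f] by (simp add: pot_def)
qed

text \<open>Passing from \<open>f\<close> to \<open>Q f\<close> loses the first term \<open>\<phi>(f)\<close> of the cycle sum; the minorizing part of \<open>K\<close>
restores exactly this amount because \<open>epsK * pot s = 1\<close>.\<close>

lemma pot_K: "wfun f \<Longrightarrow> pot (K f) = pot f"
proof -
  assume f: "wfun f"
  let ?c = "\<integral>x. f x \<partial>\<phi>"
  have "pot (K f) = pot (\<lambda>x. (epsK * ?c) * s x + Q f x)"
    by (intro pot_cong) (auto simp: Q_def intro!: wfun_K f wfun_lincomb s_wfun wfun_Q)
  also have "\<dots> = ?c * (epsK * pot s) + pot (Q f)"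
    by (simp add: pot_lincomb[OF s_wfun wfun_Q[OF f]])
  finally show ?thesis by (simp add: pot_s pot_Q[OF f])
qed

lemma pot_A: "wfun f \<Longrightarrow> pot (A f) = pot f"
proof -
  assume f: "wfun f"
  have "pot (K f) = pot (\<lambda>x. a * K (A f) x + (1 - a) * f x)"
    by (intro pot_cong)
       (auto simp: K_right[OF f] intro!: wfun_K wfun_A f wfun_lincomb wfun_cmult)
  also have "\<dots> = a * pot (K (A f)) + (1 - a) * pot f"
    by (simp add: pot_lincomb[OF wfun_K[OF wfun_A[OF f]] wfun_cmult[OF f]] pot_cmult[OF f])
  finally have "a * (pot (A f) - pot f) = 0" by (simp only: pot_K f wfun_A) argo
  then show ?thesis using a_bounds by simp
qed

lemma pot_one: "1 \<le> pot (\<lambda>_. 1)"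
proof -
  interpret ph: prob_space \<phi> by (rule phi_prob)
  have "1 \<le> G (\<lambda>_. 1) x" if x: "x \<in> space S" for x
    using Q_G[OF wfun_const x, of 1] Q_nonneg[OF wfun_G[OF wfun_const] _ x, of 1]
      G_nonneg[OF wfun_const, of 1] by simp
  then have "(\<integral>x. 1 \<partial>\<phi>) \<le> pot (\<lambda>_. 1)"
    unfolding pot_def by (intro integral_mono phi_integrable wfun_G wfun_const) (auto simp: phi_space)
  then show ?thesis by (simp add: ph.prob_space)
qed

definition \<nu> :: "'w measure" where
  "\<nu> = measure_of (space S) (sets S) (\<lambda>E. ennreal (pot (indicator E) / pot (\<lambda>_. 1)))"

lemma nu_sets: "sets \<nu> = sets S" and nu_space: "space \<nu> = space S"
  by (simp_all add: \<nu>_def)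

lemma emeasure_nu:
  assumes E: "E \<in> sets S"
  shows "emeasure \<nu> E = ennreal (pot (indicator E) / pot (\<lambda>_. 1))"
  unfolding \<nu>_def
proof (rule emeasure_measure_of_sigma[OF sets.sigma_algebra_axioms _ _ E])
  have pos: "0 < pot (\<lambda>_. 1)" using pot_one by simp
  let ?m = "\<lambda>E. ennreal (pot (indicator E) / pot (\<lambda>_. 1))"
  have nn: "0 \<le> pot (indicator E)" if "E \<in> sets S" for E
    by (rule pot_nonneg[OF wfun_indicator[OF that]]) simp
  have p0: "positive (sets S) ?m"
    using pot_zero by (simp add: positive_def indicator_def[abs_def])
  then show "positive (sets S) ?m" .
  show "countably_additive (sets S) ?m"
  proof (rule sets.empty_continuous_imp_countably_additive[OF p0])
    show "additive (sets S) ?m"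
      unfolding additive_def
    proof (intro ballI impI)
      fix E F assume E: "E \<in> sets S" and F: "F \<in> sets S" and "E \<inter> F = {}"
      then have "indicator (E \<union> F) = (\<lambda>x. indicator E x + indicator F x :: real)"
        by (auto simp: indicator_def fun_eq_iff)
      then have "pot (indicator (E \<union> F)) = pot (indicator E) + pot (indicator F)"
        using pot_add[OF wfun_indicator[OF E] wfun_indicator[OF F]] by simp
      then show "?m (E \<union> F) = ?m E + ?m F"
        using nn[OF E] nn[OF F] pos by (simp add: add_divide_distrib)
    qed
    fix B :: "nat \<Rightarrow> 'w set" assume B: "range B \<subseteq> sets S" "decseq B" "(\<Inter>i. B i) = {}"
    have "(\<lambda>i. pot (indicator (B i))) \<longlonglongrightarrow> 0"
    proof (rule pot_null[of 1])
      show "dominated 1 (indicator (B i))" for i using B by (intro dominated_indicator) auto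
      show "(\<lambda>i. indicator (B i) x :: real) \<longlonglongrightarrow> 0" for x
        using LIMSEQ_indicator_decseq[OF B(2), of x] B(3) by simp
    qed
    then have "(\<lambda>i. ennreal (pot (indicator (B i)) / pot (\<lambda>_. 1))) \<longlonglongrightarrow> ennreal (0 / pot (\<lambda>_. 1))"
      using pos by (intro tendsto_ennrealI tendsto_divide tendsto_const) auto
    then show "(\<lambda>i. ?m (B i)) \<longlonglongrightarrow> 0" by simp
  qed auto
qed

lemma nu_prob: "prob_space \<nu>"
proof
  have "pot (indicator (space S)) = pot (\<lambda>_. 1)"
    by (rule pot_cong[OF wfun_indicator wfun_const]) auto
  then show "emeasure \<nu> (space \<nu>) = 1" using pot_one by (simp add: nu_space emeasure_nu)
qed

text \<open>Both sides agree on indicators by construction; \<open>pot\<close> is linear and continuous, so the usual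
approximation by simple functions applies as long as the limit is dominated by the weight.\<close>

lemma nu_nn_integral:
  assumes "f \<in> borel_measurable S" "\<And>x. 0 \<le> f x" "wfun f"
  shows "(\<integral>\<^sup>+x. ennreal (f x) \<partial>\<nu>) = ennreal (pot f / pot (\<lambda>_. 1))"
  using assms
proof (induction rule: borel_measurable_induct_real)
  case (set E)
  then show ?case by (simp add: ennreal_indicator emeasure_nu nu_sets)
next
  case (mult u k)
  have pos: "0 < pot (\<lambda>_. 1)" using pot_one by simp
  show ?case
  proof (cases "k = 0")
    case True then show ?thesis by (simp add: pot_zero)
  next
    case False
    from mult.prems have "wfun (\<lambda>x. (1 / k) * (k * u x))" by (rule wfun_cmult)
    then have w: "wfun u" using False by simp
    have [measurable]: "u \<in> borel_measurable \<nu>" using mult(2) by (simp add: measurable_cong_sets[OF nu_sets refl])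
    have "(\<integral>\<^sup>+x. ennreal (k * u x) \<partial>\<nu>) = ennreal k * (\<integral>\<^sup>+x. ennreal (u x) \<partial>\<nu>)"
      using mult(1,3) by (simp add: ennreal_mult nn_integral_cmult)
    also have "\<dots> = ennreal (k * (pot u / pot (\<lambda>_. 1)))"
      unfolding mult.IH[OF w] using mult(1,3) pos pot_nonneg[OF w] by (intro ennreal_mult[symmetric]) auto
    finally show ?thesis by (simp add: pot_cmult[OF w])
  qed
next
  case (add u v)
  have pos: "0 < pot (\<lambda>_. 1)" using pot_one by simp
  obtain c where c: "dominated c (\<lambda>x. v x + u x)" using add.prems wfun_def by blast
  have "u x \<le> c * V' x \<and> v x \<le> c * V' x" if "x \<in> space S" for x
    using dominatedD[OF c that] add.hyps(2)[of x] add.hyps(4)[of x] by linarith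
  then have "dominated c u" "dominated c v" using add.hyps by (auto simp: dominated_def)
  then have w: "wfun u" "wfun v" using wfun_def by blast+
  have [measurable]: "u \<in> borel_measurable \<nu>" "v \<in> borel_measurable \<nu>"
    using add.hyps by (simp_all add: measurable_cong_sets[OF nu_sets refl])
  show ?case
    using add.IH(1)[OF w(1)] add.IH(2)[OF w(2)] add.hyps(2,4) pos pot_nonneg[OF w(1)] pot_nonneg[OF w(2)]
    by (simp add: ennreal_plus nn_integral_add pot_add[OF w(2,1)] add_divide_distrib)
next
  case (seq U)
  have pos: "0 < pot (\<lambda>_. 1)" using pot_one by simp
  obtain c where c: "dominated c f" using seq.prems wfun_def by blast
  have le: "U i x \<le> f x" if "x \<in> space S" for i x
    using seq.hyps(3,4) that by (intro incseq_le) (auto simp: incseq_def le_fun_def)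
  have dU: "dominated c (U i)" for i
    unfolding dominated_def
  proof (intro conjI ballI)
    show "\<bar>U i x\<bar> \<le> c * V' x" if "x \<in> space S" for x
      using seq.hyps(2)[of i x] le[OF that, of i] dominatedD[OF c that] by simp
  qed (rule seq.hyps(1))
  have [measurable]: "U i \<in> borel_measurable \<nu>" for i
    using seq.hyps(1) by (simp add: measurable_cong_sets[OF nu_sets refl])
  have inc: "incseq (\<lambda>i x. ennreal (U i x))"
    using seq.hyps(3) by (auto simp: incseq_def le_fun_def intro!: ennreal_leI)
  have sup: "ennreal (f x) = (SUP i. ennreal (U i x))" if "x \<in> space S" for x
  proof (rule LIMSEQ_unique)
    show "(\<lambda>i. ennreal (U i x)) \<longlonglongrightarrow> ennreal (f x)" by (rule tendsto_ennrealI[OF seq.hyps(4)[OF that]])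
    show "(\<lambda>i. ennreal (U i x)) \<longlonglongrightarrow> (SUP i. ennreal (U i x))"
      using inc by (intro LIMSEQ_SUP) (auto simp: incseq_def le_fun_def)
  qed
  have "(\<lambda>i. \<integral>\<^sup>+x. ennreal (U i x) \<partial>\<nu>) \<longlonglongrightarrow> (SUP i. \<integral>\<^sup>+x. ennreal (U i x) \<partial>\<nu>)"
    using inc by (intro LIMSEQ_SUP) (auto simp: incseq_def le_fun_def intro!: nn_integral_mono)
  also have "(SUP i. \<integral>\<^sup>+x. ennreal (U i x) \<partial>\<nu>) = (\<integral>\<^sup>+x. (SUP i. ennreal (U i x)) \<partial>\<nu>)"
    by (rule nn_integral_monotone_convergence_SUP[OF inc, symmetric]) measurable
  also have "\<dots> = (\<integral>\<^sup>+x. ennreal (f x) \<partial>\<nu>)"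
    by (rule nn_integral_cong) (simp add: sup nu_space)
  finally have "(\<lambda>i. \<integral>\<^sup>+x. ennreal (U i x) \<partial>\<nu>) \<longlonglongrightarrow> (\<integral>\<^sup>+x. ennreal (f x) \<partial>\<nu>)" .
  then have "(\<lambda>i. ennreal (pot (U i) / pot (\<lambda>_. 1))) \<longlonglongrightarrow> (\<integral>\<^sup>+x. ennreal (f x) \<partial>\<nu>)"
    by (simp only: seq.IH[OF dominated_wfun[OF dU]])
  moreover have "(\<lambda>i. ennreal (pot (U i) / pot (\<lambda>_. 1))) \<longlonglongrightarrow> ennreal (pot f / pot (\<lambda>_. 1))"
    using pos by (intro tendsto_ennrealI tendsto_divide tendsto_const pot_tendsto[OF dU c seq.hyps(4)]) auto
  ultimately show ?case by (rule LIMSEQ_unique)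
qed

lemma nu_V: "integrable \<nu> V'"
proof (rule integrableI_nonneg)
  have [measurable]: "V' \<in> borel_measurable \<nu>" by (simp add: measurable_cong_sets[OF nu_sets refl])
  then show "V' \<in> borel_measurable \<nu>" .
  show "AE x in \<nu>. 0 \<le> V' x" using V_nonneg by (intro AE_I2) (simp add: nu_space)
  have w: "wfun (\<lambda>x. max 0 (V' x))"
    using dominated_weight by (auto intro!: dominated_wfun[of 1] simp: dominated_def)
  have "(\<integral>\<^sup>+x. ennreal (V' x) \<partial>\<nu>) = (\<integral>\<^sup>+x. ennreal (max 0 (V' x)) \<partial>\<nu>)"
    by (intro nn_integral_cong) (simp add: nu_space V_nonneg max_def)
  also have "\<dots> < \<infinity>" by (subst nu_nn_integral) (auto intro: w)
  finally show "(\<integral>\<^sup>+x. ennreal (V' x) \<partial>\<nu>) < \<infinity>" .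
qed

lemma nu_integrable: "wfun f \<Longrightarrow> integrable \<nu> f"
  by (rule integrable_wfun[OF nu_sets nu_V])

lemma nu_integral:
  assumes f: "wfun f" shows "(\<integral>x. f x \<partial>\<nu>) = pot f / pot (\<lambda>_. 1)"
proof -
  have pos: "0 < pot (\<lambda>_. 1)" using pot_one by simp
  obtain c where c: "dominated c f" using f wfun_def by blast
  have nn: "wfun (\<lambda>x. max 0 (g x)) \<and> (\<integral>x. max 0 (g x) \<partial>\<nu>) = pot (\<lambda>x. max 0 (g x)) / pot (\<lambda>_. 1)"
    if g: "dominated c g" for g
  proof -
    have d: "dominated c (\<lambda>x. max 0 (g x))"
      using g dominated_const_nonneg[OF g] V_nonneg by (auto simp: dominated_def abs_le_iff)
    note w = dominated_wfun[OF d]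
    have "ennreal (\<integral>x. max 0 (g x) \<partial>\<nu>) = ennreal (pot (\<lambda>x. max 0 (g x)) / pot (\<lambda>_. 1))"
      using nu_nn_integral[of "\<lambda>x. max 0 (g x)"] w nu_integrable[OF w] wfun_measurable[OF w]
      by (subst nn_integral_eq_integral[symmetric]) auto
    moreover have "0 \<le> pot (\<lambda>x. max 0 (g x))" by (rule pot_nonneg[OF w]) simp
    ultimately show ?thesis using pos w
      by (simp add: ennreal_inj Bochner_Integration.integral_nonneg)
  qed
  have m: "dominated c (\<lambda>x. - f x)" using c by (simp add: dominated_def)
  have "f = (\<lambda>x. max 0 (f x) - max 0 (- f x))" by (auto simp: fun_eq_iff max_def)
  then have "(\<integral>x. f x \<partial>\<nu>) = (\<integral>x. max 0 (f x) - max 0 (- f x) \<partial>\<nu>)"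
    and "pot f = pot (\<lambda>x. max 0 (f x) - max 0 (- f x))" by auto
  then show ?thesis
    using nn[OF c] nn[OF m] nu_integrable by (simp add: pot_diff diff_divide_distrib)
qed

lemma nu_A: "wfun f \<Longrightarrow> (\<integral>x. A f x \<partial>\<nu>) = (\<integral>x. f x \<partial>\<nu>)"
  by (simp add: nu_integral wfun_A pot_A)

lemma nu_in: "\<nu> \<in> space (prob_algebra S)"
  by (simp add: space_prob_algebra nu_sets nu_prob)

lemma emeasure_bind_eq_A:
  assumes M: "M \<in> space (prob_algebra S)" and E: "E \<in> sets S"
  shows "emeasure (M \<bind> p) E = (\<integral>\<^sup>+x. ennreal (A (indicator E) x) \<partial>M)"
proof -
  have sp: "space M = space S" using M sets_eq_imp_space_eq by (auto simp: space_prob_algebra)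
  have "emeasure (p x) E = ennreal (A (indicator E) x)" if x: "x \<in> space S" for x
  proof -
    interpret prob_space "p x" by (rule p_prob[OF x])
    have "E \<inter> space (p x) = E" using sets.sets_into_space[OF E] by (auto simp: p_space[OF x])
    then show ?thesis using E by (simp add: A_def emeasure_eq_measure p_sets[OF x])
  qed
  then show ?thesis
    unfolding emeasure_bind_prob_algebra[OF M kernel E] by (intro nn_integral_cong) (simp add: sp)
qed

lemma nu_stationary: "stationary S p \<nu>"
  unfolding stationary_def
proof
  show "\<nu> \<in> space (prob_algebra S)" by (rule nu_in)
  show "\<nu> \<bind> p = \<nu>"
  proof (rule measure_eqI)
    show s: "sets (\<nu> \<bind> p) = sets \<nu>"
      unfolding nu_sets by (rule sets_bind'[OF nu_in kernel])
    fix E assume "E \<in> sets (\<nu> \<bind> p)"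
    then have E: "E \<in> sets S" by (simp add: s nu_sets)
    have "(\<integral>\<^sup>+x. ennreal (A (indicator E) x) \<partial>\<nu>) = ennreal (\<integral>x. A (indicator E) x \<partial>\<nu>)"
      using A_nonneg[of "indicator E"] nu_integrable[OF wfun_A[OF wfun_indicator[OF E]]]
      by (intro nn_integral_eq_integral AE_I2) (auto simp: nu_space)
    also have "\<dots> = ennreal (\<integral>x. indicator E x \<partial>\<nu>)"
      by (simp only: nu_A[OF wfun_indicator[OF E]])
    also have "\<dots> = emeasure \<nu> E"
      by (simp only: nu_integral[OF wfun_indicator[OF E]] emeasure_nu[OF E])
    finally show "emeasure (\<nu> \<bind> p) E = emeasure \<nu> E"
      by (simp only: emeasure_bind_eq_A[OF nu_in E])
  qed
qed

lemma Q_le_K: "wfun f \<Longrightarrow> (\<And>y. y \<in> space S \<Longrightarrow> 0 \<le> f y) \<Longrightarrow> x \<in> space S \<Longrightarrow> Q f x \<le> K f x"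
  unfolding Q_def using const_bounds s_nonneg[of x]
  by (auto intro!: mult_nonneg_nonneg Bochner_Integration.integral_nonneg simp: phi_space)

lemma stationary_integral_A:
  assumes st: "stationary S p \<mu>" and f: "f \<in> borel_measurable S" "\<And>x. x \<in> space S \<Longrightarrow> 0 \<le> f x \<and> f x \<le> 1"
  shows "(\<integral>x. A f x \<partial>\<mu>) = (\<integral>x. f x \<partial>\<mu>)"
proof -
  have mu: "sets \<mu> = sets S" "prob_space \<mu>" "\<mu> \<bind> p = \<mu>"
    using st by (auto simp: stationary_def space_prob_algebra)
  interpret mu: prob_space \<mu> by fact
  have sp: "space \<mu> = space S" using mu(1) sets_eq_imp_space_eq by blast
  have w: "wfun f" by (rule dominated_wfun, rule dominated_bounded[of f 1]) (use f in auto)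
  have Af: "0 \<le> A f x \<and> A f x \<le> 1" if x: "x \<in> space S" for x
    using A_nonneg[of f x] A_mono[OF w wfun_const[of 1] _ x] A_const[OF x, of 1] f(2) x by auto
  have m[measurable]: "f \<in> borel_measurable \<mu>" "A f \<in> borel_measurable \<mu>"
    using f(1) wfun_measurable[OF wfun_A[OF w]] by (simp_all add: measurable_cong_sets[OF mu(1) refl])
  have i: "integrable \<mu> f" "integrable \<mu> (A f)"
    using f(2) Af by (auto intro!: mu.integrable_const_bound[where B=1] AE_I2 simp: sp)
  have "ennreal (\<integral>x. f x \<partial>\<mu>) = (\<integral>\<^sup>+x. ennreal (f x) \<partial>(\<mu> \<bind> p))"
    using i f(2) unfolding mu(3) by (intro nn_integral_eq_integral[symmetric] AE_I2) (auto simp: sp)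
  also have "\<dots> = (\<integral>\<^sup>+x. \<integral>\<^sup>+y. ennreal (f y) \<partial>p x \<partial>\<mu>)"
    by (rule nn_integral_bind[where B=S])
       (use f(1) measurable_prob_algebraD[OF kernel] in \<open>simp_all add: measurable_cong_sets[OF mu(1) refl]\<close>)
  also have "\<dots> = (\<integral>\<^sup>+x. ennreal (A f x) \<partial>\<mu>)"
    unfolding A_def using f(2) wfun_integrable[OF _ w]
    by (intro nn_integral_cong nn_integral_eq_integral AE_I2) (auto simp: sp p_space)
  also have "\<dots> = ennreal (\<integral>x. A f x \<partial>\<mu>)"
    using i Af by (intro nn_integral_eq_integral AE_I2) (auto simp: sp)
  finally show ?thesis
    using f(2) Af by (subst (asm) ennreal_inj) (auto intro!: Bochner_Integration.integral_nonneg simp: sp)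
qed

text \<open>A stationary \<open>\<mu>\<close> is not known in advance to integrate the weight, so the argument is confined to
functions with values in \<open>{0..1}\<close>, on which \<open>Q ^ n f\<close> tends to \<open>0\<close> boundedly. For these,
\<open>\<mu>(f) = \<mu>(K f) = \<mu>(Q f) + epsK \<phi>(f) \<mu>(s)\<close>, and iterating expresses \<open>\<mu>(f)\<close> as a multiple of
\<open>pot f\<close>.\<close>

lemma stationary_unique:
  assumes st: "stationary S p \<mu>" shows "\<mu> = \<nu>"
proof -
  have mu: "sets \<mu> = sets S" "prob_space \<mu>" using st by (auto simp: stationary_def space_prob_algebra)
  interpret mu: prob_space \<mu> by fact
  have sp: "space \<mu> = space S" using mu(1) sets_eq_imp_space_eq by blast
  define unit where "unit f \<longleftrightarrow> f \<in> borel_measurable S \<and> (\<forall>x\<in>space S. 0 \<le> f x \<and> f x \<le> 1)"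
    for f :: "'w \<Rightarrow> real"
  have uw: "wfun f" if "unit f" for f
    by (rule dominated_wfun, rule dominated_bounded[of f 1]) (use that in \<open>auto simp: unit_def\<close>)
  have ui: "integrable \<mu> f" if "unit f" for f
    using that by (auto intro!: mu.integrable_const_bound[where B=1] AE_I2
        simp: sp unit_def measurable_cong_sets[OF mu(1) refl])
  have uK: "unit (K f)" if f: "unit f" for f
    unfolding unit_def
  proof (intro conjI ballI)
    show "K f \<in> borel_measurable S" by (rule wfun_measurable[OF wfun_K[OF uw[OF f]]])
    fix x assume x: "x \<in> space S"
    show "0 \<le> K f x" using f by (intro K_nonneg[OF uw[OF f] _ x]) (auto simp: unit_def)
    show "K f x \<le> 1" using K_mono[OF uw[OF f] wfun_const[of 1] _ x] f K_const[OF x, of 1] by (auto simp: unit_def)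
  qed
  have uQ: "unit (Q f)" if f: "unit f" for f
    unfolding unit_def
  proof (intro conjI ballI)
    show "Q f \<in> borel_measurable S" by (rule wfun_measurable[OF wfun_Q[OF uw[OF f]]])
    fix x assume x: "x \<in> space S"
    show "0 \<le> Q f x" using f by (intro Q_nonneg[OF uw[OF f] _ x]) (auto simp: unit_def)
    show "Q f x \<le> 1" using Q_le_K[OF uw[OF f] _ x] uK[OF f] f x by (auto simp: unit_def intro: order_trans)
  qed
  have intK: "(\<integral>x. K f x \<partial>\<mu>) = (\<integral>x. f x \<partial>\<mu>)" if f: "unit f" for f
  proof -
    have "unit (A (K f))"
      using uK[OF f] A_nonneg[of "K f"] A_mono[OF uw[OF uK[OF f]] wfun_const[of 1]] A_const[of _ 1]
        wfun_measurable[OF wfun_A[OF uw[OF uK[OF f]]]] by (auto simp: unit_def)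
    from ui[OF this] ui[OF f]
    have "(\<integral>x. (1 - a) * f x + a * A (K f) x \<partial>\<mu>) = (1 - a) * (\<integral>x. f x \<partial>\<mu>) + a * (\<integral>x. A (K f) x \<partial>\<mu>)"
      by simp
    moreover have "(\<integral>x. A (K f) x \<partial>\<mu>) = (\<integral>x. K f x \<partial>\<mu>)"
      using uK[OF f] by (intro stationary_integral_A[OF st]) (auto simp: unit_def)
    moreover have "(\<integral>x. K f x \<partial>\<mu>) = (\<integral>x. (1 - a) * f x + a * A (K f) x \<partial>\<mu>)"
      by (intro Bochner_Integration.integral_cong) (auto simp: sp K_left[OF uw[OF f]])
    ultimately have "(1 - a) * (\<integral>x. K f x \<partial>\<mu>) = (1 - a) * (\<integral>x. f x \<partial>\<mu>)" by (simp add: algebra_simps)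
    then show ?thesis using a_bounds by simp
  qed
  define \<sigma> where "\<sigma> = (\<integral>x. s x \<partial>\<mu>)"
  have us: "unit s" unfolding s_def by (rule uK) (auto simp: unit_def indicator_def)
  \<comment> \<open>Both \<open>\<mu>\<close> and \<open>epsK * \<sigma> * pot\<close> drop by the same amount under \<open>Q\<close>, and both vanish in the limit
    of its iterates, so they coincide.\<close>
  have inv: "(\<integral>x. Q f x \<partial>\<mu>) - epsK * \<sigma> * pot (Q f) = (\<integral>x. f x \<partial>\<mu>) - epsK * \<sigma> * pot f" if f: "unit f" for f
  proof -
    have "(\<integral>x. Q f x \<partial>\<mu>) = (\<integral>x. f x \<partial>\<mu>) - epsK * ((\<integral>y. f y \<partial>\<phi>) * \<sigma>)"
      unfolding Q_def \<sigma>_def using ui[OF uK[OF f]] ui[OF us] by (simp add: intK[OF f])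
    then show ?thesis by (simp add: pot_Q[OF uw[OF f]] algebra_simps)
  qed
  have main: "(\<integral>x. f x \<partial>\<mu>) = epsK * \<sigma> * pot f" if f: "unit f" for f
  proof -
    have un: "unit ((Q ^^ n) f)" for n by (induction n) (auto simp: f uQ)
    have const: "(\<integral>x. (Q ^^ n) f x \<partial>\<mu>) - epsK * \<sigma> * pot ((Q ^^ n) f) = (\<integral>x. f x \<partial>\<mu>) - epsK * \<sigma> * pot f" for n
      by (induction n) (use inv[OF un] in auto)
    obtain c where c: "dominated c f" using uw[OF f] wfun_def by blast
    have lim: "(\<lambda>n. (Q ^^ n) f x) \<longlonglongrightarrow> 0" if "x \<in> space S" for x
    proof (rule Lim_null_comparison)
      show "\<forall>\<^sub>F n in sequentially. norm ((Q ^^ n) f x) \<le> rho ^ n * (c * V' x)"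
        using dominatedD[OF kernel_op_dominated[OF kernel_op_funpow[OF Q_op] c] that]
        by (intro always_eventually) (simp add: mult.assoc)
      show "(\<lambda>n. rho ^ n * (c * V' x)) \<longlonglongrightarrow> 0"
        using const_bounds by (intro tendsto_mult_left_zero LIMSEQ_power_zero) auto
    qed
    have "(\<lambda>n. \<integral>x. (Q ^^ n) f x \<partial>\<mu>) \<longlonglongrightarrow> (\<integral>x. 0 \<partial>\<mu>)"
    proof (rule integral_dominated_convergence[where w="\<lambda>_. 1"])
      show "(Q ^^ n) f \<in> borel_measurable \<mu>" for n using ui[OF un] by simp
      show "AE x in \<mu>. (\<lambda>n. (Q ^^ n) f x) \<longlonglongrightarrow> 0" using lim by (intro AE_I2) (simp add: sp)
      show "AE x in \<mu>. norm ((Q ^^ n) f x) \<le> 1" for n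
        using un[of n] unfolding unit_def by (intro AE_I2) (simp add: sp)
    qed simp_all
    moreover have "(\<lambda>n. pot ((Q ^^ n) f)) \<longlonglongrightarrow> 0"
    proof (rule pot_null[OF _ lim])
      show "dominated \<bar>1\<bar> ((Q ^^ n) f)" for n
        using un[of n] by (intro dominated_bounded) (auto simp: unit_def)
    qed
    ultimately have "(\<lambda>n. (\<integral>x. (Q ^^ n) f x \<partial>\<mu>) - epsK * \<sigma> * pot ((Q ^^ n) f)) \<longlonglongrightarrow> 0 - epsK * \<sigma> * 0"
      by (intro tendsto_diff tendsto_mult_left) simp_all
    then show ?thesis unfolding const by (simp add: LIMSEQ_const_iff)
  qed
  have "unit (\<lambda>_. 1)" unfolding unit_def by simp
  from main[OF this] have one: "epsK * \<sigma> * pot (\<lambda>_. 1) = 1" by (simp add: mu.prob_space)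
  show ?thesis
  proof (rule measure_eqI)
    show "sets \<mu> = sets \<nu>" by (simp add: mu(1) nu_sets)
    fix E assume "E \<in> sets \<mu>"
    then have E: "E \<in> sets S" by (simp add: mu(1))
    then have u: "unit (indicator E)" by (auto simp: unit_def indicator_def)
    have "E \<inter> space \<mu> = E" using sets.sets_into_space[OF E] by (auto simp: sp)
    then have "measure \<mu> E = (\<integral>x. indicator E x \<partial>\<mu>)" using E by (simp add: mu(1))
    also have "\<dots> = pot (indicator E) / pot (\<lambda>_. 1)"
      using main[OF u] one pot_one by (simp add: field_simps)
    finally show "emeasure \<mu> E = emeasure \<nu> E"
      by (simp only: mu.emeasure_eq_measure emeasure_nu[OF E])
  qed
qed

lemma stationary_distr_eq: "stationary_distr S p = \<nu>"
  unfolding stationary_distr_def using nu_stationary stationary_unique by (rule the_equality)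

subsection \<open>The Poisson equation\<close>

lemma nu_weight: "(\<integral>x. V' x \<partial>\<nu>) \<le> b / (1 - lam) + c0"
proof -
  interpret n: prob_space \<nu> by (rule nu_prob)
  have "(\<integral>x. V x \<partial>\<nu>) = (\<integral>x. A V x \<partial>\<nu>)" by (simp add: nu_A wfun_V)
  also have "\<dots> \<le> (\<integral>x. lam * V x + b \<partial>\<nu>)"
  proof (rule integral_mono)
    show "integrable \<nu> (A V)" by (intro nu_integrable wfun_A wfun_V)
    show "integrable \<nu> (\<lambda>x. lam * V x + b)" by (intro nu_integrable wfun_lincomb wfun_V wfun_const)
    show "A V x \<le> lam * V x + b" if "x \<in> space \<nu>" for x
      using A_drift[of x] that b_nonneg by (cases "x \<in> W0") (auto simp: nu_space)
  qed
  also have "\<dots> = lam * (\<integral>x. V x \<partial>\<nu>) + b" using nu_integrable[OF wfun_V] by (simp add: n.prob_space)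
  finally have "(\<integral>x. V x \<partial>\<nu>) \<le> b / (1 - lam)" using lam by (simp add: pos_le_divide_eq algebra_simps)
  moreover have "(\<integral>x. V' x \<partial>\<nu>) = (\<integral>x. V x \<partial>\<nu>) + c0"
    unfolding V'_def[abs_def] using nu_integrable[OF wfun_V] by (simp add: n.prob_space)
  ultimately show ?thesis by simp
qed

text \<open>Up to a multiple of \<open>s\<close> the potential inverts \<open>I - K\<close>, namely \<open>G f - K G f = f - epsK (pot f) s\<close>.
Subtracting \<open>\<nu>(f) G 1\<close> cancels this multiple and leaves \<open>(I - K) v = f - \<nu>(f)\<close>. The resolvent identity
\<open>a (I - A) K = (1 - a) (I - K)\<close> then turns \<open>v\<close> into a solution for the kernel itself.\<close>

definition poisson :: "('w \<Rightarrow> real) \<Rightarrow> 'w \<Rightarrow> real" where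
  "poisson f x = a / (1 - a) * K (\<lambda>y. G f y - (\<integral>z. f z \<partial>\<nu>) * G (\<lambda>_. 1) y) x"

definition poisson_const :: real where
  "poisson_const = 2 / (1 - rho) * (1 + b / (1 - lam) + c0)"

lemma poisson_dominated:
  assumes f: "dominated c f" shows "dominated (poisson_const * c) (poisson f)"
proof -
  have c: "0 \<le> c" by (rule dominated_const_nonneg[OF f w0_space])
  let ?I = "\<integral>z. f z \<partial>\<nu>"
  let ?v = "\<lambda>y. G f y - ?I * G (\<lambda>_. 1) y"
  have rho: "0 < 1 - rho" using const_bounds by simp
  have I: "\<bar>?I\<bar> \<le> c * (b / (1 - lam) + c0)"
    using abs_integral_le[OF nu_sets nu_V f] mult_left_mono[OF nu_weight c] by linarith
  have "dominated (1 / (1 - rho) * c + \<bar>?I\<bar> * (1 / (1 - rho) * 1)) ?v"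
    by (intro dominated_diff dominated_cmult kernel_op_dominated[OF G_op] f)
       (use dominated_const[of 1] in simp)
  then have "dominated (1 / (1 - rho) * (c * (1 + b / (1 - lam) + c0))) ?v"
  proof (rule dominated_mono)
    have "1 / (1 - rho) * c + \<bar>?I\<bar> * (1 / (1 - rho) * 1) = 1 / (1 - rho) * (c + \<bar>?I\<bar>)" by (simp add: algebra_simps)
    also have "\<dots> \<le> 1 / (1 - rho) * (c * (1 + b / (1 - lam) + c0))"
      using I rho by (intro mult_left_mono) (auto simp: algebra_simps)
    finally show "1 / (1 - rho) * c + \<bar>?I\<bar> * (1 / (1 - rho) * 1) \<le> 1 / (1 - rho) * (c * (1 + b / (1 - lam) + c0))" .
  qed
  from dominated_cmult[OF kernel_op_dominated[OF K_op this], of "a / (1 - a)"]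
  have "dominated (\<bar>a / (1 - a)\<bar> * (poisson_const * c)) (poisson f)"
    by (simp add: poisson_def[abs_def] poisson_const_def ac_simps)
  moreover have "\<bar>a / (1 - a)\<bar> \<le> 1" using a_bounds by (simp add: divide_le_eq)
  moreover have "0 \<le> poisson_const * c"
    using c rho const_bounds lam b_nonneg by (simp add: poisson_const_def)
  ultimately show ?thesis by (elim dominated_mono) (rule mult_left_le_one_le, auto)
qed

lemma poisson_eq:
  assumes f: "wfun f" and x: "x \<in> space S"
  shows "poisson f x - A (poisson f) x = f x - (\<integral>z. f z \<partial>\<nu>)"
proof -
  let ?I = "\<integral>z. f z \<partial>\<nu>"
  define v where "v y = G f y - ?I * G (\<lambda>_. 1) y" for y
  have wv: "wfun v" unfolding v_def[abs_def] by (intro wfun_diff wfun_cmult wfun_G f wfun_const)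
  have KG: "K (G g) x = G g x - g x + epsK * pot g * s x" if "wfun g" for g
    using Q_G[OF that x] by (simp add: Q_def pot_def)
  have "K v x = K (G f) x - ?I * K (G (\<lambda>_. 1)) x"
    unfolding v_def[abs_def]
    by (simp add: kernel_op_diff[OF K_op wfun_G[OF f] wfun_cmult[OF wfun_G[OF wfun_const]] x]
        kernel_op_cmult[OF K_op wfun_G[OF wfun_const] x])
  also have "\<dots> = v x - (f x - ?I) + epsK * s x * (pot f - ?I * pot (\<lambda>_. 1))"
    by (simp add: KG f wfun_const v_def algebra_simps)
  also have "pot f - ?I * pot (\<lambda>_. 1) = 0" using pot_one by (simp add: nu_integral[OF f])
  finally have Kv: "K v x = v x - (f x - ?I)" by simp
  have "A (poisson f) x = a / (1 - a) * A (K v) x"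
    unfolding poisson_def[abs_def] v_def[abs_def, symmetric] by (rule kernel_op_cmult[OF A_op wfun_K[OF wv] x])
  then have "poisson f x - A (poisson f) x = (a * K v x - a * A (K v) x) / (1 - a)"
    by (simp add: poisson_def v_def[abs_def, symmetric] diff_divide_distrib)
  also have "a * K v x - a * A (K v) x = (1 - a) * (f x - ?I)"
  proof -
    have "a * A (K v) x = K v x - (1 - a) * v x" using K_left[OF wv x] by linarith
    then show ?thesis by (simp only: Kv) (simp add: algebra_simps)
  qed
  finally show ?thesis using a_bounds by simp
qed

text \<open>Integrating against \<open>\<nu>\<close> shows \<open>k = 0\<close>. Then \<open>d\<close> is harmonic for \<open>K\<close>, hence \<open>d - \<phi>(d)\<close> is a fixed point
of the contraction \<open>Q\<close>.\<close>

lemma harmonic_constant: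
  assumes d: "wfun d" and hk: "\<And>x. x \<in> space S \<Longrightarrow> d x - A d x = k" and x: "x \<in> space S"
  shows "d x = d w0"
proof -
  interpret ph: prob_space \<phi> by (rule phi_prob)
  interpret n: prob_space \<nu> by (rule nu_prob)
  have "(\<integral>x. d x - A d x \<partial>\<nu>) = (\<integral>x. k \<partial>\<nu>)"
    by (rule Bochner_Integration.integral_cong) (auto simp: hk nu_space)
  then have "k = 0" using nu_integrable[OF d] nu_integrable[OF wfun_A[OF d]] by (simp add: nu_A[OF d] n.prob_space)
  then have h: "A d x = d x" if "x \<in> space S" for x using hk[OF that] by simp
  let ?c = "\<integral>y. d y \<partial>\<phi>"
  have Kd: "K d y = d y" if y: "y \<in> space S" for y
  proof -
    have "K (A d) y = K d y" by (rule kernel_op_cong[OF K_op wfun_A[OF d] d h y])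
    with K_right[OF d y] have "(1 - a) * K d y = (1 - a) * d y" by (simp add: algebra_simps)
    then show ?thesis using a_bounds by simp
  qed
  have "d y - ?c = 0" if "y \<in> space S" for y
  proof (rule fixed_point_zero[OF Q_op, of "\<lambda>y. d y - ?c", OF _ _ _ _ that])
    show "wfun (\<lambda>y. d y - ?c)" by (intro wfun_diff d wfun_const)
    show "Q (\<lambda>y. d y - ?c) y = d y - ?c" if y: "y \<in> space S" for y
      using phi_integrable[OF d]
      by (simp add: Q_def kernel_op_diff[OF K_op d wfun_const y] Kd[OF y] K_const[OF y] ph.prob_space)
  qed (use const_bounds in auto)
  from this[OF x] this[OF w0_space] show ?thesis by simp
qed

end

section \<open>Poisson solutions depending Lipschitz continuously on the parameter\<close>

lemma U_ge_1: "1 \<le> U n w" by (simp add: U_def)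

lemma U_measurable [measurable]: "U n \<in> borel_measurable borel"
  unfolding U_def[abs_def] by measurable

lemma sqrt_U2_bounds: "1 \<le> sqrt (U 2 w)" "sqrt (U 2 w) \<le> U 1 w" "U 1 w \<le> 2 * sqrt (U 2 w)"
proof -
  show 1: "1 \<le> sqrt (U 2 w)" by (simp add: U_def)
  show "sqrt (U 2 w) \<le> U 1 w"
    by (rule real_le_lsqrt) (auto simp: U_def power2_eq_square algebra_simps)
  have "norm w \<le> sqrt (U 2 w)" by (rule real_le_rsqrt) (simp add: U_def)
  moreover have "U 1 w = 1 + norm w" by (simp add: U_def)
  ultimately show "U 1 w \<le> 2 * sqrt (U 2 w)" using 1 by linarith
qed

text \<open>Jensen's inequality in the form of the tangent \<open>sqrt x \<le> s / 2 + x / (2 * s)\<close> at \<open>x = t\<close>, where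
\<open>s = sqrt t\<close>. The bound \<open>1 \<le> g\<close> forces \<open>1 \<le> t\<close>, so \<open>s\<close> is positive.\<close>

lemma nn_integral_sqrt_le:
  assumes M: "prob_space M" and g: "g \<in> borel_measurable M" "\<And>x. x \<in> space M \<Longrightarrow> 1 \<le> g x"
    and t: "(\<integral>\<^sup>+x. ennreal (g x) \<partial>M) \<le> ennreal t" "0 \<le> t"
  shows "(\<integral>\<^sup>+x. ennreal (sqrt (g x)) \<partial>M) \<le> ennreal (sqrt t)"
proof -
  interpret prob_space M by fact
  have "(\<integral>\<^sup>+x. 1 \<partial>M) \<le> (\<integral>\<^sup>+x. ennreal (g x) \<partial>M)"
    using g by (intro nn_integral_mono) (simp add: ennreal_1[symmetric] ennreal_leI del: ennreal_1)
  from order_trans[OF this t(1)] have "1 \<le> ennreal t" by (simp add: emeasure_space_1)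
  then have "ennreal 1 \<le> ennreal t" by simp
  then have t1: "1 \<le> t" using t(2) by (simp add: ennreal_le_iff del: ennreal_1)
  define s where "s = sqrt t"
  have s: "1 \<le> s" "s * s = t" using t1 by (auto simp: s_def)
  have le: "sqrt (g x) \<le> s / 2 + 1 / (2 * s) * g x" if "x \<in> space M" for x
  proof -
    have "0 \<le> (sqrt (g x) - s)\<^sup>2" by simp
    also have "\<dots> = g x + s * s - 2 * s * sqrt (g x)"
      using g(2)[OF that] by (simp add: power2_eq_square algebra_simps)
    finally have "2 * s * sqrt (g x) \<le> g x + s * s" by simp
    then have "sqrt (g x) \<le> (g x + s * s) / (2 * s)" using s by (simp add: pos_le_divide_eq mult.commute)
    also have "(g x + s * s) / (2 * s) = s / 2 + 1 / (2 * s) * g x" using s(1) by (simp add: field_simps)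
    finally show ?thesis .
  qed
  have "(\<integral>\<^sup>+x. ennreal (sqrt (g x)) \<partial>M) \<le> (\<integral>\<^sup>+x. ennreal (s / 2) + ennreal (1 / (2 * s)) * ennreal (g x) \<partial>M)"
    using le s g(2) by (intro nn_integral_mono)
      (force simp: ennreal_plus[symmetric] ennreal_mult[symmetric] simp del: ennreal_plus intro!: ennreal_leI)
  also have "\<dots> = ennreal (s / 2) + ennreal (1 / (2 * s)) * (\<integral>\<^sup>+x. ennreal (g x) \<partial>M)"
    using g(1) by (simp add: nn_integral_add nn_integral_cmult emeasure_space_1)
  also have "\<dots> \<le> ennreal (s / 2) + ennreal (1 / (2 * s)) * ennreal t"
    using t by (intro add_left_mono mult_left_mono) auto
  also have "\<dots> = ennreal (s / 2 + 1 / (2 * s) * t)"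
    using s(1) t(2) by (subst ennreal_mult[symmetric]) (auto simp: ennreal_plus[symmetric] simp del: ennreal_plus)
  also have "s / 2 + 1 / (2 * s) * t = s" using s by (simp add: s(2)[symmetric])
  finally show ?thesis by (simp add: s_def)
qed

lemma kernel_section:
  assumes "model \<Theta> \<W> F P" and "\<theta> \<in> \<Theta>"
  shows "P \<theta> \<in> restrict_space borel \<W> \<rightarrow>\<^sub>M prob_algebra (restrict_space borel \<W>)"
    and "F \<theta> \<in> borel_measurable (restrict_space borel \<W>)"
proof -
  have \<theta>: "\<theta> \<in> space (restrict_space borel \<Theta>)" using assms(2) by (simp add: space_restrict_space)
  let ?S = "restrict_space borel \<W>"
  have P: "(\<lambda>(\<theta>, w). P \<theta> w) \<in> restrict_space borel \<Theta> \<Otimes>\<^sub>M ?S \<rightarrow>\<^sub>M prob_algebra ?S"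
    and F: "(\<lambda>(\<theta>, w). F \<theta> w) \<in> borel_measurable (restrict_space borel \<Theta> \<Otimes>\<^sub>M ?S)"
    using assms(1) by (auto simp: model_def)
  show "P \<theta> \<in> ?S \<rightarrow>\<^sub>M prob_algebra ?S"
    using measurable_compose[OF measurable_Pair1'[OF \<theta>] P] by simp
  show "F \<theta> \<in> borel_measurable ?S"
    using measurable_compose[OF measurable_Pair1'[OF \<theta>] F] by simp
qed

text \<open>Kernel continuity controls functions bounded by \<open>U 1\<close>, so the corrector has to be bounded by \<open>U 1\<close>
rather than \<open>U 2\<close>. The drift therefore is passed to \<open>sqrt (U 2)\<close>, which is comparable with \<open>U 1\<close>.\<close>

lemma small_set_kernel_sqrt_weight:
  assumes model: "model \<Theta> \<W> F P"
    and erg: "uniform_ergodicity \<Theta> \<W> P N \<W>\<^sub>0 \<epsilon>\<^sub>0 \<phi> lam c"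
    and \<theta>: "\<theta> \<in> \<Theta>" and w0: "w0 \<in> \<W>\<^sub>0"
  shows "small_set_kernel (restrict_space borel \<W>) (P \<theta>) (\<lambda>w. sqrt (U 2 w)) \<W>\<^sub>0 w0 \<phi>
    (sqrt lam) (sqrt c) \<epsilon>\<^sub>0 N"
proof -
  let ?S = "restrict_space borel \<W>"
  have sp: "space ?S = \<W>" by (simp add: space_restrict_space)
  note e = erg[unfolded uniform_ergodicity_def Let_def]
  note k = kernel_section(1)[OF model \<theta>]
  have meas: "U 2 \<in> borel_measurable ?S" by (intro measurable_restrict_space1) measurable
  show ?thesis
  proof
    fix w assume w: "w \<in> space ?S"
    have pw: "prob_space (P \<theta> w)" "sets (P \<theta> w) = sets ?S"
      using measurable_space[OF k w] by (auto simp: space_prob_algebra)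
    have "(\<integral>\<^sup>+y. ennreal (sqrt (U 2 y)) \<partial>P \<theta> w) \<le> ennreal (sqrt (lam * U 2 w + c * indicator \<W>\<^sub>0 w))"
    proof (rule nn_integral_sqrt_le[OF pw(1)])
      show "U 2 \<in> borel_measurable (P \<theta> w)" using meas by (simp add: measurable_cong_sets[OF pw(2) refl])
      show "(\<integral>\<^sup>+y. ennreal (U 2 y) \<partial>P \<theta> w) \<le> ennreal (lam * U 2 w + c * indicator \<W>\<^sub>0 w)"
        using e \<theta> w sp by auto
      show "0 \<le> lam * U 2 w + c * indicator \<W>\<^sub>0 w" using e U_ge_1[of 2 w] by (auto simp: indicator_def)
    qed (rule U_ge_1)
    also have "\<dots> \<le> ennreal (sqrt lam * sqrt (U 2 w) + sqrt c * indicator \<W>\<^sub>0 w)"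
    proof (rule ennreal_leI)
      have "sqrt (lam * U 2 w + c * indicator \<W>\<^sub>0 w) \<le> sqrt (lam * U 2 w) + sqrt (c * indicator \<W>\<^sub>0 w)"
        using e U_ge_1[of 2 w] by (intro sqrt_add_le_add_sqrt) (auto simp: indicator_def)
      also have "\<dots> = sqrt lam * sqrt (U 2 w) + sqrt c * indicator \<W>\<^sub>0 w"
        by (simp add: real_sqrt_mult indicator_def)
      finally show "sqrt (lam * U 2 w + c * indicator \<W>\<^sub>0 w) \<le> sqrt lam * sqrt (U 2 w) + sqrt c * indicator \<W>\<^sub>0 w" .
    qed
    finally show "(\<integral>\<^sup>+y. ennreal (sqrt (U 2 y)) \<partial>P \<theta> w) \<le> ennreal (sqrt lam * sqrt (U 2 w) + sqrt c * indicator \<W>\<^sub>0 w)" .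
  next
    show "(\<lambda>w. sqrt (U 2 w)) \<in> borel_measurable ?S" using meas by measurable
    show "1 \<le> sqrt (U 2 x)" for x :: 'b by (rule sqrt_U2_bounds)
  qed (use e k w0 \<theta> in auto)
qed

lemma stationary_integrable_U1:
  assumes model: "model \<Theta> \<W> F P"
    and erg: "uniform_ergodicity \<Theta> \<W> P N \<W>\<^sub>0 \<epsilon>\<^sub>0 \<phi> lam c"
    and \<theta>: "\<theta> \<in> \<Theta>"
  shows "integrable (stationary_distr (restrict_space borel \<W>) (P \<theta>)) (U 1)"
    and "sets (stationary_distr (restrict_space borel \<W>) (P \<theta>)) = sets (restrict_space borel \<W>)"
proof -
  obtain w0 where w0: "w0 \<in> \<W>\<^sub>0" using erg by (auto simp: uniform_ergodicity_def Let_def)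
  interpret k: small_set_kernel "restrict_space borel \<W>" "P \<theta>" "\<lambda>w. sqrt (U 2 w)" \<W>\<^sub>0 w0 \<phi>
    "sqrt lam" "sqrt c" \<epsilon>\<^sub>0 N
    by (rule small_set_kernel_sqrt_weight[OF model erg \<theta> w0])
  show "sets (stationary_distr (restrict_space borel \<W>) (P \<theta>)) = sets (restrict_space borel \<W>)"
    by (simp only: k.stationary_distr_eq k.nu_sets)
  have "k.dominated 2 (U 1)"
    unfolding k.dominated_def
  proof (intro conjI ballI)
    show "U 1 \<in> borel_measurable (restrict_space borel \<W>)" by (intro measurable_restrict_space1) measurable
    show "\<bar>U 1 w\<bar> \<le> 2 * k.V' w" for w
      using sqrt_U2_bounds(3)[of w] k.const_bounds(5) U_ge_1[of 1 w] by (simp add: k.V'_def)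
  qed
  then show "integrable (stationary_distr (restrict_space borel \<W>) (P \<theta>)) (U 1)"
    unfolding k.stationary_distr_eq by (rule k.nu_integrable[OF k.dominated_wfun])
qed

text \<open>The bound on \<open>u\<close> is uniform because \<open>poisson_const\<close> depends only on the common drift and minorization
constants. For the dependence on the parameter, apply \<open>I - P \<theta>'\<close> to \<open>u \<theta> - u \<theta>'\<close>: up to a constant the
result is \<open>f \<theta> - f \<theta>' + (P \<theta> - P \<theta>') (u \<theta>)\<close>, which is of order \<open>norm (\<theta> - \<theta>')\<close> by kernel continuity.
The Poisson solution for this right-hand side is of the same order and differs from \<open>u \<theta> - u \<theta>'\<close> only
by a constant, which the normalisation \<open>u \<theta> w0 = 0\<close> determines.\<close>

lemma poisson_family:
  fixes f :: "'d::euclidean_space \<Rightarrow> 'w::euclidean_space \<Rightarrow> real"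
  assumes model: "model \<Theta> \<W> F P"
    and erg: "uniform_ergodicity \<Theta> \<W> P N \<W>\<^sub>0 \<epsilon>\<^sub>0 \<phi> lam c"
    and cont: "kernel_continuity \<Theta> \<W> P L\<^sub>P"
    and f_meas: "\<And>\<theta>. \<theta> \<in> \<Theta> \<Longrightarrow> f \<theta> \<in> borel_measurable (restrict_space borel \<W>)"
    and f_bound: "\<And>\<theta> w. \<theta> \<in> \<Theta> \<Longrightarrow> w \<in> \<W> \<Longrightarrow> \<bar>f \<theta> w\<bar> \<le> c\<^sub>1 * U 1 w"
    and f_lip: "\<And>\<theta> \<theta>' w. \<theta> \<in> \<Theta> \<Longrightarrow> \<theta>' \<in> \<Theta> \<Longrightarrow> w \<in> \<W> \<Longrightarrow>
      \<bar>f \<theta> w - f \<theta>' w\<bar> \<le> c\<^sub>2 * U 1 w * norm (\<theta> - \<theta>')"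
    and nonneg: "0 \<le> c\<^sub>1" "0 \<le> c\<^sub>2"
  obtains u :: "'d \<Rightarrow> 'w \<Rightarrow> real" and L where "0 \<le> L"
    and "\<And>\<theta>. \<theta> \<in> \<Theta> \<Longrightarrow> u \<theta> \<in> borel_measurable (restrict_space borel \<W>)"
    and "\<And>\<theta> w. \<theta> \<in> \<Theta> \<Longrightarrow> w \<in> \<W> \<Longrightarrow> \<bar>u \<theta> w\<bar> \<le> L * U 1 w"
    and "\<And>\<theta> \<theta>' w. \<theta> \<in> \<Theta> \<Longrightarrow> \<theta>' \<in> \<Theta> \<Longrightarrow> w \<in> \<W> \<Longrightarrow>
      \<bar>u \<theta> w - u \<theta>' w\<bar> \<le> L * U 1 w * norm (\<theta> - \<theta>')"
    and "\<And>\<theta> w. \<theta> \<in> \<Theta> \<Longrightarrow> w \<in> \<W> \<Longrightarrow>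
      u \<theta> w - (\<integral>y. u \<theta> y \<partial>P \<theta> w)
        = f \<theta> w - (\<integral>y. f \<theta> y \<partial>stationary_distr (restrict_space borel \<W>) (P \<theta>))"
proof -
  define S where "S = restrict_space borel \<W>"
  have sp: "space S = \<W>" by (simp add: S_def space_restrict_space)
  obtain w0 where w0: "w0 \<in> \<W>\<^sub>0" using erg by (auto simp: uniform_ergodicity_def Let_def)
  then have w0W: "w0 \<in> \<W>"
    using erg sets.sets_into_space[of "\<W>\<^sub>0" S] sp by (auto simp: uniform_ergodicity_def Let_def S_def)
  have LP: "0 < L\<^sub>P" using cont by (simp add: kernel_continuity_def)
  define l where "l = sqrt lam"
  define b where "b = sqrt c"
  define V where "V = (\<lambda>w::'w. sqrt (U 2 w))"
  have ker: "small_set_kernel S (P \<theta>) V \<W>\<^sub>0 w0 \<phi> l b \<epsilon>\<^sub>0 N" if "\<theta> \<in> \<Theta>" for \<theta>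
    unfolding S_def l_def b_def V_def by (rule small_set_kernel_sqrt_weight[OF model erg that w0])
  define c0 where "c0 = small_set_kernel.c0 l b \<epsilon>\<^sub>0 N"
  define C where "C = small_set_kernel.poisson_const l b \<epsilon>\<^sub>0 N"
  define dom where "dom = weighted_functions.dominated S (small_set_kernel.V' V l b \<epsilon>\<^sub>0 N)"
  define pois where "pois \<theta> = small_set_kernel.poisson S (P \<theta>) \<W>\<^sub>0 \<phi> b \<epsilon>\<^sub>0 N" for \<theta>
  define D where "D = 2 * \<bar>C\<bar> * (1 + c0)"
  define u where "u \<theta> w = pois \<theta> (f \<theta>) w - pois \<theta> (f \<theta>) w0" for \<theta> w
  define C\<^sub>1 where "C\<^sub>1 = D * c\<^sub>1 * (1 + U 1 w0)"
  define C\<^sub>2 where "C\<^sub>2 = D * (c\<^sub>2 + C\<^sub>1 * L\<^sub>P) * (1 + U 1 w0)"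
  have U0: "0 \<le> U 1 w" for w :: 'w using U_ge_1[of 1 w] by simp
  \<comment> \<open>The shifted weight \<open>V'\<close> lies between \<open>U 1 / 2\<close> and \<open>(1 + c0) * U 1\<close>, which accounts for the factors
    \<open>2\<close> and \<open>1 + c0\<close>.\<close>
  have dom_I: "dom (2 * k) g" if "\<theta> \<in> \<Theta>" "g \<in> borel_measurable S" "\<And>w. w \<in> \<W> \<Longrightarrow> \<bar>g w\<bar> \<le> k * U 1 w" "0 \<le> k" for \<theta> k g
  proof -
    interpret k: small_set_kernel S "P \<theta>" V \<W>\<^sub>0 w0 \<phi> l b \<epsilon>\<^sub>0 N by (rule ker[OF that(1)])
    have "\<bar>g w\<bar> \<le> 2 * k * k.V' w" if w: "w \<in> \<W>" for w
    proof -
      have kV: "k.V' w = sqrt (U 2 w) + k.c0" unfolding k.V'_def unfolding V_def ..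
      have "k * U 1 w \<le> k * (2 * k.V' w)"
        using sqrt_U2_bounds(3)[of w] k.const_bounds(5) \<open>0 \<le> k\<close> unfolding kV by (intro mult_left_mono) auto
      then show ?thesis using \<open>\<And>w. w \<in> \<W> \<Longrightarrow> \<bar>g w\<bar> \<le> k * U 1 w\<close>[OF w] by simp
    qed
    then show ?thesis using that(2) by (simp add: dom_def k.dominated_def sp)
  qed
  have pois_bound: "\<bar>pois \<theta> g w - pois \<theta> g w0\<bar> \<le> D * k * (1 + U 1 w0) * U 1 w"
    and pois_meas: "pois \<theta> g \<in> borel_measurable S"
    if "\<theta> \<in> \<Theta>" "g \<in> borel_measurable S" "\<And>w. w \<in> \<W> \<Longrightarrow> \<bar>g w\<bar> \<le> k * U 1 w" "0 \<le> k" "w \<in> \<W>" for \<theta> k g w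
  proof -
    interpret k: small_set_kernel S "P \<theta>" V \<W>\<^sub>0 w0 \<phi> l b \<epsilon>\<^sub>0 N by (rule ker[OF that(1)])
    have d: "k.dominated (C * (2 * k)) (pois \<theta> g)"
      using k.poisson_dominated dom_I[OF that(1-4)] by (simp add: dom_def C_def pois_def)
    then show "pois \<theta> g \<in> borel_measurable S" by (rule k.dominated_measurable)
    have b: "\<bar>pois \<theta> g y\<bar> \<le> D * k * U 1 y" if "y \<in> \<W>" for y
    proof -
      have kV: "k.V' y = sqrt (U 2 y) + c0" unfolding k.V'_def unfolding V_def c0_def ..
      have "\<bar>pois \<theta> g y\<bar> \<le> C * (2 * k) * k.V' y" using k.dominatedD[OF d] that sp by simp
      also have "\<dots> \<le> \<bar>C\<bar> * (2 * k) * ((1 + c0) * U 1 y)"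
      proof (intro mult_mono)
        have "c0 \<le> c0 * U 1 y" using k.const_bounds(5) mult_left_mono[OF U_ge_1[of 1 y], of c0] by (simp add: c0_def)
        then show "k.V' y \<le> (1 + c0) * U 1 y"
          using sqrt_U2_bounds(2)[of y] unfolding kV by (simp add: algebra_simps)
      qed (use that sp \<open>0 \<le> k\<close> k.V_nonneg in auto)
      finally show ?thesis by (simp only: D_def ac_simps)
    qed
    have Dk: "0 \<le> D * k" using \<open>0 \<le> k\<close> k.const_bounds(5) by (simp add: D_def c0_def)
    have "D * k * U 1 w0 * 1 \<le> D * k * U 1 w0 * U 1 w"
      using Dk U0[of w0] U_ge_1[of 1 w] by (intro mult_left_mono) auto
    then show "\<bar>pois \<theta> g w - pois \<theta> g w0\<bar> \<le> D * k * (1 + U 1 w0) * U 1 w"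
      using b[OF that(5)] b[OF w0W] by (simp add: algebra_simps)
  qed
  show ?thesis
  proof (cases "\<Theta> = {}")
    case True then show ?thesis using that[of 0] by simp
  next
    case False
    then obtain \<theta>0 where "\<theta>0 \<in> \<Theta>" by blast
    have D: "0 \<le> D"
      using small_set_kernel.const_bounds(5)[OF ker[OF \<open>\<theta>0 \<in> \<Theta>\<close>]] by (simp add: D_def c0_def)
    have C1: "0 \<le> C\<^sub>1" using D nonneg U0[of w0] by (simp add: C\<^sub>1_def)
    have C2: "0 \<le> C\<^sub>2" using D nonneg U0[of w0] LP C1 by (simp add: C\<^sub>2_def)
    have u_meas: "u \<theta> \<in> borel_measurable S" if "\<theta> \<in> \<Theta>" for \<theta>
      unfolding u_def[abs_def] using pois_meas[OF that f_meas[OF that, folded S_def] f_bound[OF that] nonneg(1) w0W]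
      by measurable
    have u_bound: "\<bar>u \<theta> w\<bar> \<le> C\<^sub>1 * U 1 w" if "\<theta> \<in> \<Theta>" "w \<in> \<W>" for \<theta> w
      unfolding u_def C\<^sub>1_def
      by (rule pois_bound[OF that(1) f_meas[OF that(1), folded S_def] f_bound[OF that(1)] nonneg(1) that(2)])
    have u_eq: "u \<theta> w - (\<integral>y. u \<theta> y \<partial>P \<theta> w) = f \<theta> w - (\<integral>y. f \<theta> y \<partial>stationary_distr S (P \<theta>))"
      if \<theta>: "\<theta> \<in> \<Theta>" and w: "w \<in> \<W>" for \<theta> w
    proof -
      interpret k: small_set_kernel S "P \<theta>" V \<W>\<^sub>0 w0 \<phi> l b \<epsilon>\<^sub>0 N by (rule ker[OF \<theta>])
      have wS: "w \<in> space S" using w sp by simp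
      have "k.dominated (2 * c\<^sub>1) (f \<theta>)"
        using dom_I[OF \<theta> f_meas[OF \<theta>, folded S_def] f_bound[OF \<theta>] nonneg(1)] by (simp add: dom_def)
      note d = this k.poisson_dominated[OF this]
      have "k.A (u \<theta>) w = k.A (k.poisson (f \<theta>)) w - k.A (\<lambda>_. k.poisson (f \<theta>) w0) w"
        unfolding u_def[abs_def] pois_def
        by (rule k.kernel_op_diff[OF k.A_op k.dominated_wfun[OF d(2)] k.wfun_const wS])
      then show ?thesis
        using k.poisson_eq[OF k.dominated_wfun[OF d(1)] wS]
        by (simp add: k.A_const[OF wS] k.A_def[of "u \<theta>"] u_def pois_def k.stationary_distr_eq)
    qed
    have u_lip: "\<bar>u \<theta> w - u \<theta>' w\<bar> \<le> C\<^sub>2 * U 1 w * norm (\<theta> - \<theta>')"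
      if \<theta>: "\<theta> \<in> \<Theta>" and \<theta>': "\<theta>' \<in> \<Theta>" and w: "w \<in> \<W>" for \<theta> \<theta>' w
    proof -
      interpret k: small_set_kernel S "P \<theta>" V \<W>\<^sub>0 w0 \<phi> l b \<epsilon>\<^sub>0 N by (rule ker[OF \<theta>])
      interpret k': small_set_kernel S "P \<theta>'" V \<W>\<^sub>0 w0 \<phi> l b \<epsilon>\<^sub>0 N by (rule ker[OF \<theta>'])
      have wS: "w \<in> space S" using w sp by simp
      define r where "r = norm (\<theta> - \<theta>')"
      \<comment> \<open>The right-hand side of the Poisson equation for \<open>P \<theta>'\<close> satisfied by the difference.\<close>
      define h where "h y = f \<theta> y - f \<theta>' y + (k.A (u \<theta>) y - k'.A (u \<theta>) y)" for y
      have "k.dominated (2 * C\<^sub>1) (u \<theta>)" "k.dominated (2 * C\<^sub>1) (u \<theta>')"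
        using dom_I[OF \<theta> u_meas[OF \<theta>] u_bound[OF \<theta>] C1] dom_I[OF \<theta>' u_meas[OF \<theta>'] u_bound[OF \<theta>'] C1]
        by (simp_all add: dom_def)
      then have wu: "k.wfun (u \<theta>)" "k.wfun (u \<theta>')" by (auto intro: k.dominated_wfun)
      have "k.dominated (2 * c\<^sub>1) (f \<theta>)" "k.dominated (2 * c\<^sub>1) (f \<theta>')"
        using dom_I[OF \<theta> f_meas[OF \<theta>, folded S_def] f_bound[OF \<theta>] nonneg(1)]
          dom_I[OF \<theta>' f_meas[OF \<theta>', folded S_def] f_bound[OF \<theta>'] nonneg(1)]
        by (simp_all add: dom_def)
      then have wf: "k.wfun (f \<theta>)" "k.wfun (f \<theta>')" by (auto intro: k.dominated_wfun)
      have h_meas: "h \<in> borel_measurable S"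
        unfolding h_def[abs_def]
        using k.wfun_measurable[OF wf(1)] k.wfun_measurable[OF wf(2)]
          k.wfun_measurable[OF k.wfun_A[OF wu(1)]] k.wfun_measurable[OF k'.wfun_A[OF wu(1)]]
        by measurable
      have h_bound: "\<bar>h y\<bar> \<le> ((c\<^sub>2 + C\<^sub>1 * L\<^sub>P) * r) * U 1 y" if y: "y \<in> \<W>" for y
      proof -
        have "\<bar>k.A (u \<theta>) y - k'.A (u \<theta>) y\<bar> \<le> C\<^sub>1 * (L\<^sub>P * U 1 y * r)"
        proof (cases "C\<^sub>1 = 0")
          case True
          have yS: "y \<in> space S" using y sp by simp
          have z: "u \<theta> x = 0" if "x \<in> space S" for x using u_bound[OF \<theta>] that True sp by simp
          have "k.A (u \<theta>) y = k.A (\<lambda>_. 0) y" "k'.A (u \<theta>) y = k'.A (\<lambda>_. 0) y"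
            by (rule k.kernel_op_cong[OF k.A_op wu(1) k.wfun_const z yS])
               (assumption, rule k.kernel_op_cong[OF k'.A_op wu(1) k.wfun_const z yS])
          then show ?thesis using True by (simp add: k.A_const[OF yS] k'.A_const[OF yS])
        next
          case False
          then have C1': "0 < C\<^sub>1" using C1 by simp
          let ?g = "\<lambda>x. u \<theta> x / C\<^sub>1"
          have "?g \<in> borel_measurable (restrict_space borel \<W>)" using u_meas[OF \<theta>] unfolding S_def by measurable
          moreover have "\<forall>x\<in>\<W>. \<bar>?g x\<bar> \<le> U 1 x"
            using u_bound[OF \<theta>] C1' by (simp add: pos_divide_le_eq mult.commute)
          ultimately have "\<bar>(\<integral>x. ?g x \<partial>P \<theta> y) - (\<integral>x. ?g x \<partial>P \<theta>' y)\<bar> \<le> L\<^sub>P * U 1 y * r"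
            using cont \<theta> \<theta>' y unfolding kernel_continuity_def r_def by blast
          then have "\<bar>k.A (u \<theta>) y / C\<^sub>1 - k'.A (u \<theta>) y / C\<^sub>1\<bar> \<le> L\<^sub>P * U 1 y * r"
            by (simp add: k.A_def k'.A_def)
          then have "\<bar>k.A (u \<theta>) y - k'.A (u \<theta>) y\<bar> / C\<^sub>1 \<le> L\<^sub>P * U 1 y * r"
            using C1' by (simp add: diff_divide_distrib[symmetric])
          then show ?thesis using C1' by (simp add: pos_divide_le_eq mult.commute)
        qed
        moreover have "\<bar>f \<theta> y - f \<theta>' y\<bar> \<le> c\<^sub>2 * U 1 y * r" unfolding r_def by (rule f_lip[OF \<theta> \<theta>' y])
        ultimately show ?thesis unfolding h_def by (simp add: algebra_simps)
      qed
      have kr: "0 \<le> (c\<^sub>2 + C\<^sub>1 * L\<^sub>P) * r" using nonneg C1 LP by (simp add: r_def)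
      have "k.dominated (2 * ((c\<^sub>2 + C\<^sub>1 * L\<^sub>P) * r)) h"
        using dom_I[OF \<theta>' h_meas h_bound kr] by (simp add: dom_def)
      then have wh: "k.wfun h" and wz: "k.wfun (k'.poisson h)"
        by (auto intro: k.dominated_wfun k'.poisson_dominated)
      define z where "z = k'.poisson h"
      have wz: "k.wfun z" using wz by (simp add: z_def)
      define d where "d y = u \<theta> y - u \<theta>' y - z y" for y
      have wd: "k.wfun d" unfolding d_def[abs_def] by (intro k.wfun_diff wu wz)
      define \<kappa> where "\<kappa> = (\<integral>y. h y \<partial>k'.\<nu>) - (\<integral>y. f \<theta> y \<partial>k.\<nu>) + (\<integral>y. f \<theta>' y \<partial>k'.\<nu>)"
      have dk: "d y - k'.A d y = \<kappa>" if y: "y \<in> space S" for y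
      proof -
        have "k'.A d y = k'.A (\<lambda>y. u \<theta> y - u \<theta>' y) y - k'.A z y"
          unfolding d_def[abs_def] by (rule k.kernel_op_diff[OF k'.A_op k.wfun_diff[OF wu] wz y])
        also have "k'.A (\<lambda>y. u \<theta> y - u \<theta>' y) y = k'.A (u \<theta>) y - k'.A (u \<theta>') y"
          by (rule k.kernel_op_diff[OF k'.A_op wu y])
        finally have "k'.A d y = k'.A (u \<theta>) y - k'.A (u \<theta>') y - k'.A z y" .
        moreover have "z y - k'.A z y = h y - (\<integral>y. h y \<partial>k'.\<nu>)"
          unfolding z_def by (rule k'.poisson_eq[OF wh y])
        moreover have "u \<theta> y - k.A (u \<theta>) y = f \<theta> y - (\<integral>y. f \<theta> y \<partial>k.\<nu>)"
          using u_eq[OF \<theta>, of y] y sp by (simp add: k.A_def k.stationary_distr_eq)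
        moreover have "u \<theta>' y - k'.A (u \<theta>') y = f \<theta>' y - (\<integral>y. f \<theta>' y \<partial>k'.\<nu>)"
          using u_eq[OF \<theta>', of y] y sp by (simp add: k'.A_def k'.stationary_distr_eq)
        ultimately show ?thesis unfolding d_def \<kappa>_def h_def by linarith
      qed
      have "d w = d w0" by (rule k'.harmonic_constant[OF wd dk wS])
      then have "u \<theta> w - u \<theta>' w = z w - z w0" by (simp add: d_def u_def)
      then have "\<bar>u \<theta> w - u \<theta>' w\<bar> \<le> D * ((c\<^sub>2 + C\<^sub>1 * L\<^sub>P) * r) * (1 + U 1 w0) * U 1 w"
        using pois_bound[OF \<theta>' h_meas h_bound kr w] by (simp add: z_def pois_def)
      then show ?thesis by (simp add: C\<^sub>2_def r_def ac_simps)
    qed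
    show ?thesis
    proof (rule that[of "C\<^sub>1 + C\<^sub>2" u])
      show "0 \<le> C\<^sub>1 + C\<^sub>2" using C1 C2 by simp
      show "\<bar>u \<theta> w\<bar> \<le> (C\<^sub>1 + C\<^sub>2) * U 1 w" if "\<theta> \<in> \<Theta>" "w \<in> \<W>" for \<theta> w
        using u_bound[OF that] mult_nonneg_nonneg[OF C2 U0[of w]] by (simp add: distrib_right)
      show "\<bar>u \<theta> w - u \<theta>' w\<bar> \<le> (C\<^sub>1 + C\<^sub>2) * U 1 w * norm (\<theta> - \<theta>')"
        if "\<theta> \<in> \<Theta>" "\<theta>' \<in> \<Theta>" "w \<in> \<W>" for \<theta> \<theta>' w
        using u_lip[OF that] mult_nonneg_nonneg[OF mult_nonneg_nonneg[OF C1 U0[of w]] norm_ge_zero[of "\<theta> - \<theta>'"]]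
        by (simp add: distrib_right)
    qed (use u_meas u_eq S_def in auto)
  qed
qed

section \<open>A scalar recursion\<close>

text \<open>Bernoulli's inequality for the exponent \<open>- p\<close>, from \<open>ln (1 + t) \<le> t\<close>.\<close>
lemma powr_succ_ge:
  fixes p :: real
  assumes "1 \<le> k" "0 \<le> p"
  shows "real k powr - p * (1 - p / real k) \<le> real (Suc k) powr - p"
proof -
  have k: "0 < real k" using assms by simp
  have "1 - p / real k \<le> 1 - p * ln (1 + 1 / real k)"
    using mult_left_mono[OF ln_add_one_self_le_self[of "1 / real k"], of p] assms by simp
  also have "\<dots> \<le> exp (- p * ln (1 + 1 / real k))"
    using exp_ge_add_one_self[of "- p * ln (1 + 1 / real k)"] by simp
  also have "\<dots> = (1 + 1 / real k) powr - p"
    using add_pos_pos[OF zero_less_one, of "1 / real k"] k by (simp add: powr_def)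
  finally have "real k powr - p * (1 - p / real k) \<le> real k powr - p * (1 + 1 / real k) powr - p"
    by (intro mult_left_mono) auto
  also have "\<dots> = (real k * (1 + 1 / real k)) powr - p" using k by (simp add: powr_mult)
  also have "real k * (1 + 1 / real k) = real (Suc k)" using k by (simp add: field_simps)
  finally show ?thesis .
qed

text \<open>The sequence \<open>C * y * k powr - p\<close> is a supersolution: it decreases by the factor \<open>1 - p / k\<close> per step,
while the recursion contracts by \<open>1 - a * k powr - \<delta>\<close>. For \<open>\<delta> < 1\<close> the contraction wins eventually
whatever \<open>p\<close> is; for \<open>\<delta> = 1\<close> it wins precisely when \<open>p < a\<close>. In both cases a margin
\<open>\<kappa> * k powr - \<delta>\<close> remains to absorb the inhomogeneous term. The constants do not depend on the
sequence or on \<open>y\<close>.\<close>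
lemma recursion_rate:
  fixes a p \<delta> :: real
  assumes "0 < a" "0 < p" "0 < \<delta>" "\<delta> \<le> 1" and crit: "\<delta> = 1 \<Longrightarrow> p < a"
  obtains C K where "0 < C" "1 \<le> K"
    and "\<And>x y k. 0 \<le> y \<Longrightarrow> (\<And>k. 1 \<le> k \<Longrightarrow> x k \<le> y) \<Longrightarrow>
      (\<And>k. 1 \<le> k \<Longrightarrow> x (Suc k) \<le> (1 - a * real k powr - \<delta>) * x k + y * real k powr (- \<delta> - p)) \<Longrightarrow>
      K \<le> k \<Longrightarrow> x k \<le> C * y * real k powr - p"
proof -
  define \<kappa> where "\<kappa> = (if \<delta> = 1 then a - p else a / 2)"
  have \<kappa>: "0 < \<kappa>" using assms by (simp add: \<kappa>_def)
  have "\<forall>\<^sub>F k in sequentially. real k powr - \<delta> < 1 / a"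
  proof (rule order_tendstoD(2))
    show "(\<lambda>k. real k powr - \<delta>) \<longlonglongrightarrow> 0"
      using \<open>0 < \<delta>\<close> by (intro tendsto_neg_powr filterlim_real_sequentially) auto
  qed (use assms in auto)
  moreover have "\<forall>\<^sub>F k in sequentially. p * real k powr (\<delta> - 1) \<le> a - \<kappa>"
  proof (cases "\<delta> = 1")
    case True
    then show ?thesis using \<open>0 < p\<close> by (simp add: \<kappa>_def)
  next
    case False
    have "\<forall>\<^sub>F k in sequentially. real k powr (- (1 - \<delta>)) < (a / 2) / p"
    proof (rule order_tendstoD(2))
      show "(\<lambda>k. real k powr (- (1 - \<delta>))) \<longlonglongrightarrow> 0"
        using False \<open>\<delta> \<le> 1\<close> by (intro tendsto_neg_powr filterlim_real_sequentially) auto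
    qed (use assms in auto)
    then show ?thesis
      using False assms by (elim eventually_mono) (simp add: \<kappa>_def pos_less_divide_eq mult.commute)
  qed
  ultimately have "\<forall>\<^sub>F k in sequentially. real k powr - \<delta> < 1 / a \<and> p * real k powr (\<delta> - 1) \<le> a - \<kappa>"
    by (rule eventually_conj)
  then obtain K0 where K0: "\<And>k. K0 \<le> k \<Longrightarrow> real k powr - \<delta> < 1 / a \<and> p * real k powr (\<delta> - 1) \<le> a - \<kappa>"
    by (auto simp: eventually_sequentially)
  define K where "K = max 1 K0"
  define C where "C = max (real K powr p) (1 / \<kappa>)"
  have C: "0 < C" "1 \<le> C * \<kappa>" "real K powr p \<le> C"
  proof -
    show "0 < C" using \<kappa> by (simp add: C_def less_max_iff_disj)
    have "1 / \<kappa> \<le> C" by (simp add: C_def)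
    then show "1 \<le> C * \<kappa>" using \<kappa> by (simp add: pos_divide_le_eq)
    show "real K powr p \<le> C" by (simp add: C_def)
  qed
  show ?thesis
  proof (rule that[of C K])
    show "1 \<le> K" by (simp add: K_def)
    fix x :: "nat \<Rightarrow> real" and y k
    assume y: "0 \<le> y" and bound: "\<And>k. 1 \<le> k \<Longrightarrow> x k \<le> y"
      and rec_step: "\<And>k. 1 \<le> k \<Longrightarrow> x (Suc k) \<le> (1 - a * real k powr - \<delta>) * x k + y * real k powr (- \<delta> - p)"
    assume "K \<le> k"
    then show "x k \<le> C * y * real k powr - p"
    proof (induction k rule: dec_induct)
      case base
      have K1: "1 \<le> K" by (simp add: K_def)
      have "x K \<le> y * (real K powr p * real K powr - p)" using bound[OF K1] K1 by (simp add: powr_add[symmetric])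
      also have "\<dots> \<le> y * (C * real K powr - p)" using C y by (intro mult_left_mono mult_right_mono) auto
      finally show ?case by (simp add: ac_simps)
    next
      case (step k)
      have k1: "1 \<le> k" and kK: "K0 \<le> k" using step.hyps by (auto simp: K_def)
      then have k0: "0 < real k" by simp
      let ?q = "real k powr - p" and ?d = "real k powr - \<delta>"
      have "a * ?d \<le> 1" using K0[OF kK] \<open>0 < a\<close> by (simp add: pos_less_divide_eq mult.commute)
      then have "(1 - a * ?d) * x k \<le> (1 - a * ?d) * (C * y * ?q)" using step.IH by (intro mult_left_mono) auto
      moreover have "real k powr (- \<delta> - p) = ?d * ?q" by (simp add: powr_add[symmetric])
      ultimately have "x (Suc k) \<le> (1 - a * ?d) * (C * y * ?q) + y * (?d * ?q)"
        using rec_step[OF k1] by simp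
      also have "\<dots> = C * y * ?q - y * ?q * (C * (a * ?d) - ?d)" by (simp add: algebra_simps)
      also have "\<dots> \<le> C * y * ?q - y * ?q * (C * (p / real k))"
      proof -
        have "?d * real k powr (\<delta> - 1) = real k powr - 1" by (simp add: powr_add[symmetric])
        then have pk: "p / real k = ?d * (p * real k powr (\<delta> - 1))"
          using k0 by (simp add: powr_minus_divide mult.left_commute)
        have "C * (p / real k) \<le> C * (?d * (a - \<kappa>))"
          unfolding pk using K0[OF kK] C by (intro mult_left_mono) auto
        moreover have "?d * 1 \<le> ?d * (C * \<kappa>)" using C by (intro mult_left_mono) auto
        ultimately have "C * (p / real k) \<le> C * (a * ?d) - ?d" by (simp add: algebra_simps)
        then show ?thesis using y by (intro diff_left_mono mult_left_mono) auto
      qed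
      also have "\<dots> = C * y * (?q * (1 - p / real k))" by (simp add: algebra_simps)
      also have "\<dots> \<le> C * y * real (Suc k) powr - p"
        using C y \<open>0 < p\<close> powr_succ_ge[OF k1, of p] by (intro mult_left_mono) auto
      finally show ?case .
    qed
  qed (rule C)
qed

section \<open>Conditional laws along the recursion\<close>

text \<open>Approximate \<open>\<theta>\<close> by simple functions. Their values need not belong to \<open>\<Theta>\<close>, but projecting them to \<open>\<Theta>\<close>
keeps the convergence because the projection does not increase distances.\<close>

lemma borel_measurable_caratheodory:
  fixes u :: "'d::euclidean_space \<Rightarrow> 'w \<Rightarrow> real"
  assumes \<Theta>: "closed \<Theta>" "convex \<Theta>" "\<Theta> \<noteq> {}"
    and meas: "\<And>\<theta>. \<theta> \<in> \<Theta> \<Longrightarrow> u \<theta> \<in> borel_measurable S"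
    and lip: "\<And>\<theta> \<theta>' w. \<theta> \<in> \<Theta> \<Longrightarrow> \<theta>' \<in> \<Theta> \<Longrightarrow> w \<in> space S \<Longrightarrow>
      \<bar>u \<theta> w - u \<theta>' w\<bar> \<le> g w * norm (\<theta> - \<theta>')"
  shows "(\<lambda>(\<theta>, w). u \<theta> w) \<in> borel_measurable (restrict_space borel \<Theta> \<Otimes>\<^sub>M S)"
proof -
  let ?B = "restrict_space borel \<Theta>"
  have "(\<lambda>\<theta>. \<theta>) \<in> borel_measurable ?B" by (rule measurable_restrict_space1) simp
  from borel_measurable_implies_sequence_metric[OF this, of 0] obtain f where
    f: "\<And>i. simple_function ?B (f i)" "\<And>\<theta>. \<theta> \<in> space ?B \<Longrightarrow> (\<lambda>i. f i \<theta>) \<longlonglongrightarrow> \<theta>"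
    by blast
  have cp: "closest_point \<Theta> t \<in> \<Theta>" for t by (rule closest_point_in_set[OF \<Theta>(1,3)])
  show ?thesis
  proof (rule borel_measurable_LIMSEQ_metric)
    fix i
    have fm: "f i \<in> ?B \<rightarrow>\<^sub>M count_space (f i ` space ?B)"
      using f(1)[of i] by (intro measurable_count_space_eq2[THEN iffD2]) (auto simp: simple_function_def)
    have "(\<lambda>z. u (closest_point \<Theta> (f i (fst z))) (snd z)) \<in> borel_measurable (?B \<Otimes>\<^sub>M S)"
    proof (rule measurable_compose_countable'[where f="\<lambda>t z. u (closest_point \<Theta> t) (snd z)" and g="\<lambda>z. f i (fst z)"])
      show "(\<lambda>z. u (closest_point \<Theta> t) (snd z)) \<in> borel_measurable (?B \<Otimes>\<^sub>M S)" for t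
        by (rule measurable_compose[OF measurable_snd meas[OF cp]])
      show "(\<lambda>z. f i (fst z)) \<in> ?B \<Otimes>\<^sub>M S \<rightarrow>\<^sub>M count_space (f i ` space ?B)"
        by (rule measurable_compose[OF measurable_fst fm])
      show "countable (f i ` space ?B)"
        using f(1)[of i] by (auto simp: simple_function_def intro: countable_finite)
    qed
    then show "(\<lambda>(\<theta>, w). u (closest_point \<Theta> (f i \<theta>)) w) \<in> borel_measurable (?B \<Otimes>\<^sub>M S)"
      by (simp add: case_prod_beta')
  next
    fix z assume "z \<in> space (?B \<Otimes>\<^sub>M S)"
    then obtain \<theta> w where z: "z = (\<theta>, w)" and \<theta>: "\<theta> \<in> \<Theta>" and w: "w \<in> space S"
      by (auto simp: space_pair_measure space_restrict_space)
    have lim: "(\<lambda>i. f i \<theta>) \<longlonglongrightarrow> \<theta>" using f(2) \<theta> by (simp add: space_restrict_space)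
    have "(\<lambda>i. u (closest_point \<Theta> (f i \<theta>)) w - u \<theta> w) \<longlonglongrightarrow> 0"
    proof (rule Lim_null_comparison)
      show "(\<lambda>i. \<bar>g w\<bar> * norm (f i \<theta> - \<theta>)) \<longlonglongrightarrow> 0"
        using tendsto_norm[OF LIM_zero[OF lim]] by (intro tendsto_mult_right_zero) simp
      show "\<forall>\<^sub>F i in sequentially. norm (u (closest_point \<Theta> (f i \<theta>)) w - u \<theta> w) \<le> \<bar>g w\<bar> * norm (f i \<theta> - \<theta>)"
      proof (intro always_eventually allI)
        fix i
        have "norm (closest_point \<Theta> (f i \<theta>) - \<theta>) \<le> norm (f i \<theta> - \<theta>)"
          using closest_point_lipschitz[OF \<Theta>(2,1,3), of "f i \<theta>" \<theta>] closest_point_self[OF \<theta>]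
          by (simp add: dist_norm)
        then have "g w * norm (closest_point \<Theta> (f i \<theta>) - \<theta>) \<le> \<bar>g w\<bar> * norm (f i \<theta> - \<theta>)"
          by (intro mult_mono) auto
        with lip[OF cp \<theta> w, of "f i \<theta>"]
        show "norm (u (closest_point \<Theta> (f i \<theta>)) w - u \<theta> w) \<le> \<bar>g w\<bar> * norm (f i \<theta> - \<theta>)" by simp
      qed
    qed
    then show "(\<lambda>i. (\<lambda>(\<theta>, w). u (closest_point \<Theta> (f i \<theta>)) w) z) \<longlonglongrightarrow> (\<lambda>(\<theta>, w). u \<theta> w) z"
      unfolding z by (simp add: LIM_zero_cancel)
  qed
qed

lemma space_join_sigma [simp]: "space (join_sigma G f X) = space G"
  by (simp add: join_sigma_def space_measure_of_conv)

lemma sets_join_sigma: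
  "sets (join_sigma G f X) = sigma_sets (space G) (sets G \<union> sets (vimage_algebra (space G) f X))"
  unfolding join_sigma_def
  using sets.space_closed[of G] sets.space_closed[of "vimage_algebra (space G) f X"]
  by (intro sets_measure_of) auto

lemma subalgebra_join_sigma_left: "subalgebra (join_sigma G f X) G"
  by (auto simp: subalgebra_def sets_join_sigma)

lemma subalgebra_join_sigma:
  assumes G: "subalgebra \<Omega> G" and f: "f \<in> \<Omega> \<rightarrow>\<^sub>M X"
  shows "subalgebra \<Omega> (join_sigma G f X)"
proof -
  have sp: "space G = space \<Omega>" using G by (simp add: subalgebra_def)
  have "sets (vimage_algebra (space G) f X) \<subseteq> sets \<Omega>"
    using measurable_sets[OF f] f unfolding sp
    by (subst sets_vimage_algebra2) (auto simp: measurable_def)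
  then show ?thesis
    using G sets.sigma_sets_subset[of "sets G \<union> sets (vimage_algebra (space G) f X)" \<Omega>]
    by (simp add: subalgebra_def sets_join_sigma sp)
qed

lemma subalgebra_trans: "subalgebra A B \<Longrightarrow> subalgebra B C \<Longrightarrow> subalgebra A C"
  by (auto simp: subalgebra_def)

locale sa_recursion =
  fixes \<Omega> :: "'a measure" and \<Theta> :: "'d::euclidean_space set" and \<W> :: "'w::euclidean_space set"
    and F P \<alpha> \<theta> W and \<xi> :: "nat \<Rightarrow> 'a \<Rightarrow> 'c" and X M B
  assumes rec: "extended_recursion \<Omega> \<Theta> \<W> F P \<alpha> \<theta> W \<xi> X M B"
    and model: "model \<Theta> \<W> F P"
begin

abbreviation "Gm \<equiv> Gminus \<Omega> \<theta> W \<xi> X"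
abbreviation "Gp \<equiv> Gplus \<Omega> \<theta> W \<xi> X"
abbreviation "S \<equiv> restrict_space borel \<W>"
abbreviation "\<kappa> k x \<equiv> P (\<theta> k x) (W k x)"

lemma prob_\<Omega>: "prob_space \<Omega>" using rec by (simp add: extended_recursion_def)

sublocale prob_space \<Omega> by (rule prob_\<Omega>)

lemma \<theta>_meas [measurable]: "\<theta> k \<in> \<Omega> \<rightarrow>\<^sub>M restrict_space borel \<Theta>"
  and W_meas [measurable]: "W k \<in> \<Omega> \<rightarrow>\<^sub>M S"
  and \<xi>_meas: "\<xi> (Suc k) \<in> \<Omega> \<rightarrow>\<^sub>M X (Suc k)"
  and M_meas [measurable]: "M (Suc k) \<in> borel_measurable \<Omega>"
  and B_meas [measurable]: "B k \<in> borel_measurable \<Omega>"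
  using rec by (auto simp: extended_recursion_def)

lemma space_S: "space S = \<W>" by (simp add: space_restrict_space)

lemma \<theta>_in: "x \<in> space \<Omega> \<Longrightarrow> \<theta> k x \<in> \<Theta>" and W_in: "x \<in> space \<Omega> \<Longrightarrow> W k x \<in> \<W>"
  using measurable_space[OF \<theta>_meas] measurable_space[OF W_meas] by (auto simp: space_restrict_space)

lemma \<theta>_borel [measurable]: "\<theta> k \<in> borel_measurable \<Omega>" and W_borel [measurable]: "W k \<in> borel_measurable \<Omega>"
  using \<theta>_meas W_meas by (simp_all add: measurable_restrict_space2_iff)

lemma subalgebra_Gp_Gm: "subalgebra (Gp k) (Gm k)"
  unfolding Gplus_def by (rule subalgebra_join_sigma_left)

lemma subalgebra_Gm_Suc: "subalgebra (Gm (Suc k)) (Gp k)"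
  by (simp add: Gplus_def subalgebra_join_sigma_left)

lemma subalgebra_Gm: "subalgebra \<Omega> (Gm k)"
proof (induction k)
  case 0
  have f: "(\<lambda>x. (\<theta> 0 x, W 0 x)) \<in> \<Omega> \<rightarrow>\<^sub>M borel \<Otimes>\<^sub>M borel" by measurable
  have "sets (vimage_algebra (space \<Omega>) (\<lambda>x. (\<theta> 0 x, W 0 x)) (borel \<Otimes>\<^sub>M borel)) \<subseteq> sets \<Omega>"
    using measurable_sets[OF f] f by (subst sets_vimage_algebra2) (auto simp: measurable_def)
  then show ?case by (simp add: subalgebra_def)
next
  case (Suc k)
  have "subalgebra \<Omega> (join_sigma (join_sigma (Gm k) (\<xi> (Suc k)) (X (Suc k))) (W (Suc k)) borel)"
    by (rule subalgebra_join_sigma[OF subalgebra_join_sigma[OF Suc.IH \<xi>_meas] W_borel])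
  then show ?case by simp
qed

lemma subalgebra_Gp: "subalgebra \<Omega> (Gp k)"
  unfolding Gplus_def by (rule subalgebra_join_sigma[OF subalgebra_Gm \<xi>_meas])

lemma space_Gm [simp]: "space (Gm k) = space \<Omega>" and space_Gp [simp]: "space (Gp k) = space \<Omega>"
  using subalgebra_Gm subalgebra_Gp by (auto simp: subalgebra_def)

lemma subalgebra_Gp_0: "subalgebra (Gp k) (Gp 0)"
proof (induction k)
  case 0 then show ?case by (simp add: subalgebra_def)
next
  case (Suc k)
  then show ?case using subalgebra_trans subalgebra_Gp_Gm subalgebra_Gm_Suc by blast
qed

lemma Gp_0_sets: "A \<in> sets (Gp 0) \<Longrightarrow> A \<in> sets (Gp k)"
  and Gp_0_sets_Gm: "A \<in> sets (Gp 0) \<Longrightarrow> A \<in> sets (Gm (Suc k))"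
  and Gp_sets_\<Omega>: "A \<in> sets (Gp k) \<Longrightarrow> A \<in> sets \<Omega>"
  using subalgebra_Gp_0[of k] subalgebra_Gm_Suc[of k] subalgebra_Gp[of k] by (auto simp: subalgebra_def)

lemma cond_exp_Gp: "finite_measure_subalgebra \<Omega> (Gp k)" and cond_exp_Gm: "finite_measure_subalgebra \<Omega> (Gm k)"
  by unfold_locales (rule subalgebra_Gp, rule subalgebra_Gm)

lemma \<theta>_Gm: "\<theta> k \<in> Gm k \<rightarrow>\<^sub>M restrict_space borel \<Theta>" and W_Gm: "W k \<in> Gm k \<rightarrow>\<^sub>M S"
  using rec \<theta>_in W_in by (auto simp: extended_recursion_def measurable_restrict_space2_iff)

lemma \<theta>_Gp [measurable]: "\<theta> k \<in> Gp k \<rightarrow>\<^sub>M restrict_space borel \<Theta>" and W_Gp [measurable]: "W k \<in> Gp k \<rightarrow>\<^sub>M S"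
  using measurable_from_subalg[OF subalgebra_Gp_Gm] \<theta>_Gm W_Gm by blast+

lemma \<kappa>_meas: "\<kappa> k \<in> Gp k \<rightarrow>\<^sub>M prob_algebra S"
proof -
  have P: "(\<lambda>(\<theta>, w). P \<theta> w) \<in> restrict_space borel \<Theta> \<Otimes>\<^sub>M S \<rightarrow>\<^sub>M prob_algebra S"
    using model by (simp add: model_def)
  show ?thesis using measurable_compose[OF measurable_Pair[OF \<theta>_Gp W_Gp] P] by simp
qed

lemma \<kappa>_prob: "x \<in> space \<Omega> \<Longrightarrow> prob_space (\<kappa> k x)" and \<kappa>_sets: "x \<in> space \<Omega> \<Longrightarrow> sets (\<kappa> k x) = sets S"
  using measurable_space[OF \<kappa>_meas[of k], of x] by (auto simp: space_prob_algebra)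

lemma \<kappa>_space: "x \<in> space \<Omega> \<Longrightarrow> space (\<kappa> k x) = \<W>"
  using sets_eq_imp_space_eq[OF \<kappa>_sets] space_S by simp

lemma emeasure_next_state:
  assumes A: "A \<in> sets (Gp k)" and E: "E \<in> sets S"
  shows "(\<integral>\<^sup>+x. indicator A x * indicator E (W (Suc k) x) \<partial>\<Omega>)
       = (\<integral>\<^sup>+x. indicator A x * emeasure (\<kappa> k x) E \<partial>\<Omega>)"
proof -
  interpret ce: finite_measure_subalgebra \<Omega> "Gp k" by (rule cond_exp_Gp)
  have [measurable]: "A \<in> sets \<Omega>" "E \<in> sets S" "indicator A \<in> borel_measurable (Gp k)" using A E Gp_sets_\<Omega> by auto
  have [measurable]: "(\<lambda>x. measure (\<kappa> k x) E) \<in> borel_measurable \<Omega>"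
    using measurable_compose[OF \<kappa>_meas measurable_measure_prob_algebra[OF E]]
    by (rule measurable_from_subalg[OF subalgebra_Gp])
  let ?g = "\<lambda>x. indicator E (W (Suc k) x) :: real"
  have int: "integrable \<Omega> (\<lambda>x. indicator A x * ?g x)"
    by (rule integrable_const_bound[where B=1]) (auto simp: indicator_def)
  have "(\<integral>x. indicator A x * ?g x \<partial>\<Omega>) = (\<integral>x. indicator A x * real_cond_exp \<Omega> (Gp k) ?g x \<partial>\<Omega>)"
    by (rule ce.real_cond_exp_intg(2)[OF int, symmetric]) (use A in measurable)
  also have "\<dots> = (\<integral>x. indicator A x * measure (\<kappa> k x) E \<partial>\<Omega>)"
  proof (rule integral_cong_AE)
    show "AE x in \<Omega>. indicator A x * real_cond_exp \<Omega> (Gp k) ?g x = indicator A x * measure (\<kappa> k x) E"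
    proof -
      have "AE x in \<Omega>. real_cond_exp \<Omega> (Gp k) ?g x = measure (\<kappa> k x) E"
        using rec E unfolding extended_recursion_def by blast
      then show ?thesis by eventually_elim simp
    qed
  qed measurable
  finally have eq: "(\<integral>x. indicator A x * ?g x \<partial>\<Omega>) = (\<integral>x. indicator A x * measure (\<kappa> k x) E \<partial>\<Omega>)" .
  have "(\<integral>\<^sup>+x. indicator A x * indicator E (W (Suc k) x) \<partial>\<Omega>) = (\<integral>\<^sup>+x. ennreal (indicator A x * ?g x) \<partial>\<Omega>)"
    by (intro nn_integral_cong) (auto simp: indicator_def)
  also have "\<dots> = ennreal (\<integral>x. indicator A x * ?g x \<partial>\<Omega>)"
    by (intro nn_integral_eq_integral int) auto
  also have "\<dots> = (\<integral>\<^sup>+x. ennreal (indicator A x * measure (\<kappa> k x) E) \<partial>\<Omega>)"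
    unfolding eq
  proof (rule nn_integral_eq_integral[symmetric])
    show "integrable \<Omega> (\<lambda>x. indicator A x * measure (\<kappa> k x) E)"
      using prob_space.prob_le_1[OF \<kappa>_prob]
      by (intro integrable_const_bound[where B=1] AE_I2) (auto simp: indicator_def)
  qed auto
  also have "\<dots> = (\<integral>\<^sup>+x. indicator A x * emeasure (\<kappa> k x) E \<partial>\<Omega>)"
  proof (rule nn_integral_cong)
    fix x assume "x \<in> space \<Omega>"
    then interpret k: prob_space "\<kappa> k x" by (rule \<kappa>_prob)
    show "ennreal (indicator A x * measure (\<kappa> k x) E) = indicator A x * emeasure (\<kappa> k x) E"
      by (simp add: k.emeasure_eq_measure indicator_def)
  qed
  finally show ?thesis .
qed

text \<open>The pair of the sample point, observed through \<open>Gp k\<close>, and the next state has the joint law given by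
the kernel \<open>\<kappa> k\<close>: the two laws agree on rectangles by the conditional distribution of the next state.
This permits integrands that depend on the past, such as the corrector at the current parameter.\<close>

lemma nn_integral_next_state:
  assumes H: "(\<lambda>(x, y). H x y) \<in> borel_measurable (Gp k \<Otimes>\<^sub>M S)"
  shows "(\<integral>\<^sup>+x. H x (W (Suc k) x) \<partial>\<Omega>) = (\<integral>\<^sup>+x. \<integral>\<^sup>+y. H x y \<partial>\<kappa> k x \<partial>\<Omega>)"
proof -
  let ?G = "Gp k" and ?\<mu> = "restr_to_subalg \<Omega> (Gp k)"
  let ?N = "?G \<Otimes>\<^sub>M S"
  have sets_\<mu>: "sets ?\<mu> = sets ?G" by (rule sets_restr_to_subalg[OF subalgebra_Gp])
  have space_\<mu>: "space ?\<mu> = space \<Omega>" by (rule space_restr_to_subalg)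
  let ?f = "\<lambda>x. (x, W (Suc k) x)"
  have f: "?f \<in> \<Omega> \<rightarrow>\<^sub>M ?N"
    by (rule measurable_Pair[OF measurable_from_subalg[OF subalgebra_Gp measurable_ident] W_meas, unfolded id_def])
  let ?L = "\<lambda>x. distr (\<kappa> k x) ?N (\<lambda>y. (x, y))"
  have \<kappa>: "\<kappa> k \<in> ?\<mu> \<rightarrow>\<^sub>M prob_algebra S" using \<kappa>_meas by (simp add: measurable_cong_sets[OF sets_\<mu> refl])
  have "(\<lambda>(x, y). (x, y)) \<in> ?\<mu> \<Otimes>\<^sub>M S \<rightarrow>\<^sub>M ?N"
    by (simp add: measurable_cong_sets[OF sets_pair_measure_cong[OF sets_\<mu> refl] refl])
  then have L: "?L \<in> ?\<mu> \<rightarrow>\<^sub>M prob_algebra ?N" by (rule measurable_distr_prob_space2[OF \<kappa>])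
  note L' = measurable_prob_algebraD[OF L]
  have pm: "(\<lambda>y. (x, y)) \<in> \<kappa> k x \<rightarrow>\<^sub>M ?N" if "x \<in> space \<Omega>" for x
    using that by (simp add: measurable_cong_sets[OF \<kappa>_sets[OF that] refl])
  let ?M1 = "distr \<Omega> ?N ?f" and ?M2 = "?\<mu> \<bind> ?L"
  have ne: "space ?\<mu> \<noteq> {}" using not_empty by (simp add: space_\<mu>)
  have "?M1 = ?M2"
  proof (rule measure_eqI_generator_eq[OF Int_stable_pair_measure_generator[of ?G S]])
    show "{a \<times> b |a b. a \<in> sets ?G \<and> b \<in> sets S} \<subseteq> Pow (space ?G \<times> space S)"
      using sets.space_closed[of ?G] sets.space_closed[of S] by fast
    show "sets ?M1 = sigma_sets (space ?G \<times> space S) {a \<times> b |a b. a \<in> sets ?G \<and> b \<in> sets S}"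
      by (simp add: sets_pair_measure)
    show "sets ?M2 = sigma_sets (space ?G \<times> space S) {a \<times> b |a b. a \<in> sets ?G \<and> b \<in> sets S}"
      by (subst sets_bind[OF _ ne, where N="?N"])
         (use measurable_space[OF L] in \<open>auto simp: sets_pair_measure space_prob_algebra\<close>)
    show "range (\<lambda>i::nat. space ?G \<times> space S) \<subseteq> {a \<times> b |a b. a \<in> sets ?G \<and> b \<in> sets S}" by blast
    show "(\<Union>i::nat. space ?G \<times> space S) = space ?G \<times> space S" by simp
    have "prob_space ?M1" by (rule prob_space_distr[OF f])
    then show "emeasure ?M1 (space ?G \<times> space S) \<noteq> \<infinity>"
      by (simp add: prob_space.finite_measure finite_measure.emeasure_finite)
    fix Z assume "Z \<in> {a \<times> b |a b. a \<in> sets ?G \<and> b \<in> sets S}"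
    then obtain A E where Z: "Z = A \<times> E" and A: "A \<in> sets ?G" and E: "E \<in> sets S" by blast
    have ZN: "Z \<in> sets ?N" using A E by (simp add: Z)
    have AO: "A \<in> sets \<Omega>" using A by (rule Gp_sets_\<Omega>)
    have [measurable]: "(\<lambda>x. indicator A x * emeasure (\<kappa> k x) E) \<in> borel_measurable ?G"
      using A measurable_compose[OF measurable_prob_algebraD[OF \<kappa>_meas] measurable_emeasure_subprob_algebra[OF E]]
      by measurable
    have "emeasure ?M1 Z = emeasure \<Omega> (?f -` Z \<inter> space \<Omega>)" by (rule emeasure_distr[OF f ZN])
    also have "\<dots> = (\<integral>\<^sup>+x. indicator (?f -` Z \<inter> space \<Omega>) x \<partial>\<Omega>)"
      using measurable_sets[OF f ZN] by simp
    also have "\<dots> = (\<integral>\<^sup>+x. indicator A x * indicator E (W (Suc k) x) \<partial>\<Omega>)"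
      by (intro nn_integral_cong) (auto simp: Z indicator_def)
    also have "\<dots> = (\<integral>\<^sup>+x. indicator A x * emeasure (\<kappa> k x) E \<partial>\<Omega>)"
      by (rule emeasure_next_state[OF A E])
    also have "\<dots> = (\<integral>\<^sup>+x. indicator A x * emeasure (\<kappa> k x) E \<partial>?\<mu>)"
      by (rule nn_integral_subalgebra2[OF subalgebra_Gp, symmetric]) measurable
    also have "\<dots> = (\<integral>\<^sup>+x. emeasure (?L x) Z \<partial>?\<mu>)"
    proof (rule nn_integral_cong)
      fix x assume "x \<in> space ?\<mu>"
      then have x: "x \<in> space \<Omega>" by (simp add: space_\<mu>)
      have "E \<subseteq> \<W>" using sets.sets_into_space[OF E] by (simp add: space_S)
      then have "(\<lambda>y. (x, y)) -` Z \<inter> space (\<kappa> k x) = (if x \<in> A then E else {})"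
        by (auto simp: Z \<kappa>_space[OF x])
      then show "indicator A x * emeasure (\<kappa> k x) E = emeasure (?L x) Z"
        by (simp add: emeasure_distr[OF pm[OF x] ZN])
    qed
    also have "\<dots> = emeasure ?M2 Z" by (rule emeasure_bind[OF ne L' ZN, symmetric])
    finally show "emeasure ?M1 Z = emeasure ?M2 Z" .
  qed
  then have "(\<integral>\<^sup>+z. (\<lambda>(x, y). H x y) z \<partial>?M1) = (\<integral>\<^sup>+z. (\<lambda>(x, y). H x y) z \<partial>?M2)" by simp
  moreover have "(\<integral>\<^sup>+z. (\<lambda>(x, y). H x y) z \<partial>?M1) = (\<integral>\<^sup>+x. H x (W (Suc k) x) \<partial>\<Omega>)"
    using H by (subst nn_integral_distr[OF f]) simp_all
  moreover have "(\<integral>\<^sup>+z. (\<lambda>(x, y). H x y) z \<partial>?M2) = (\<integral>\<^sup>+x. \<integral>\<^sup>+z. (\<lambda>(x, y). H x y) z \<partial>?L x \<partial>?\<mu>)"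
    by (rule nn_integral_bind[OF H L'])
  moreover have "\<dots> = (\<integral>\<^sup>+x. \<integral>\<^sup>+y. H x y \<partial>\<kappa> k x \<partial>?\<mu>)"
    by (intro nn_integral_cong) (simp add: space_\<mu> nn_integral_distr[OF pm] H)
  moreover have "\<dots> = (\<integral>\<^sup>+x. \<integral>\<^sup>+y. H x y \<partial>\<kappa> k x \<partial>\<Omega>)"
    by (intro nn_integral_subalgebra2[OF subalgebra_Gp]
        nn_integral_measurable_subprob_algebra2[OF H measurable_prob_algebraD[OF \<kappa>_meas]])
  ultimately show ?thesis by simp
qed

text \<open>For real integrands the inner integral must exist at every point; this is the case when the
  integrand is dominated by a function integrable for all transition laws.\<close>

lemma integral_next_state:
  assumes H: "(\<lambda>(x, y). H x y :: real) \<in> borel_measurable (Gp k \<Otimes>\<^sub>M S)"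
    and bound: "\<And>x y. x \<in> space \<Omega> \<Longrightarrow> y \<in> \<W> \<Longrightarrow> \<bar>H x y\<bar> \<le> g y"
    and g: "\<And>x. x \<in> space \<Omega> \<Longrightarrow> integrable (\<kappa> k x) g" "integrable \<Omega> (\<lambda>x. g (W (Suc k) x))"
  shows "integrable \<Omega> (\<lambda>x. H x (W (Suc k) x))"
    and "integrable \<Omega> (\<lambda>x. \<integral>y. H x y \<partial>\<kappa> k x)"
    and "(\<integral>x. H x (W (Suc k) x) \<partial>\<Omega>) = (\<integral>x. (\<integral>y. H x y \<partial>\<kappa> k x) \<partial>\<Omega>)"
proof -
  have main: "integrable \<Omega> (\<lambda>x. J x (W (Suc k) x)) \<and> integrable \<Omega> (\<lambda>x. \<integral>y. J x y \<partial>\<kappa> k x) \<and>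
      (\<integral>x. J x (W (Suc k) x) \<partial>\<Omega>) = (\<integral>x. (\<integral>y. J x y \<partial>\<kappa> k x) \<partial>\<Omega>) \<and>
      (\<forall>x\<in>space \<Omega>. integrable (\<kappa> k x) (J x))"
    if J: "(\<lambda>(x, y). J x y :: real) \<in> borel_measurable (Gp k \<Otimes>\<^sub>M S)" and nn: "\<And>x y. 0 \<le> J x y"
      and le: "\<And>x y. x \<in> space \<Omega> \<Longrightarrow> y \<in> \<W> \<Longrightarrow> J x y \<le> g y" for J
  proof -
    have Je: "(\<lambda>(x, y). ennreal (J x y)) \<in> borel_measurable (Gp k \<Otimes>\<^sub>M S)"
      using measurable_compose[OF J measurable_ennreal] by (simp add: case_prod_beta')
    have J1: "(\<lambda>x. J x (W (Suc k) x)) \<in> borel_measurable \<Omega>"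
      using measurable_compose[OF measurable_Pair[OF measurable_from_subalg[OF subalgebra_Gp measurable_ident] W_meas] J]
      by simp
    have Jx: "J x \<in> borel_measurable (\<kappa> k x)" if x: "x \<in> space \<Omega>" for x
    proof -
      have "x \<in> space (Gp k)" using x by simp
      from measurable_compose[OF measurable_Pair1'[OF this] J] show ?thesis
        by (simp add: measurable_cong_sets[OF \<kappa>_sets[OF x] refl])
    qed
    have Ji: "integrable (\<kappa> k x) (J x)" if x: "x \<in> space \<Omega>" for x
      by (rule Bochner_Integration.integrable_bound[OF g(1)[OF x] Jx[OF x]], rule AE_I2)
         (use le nn x in \<open>auto simp: \<kappa>_space[OF x] intro: order_trans[OF _ abs_ge_self]\<close>)
    have i1: "integrable \<Omega> (\<lambda>x. J x (W (Suc k) x))"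
      by (rule Bochner_Integration.integrable_bound[OF g(2) J1], rule AE_I2)
         (use le nn W_in in \<open>auto intro: order_trans[OF _ abs_ge_self]\<close>)
    have inner: "(\<integral>\<^sup>+y. ennreal (J x y) \<partial>\<kappa> k x) = ennreal (\<integral>y. J x y \<partial>\<kappa> k x)" if "x \<in> space \<Omega>" for x
      by (rule nn_integral_eq_integral[OF Ji[OF that]]) (simp add: nn)
    have I0: "0 \<le> (\<integral>y. J x y \<partial>\<kappa> k x)" for x by (rule Bochner_Integration.integral_nonneg) (simp add: nn)
    have eq: "ennreal (\<integral>x. J x (W (Suc k) x) \<partial>\<Omega>) = (\<integral>\<^sup>+x. ennreal (\<integral>y. J x y \<partial>\<kappa> k x) \<partial>\<Omega>)"
    proof -
      have "ennreal (\<integral>x. J x (W (Suc k) x) \<partial>\<Omega>) = (\<integral>\<^sup>+x. ennreal (J x (W (Suc k) x)) \<partial>\<Omega>)"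
        by (rule nn_integral_eq_integral[OF i1, symmetric]) (simp add: nn)
      also have "\<dots> = (\<integral>\<^sup>+x. \<integral>\<^sup>+y. ennreal (J x y) \<partial>\<kappa> k x \<partial>\<Omega>)" by (rule nn_integral_next_state[OF Je])
      also have "\<dots> = (\<integral>\<^sup>+x. ennreal (\<integral>y. J x y \<partial>\<kappa> k x) \<partial>\<Omega>)" by (rule nn_integral_cong[OF inner])
      finally show ?thesis .
    qed
    have m: "(\<lambda>x. \<integral>y. J x y \<partial>\<kappa> k x) \<in> borel_measurable \<Omega>"
    proof -
      have "(\<lambda>x. enn2real (\<integral>\<^sup>+y. ennreal (J x y) \<partial>\<kappa> k x)) \<in> borel_measurable \<Omega>"
        using measurable_from_subalg[OF subalgebra_Gp
            nn_integral_measurable_subprob_algebra2[OF Je measurable_prob_algebraD[OF \<kappa>_meas]]]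
        by measurable
      then show ?thesis by (rule measurable_cong[THEN iffD1, rotated]) (simp add: inner I0)
    qed
    have i2: "integrable \<Omega> (\<lambda>x. \<integral>y. J x y \<partial>\<kappa> k x)"
      by (rule integrableI_nonneg[OF m]) (use I0 eq[symmetric] in auto)
    have "ennreal (\<integral>x. J x (W (Suc k) x) \<partial>\<Omega>) = ennreal (\<integral>x. (\<integral>y. J x y \<partial>\<kappa> k x) \<partial>\<Omega>)"
      unfolding eq by (rule nn_integral_eq_integral[OF i2]) (simp add: I0)
    then have "(\<integral>x. J x (W (Suc k) x) \<partial>\<Omega>) = (\<integral>x. (\<integral>y. J x y \<partial>\<kappa> k x) \<partial>\<Omega>)"
      by (subst (asm) ennreal_inj) (auto intro!: Bochner_Integration.integral_nonneg nn I0)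
    with i1 i2 Ji show ?thesis by blast
  qed
  have pos: "(\<lambda>(x, y). max 0 (H x y)) \<in> borel_measurable (Gp k \<Otimes>\<^sub>M S)"
    and neg: "(\<lambda>(x, y). max 0 (- H x y)) \<in> borel_measurable (Gp k \<Otimes>\<^sub>M S)"
    using H by (simp_all add: case_prod_beta' borel_measurable_max)
  have b: "max 0 (H x y) \<le> g y" "max 0 (- H x y) \<le> g y" if "x \<in> space \<Omega>" "y \<in> \<W>" for x y
    using bound[OF that] by (auto simp: abs_le_iff)
  note p = main[OF pos _ b(1)] and n = main[OF neg _ b(2)]
  have dec: "H x y = max 0 (H x y) - max 0 (- H x y)" for x y by (simp add: max_def)
  have inner: "(\<integral>y. H x y \<partial>\<kappa> k x) = (\<integral>y. max 0 (H x y) \<partial>\<kappa> k x) - (\<integral>y. max 0 (- H x y) \<partial>\<kappa> k x)"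
    if "x \<in> space \<Omega>" for x
    using p n that by (subst dec) (simp add: Bochner_Integration.integral_diff)
  show "integrable \<Omega> (\<lambda>x. H x (W (Suc k) x))" using p n by (subst dec) (simp add: Bochner_Integration.integrable_diff)
  have "integrable \<Omega> (\<lambda>x. (\<integral>y. max 0 (H x y) \<partial>\<kappa> k x) - (\<integral>y. max 0 (- H x y) \<partial>\<kappa> k x))"
    using p n by (intro Bochner_Integration.integrable_diff) auto
  then show "integrable \<Omega> (\<lambda>x. \<integral>y. H x y \<partial>\<kappa> k x)"
    by (rule Bochner_Integration.integrable_cong[THEN iffD1, rotated -1]) (simp_all add: inner)
  have "(\<integral>x. H x (W (Suc k) x) \<partial>\<Omega>)
      = (\<integral>x. max 0 (H x (W (Suc k) x)) \<partial>\<Omega>) - (\<integral>x. max 0 (- H x (W (Suc k) x)) \<partial>\<Omega>)"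
    using p n by (subst dec) (simp add: Bochner_Integration.integral_diff)
  also have "\<dots> = (\<integral>x. (\<integral>y. max 0 (H x y) \<partial>\<kappa> k x) \<partial>\<Omega>) - (\<integral>x. (\<integral>y. max 0 (- H x y) \<partial>\<kappa> k x) \<partial>\<Omega>)"
    using p n by simp
  also have "\<dots> = (\<integral>x. (\<integral>y. max 0 (H x y) \<partial>\<kappa> k x) - (\<integral>y. max 0 (- H x y) \<partial>\<kappa> k x) \<partial>\<Omega>)"
    using p n by (intro Bochner_Integration.integral_diff[symmetric]) auto
  also have "\<dots> = (\<integral>x. (\<integral>y. H x y \<partial>\<kappa> k x) \<partial>\<Omega>)"
    by (intro Bochner_Integration.integral_cong) (auto simp: inner)
  finally show "(\<integral>x. H x (W (Suc k) x) \<partial>\<Omega>) = (\<integral>x. (\<integral>y. H x y \<partial>\<kappa> k x) \<partial>\<Omega>)" .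
qed

end

section \<open>Moments, noise and the one-step inequality\<close>

lemma U1_le_U2: "U 1 w \<le> 2 * U 2 w" and U1_sq_le_U2: "(U 1 w)\<^sup>2 \<le> 2 * U 2 w"
proof -
  have sq: "(1 + norm w)\<^sup>2 + (1 - norm w)\<^sup>2 = 2 * U 2 w" by (simp add: U_def power2_eq_square algebra_simps)
  have "U 1 w = 1 + norm w" by (simp add: U_def)
  then show 1: "(U 1 w)\<^sup>2 \<le> 2 * U 2 w" unfolding sq[symmetric] by simp
  have "U 1 w * 1 \<le> U 1 w * U 1 w" using U_ge_1[of 1 w] by (intro mult_left_mono) auto
  then show "U 1 w \<le> 2 * U 2 w" using 1 by (simp add: power2_eq_square)
qed

locale sa_assumptions = sa_recursion \<Omega> \<Theta> \<W> F P \<alpha> \<theta> W \<xi> X M B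
  for \<Omega> :: "'a measure" and \<Theta> :: "'d::euclidean_space set" and \<W> :: "'w::euclidean_space set"
    and F P \<alpha> \<theta> W and \<xi> :: "nat \<Rightarrow> 'a \<Rightarrow> 'c" and X M B +
  fixes lam c C\<^sub>F :: real and \<W>\<^sub>0 :: "'w set" and m b :: "nat \<Rightarrow> real" and \<theta>s :: 'd and D :: real
  assumes lam: "0 \<le> lam" "lam < 1" and c: "0 \<le> c"
    and drift: "\<And>t w. t \<in> \<Theta> \<Longrightarrow> w \<in> \<W> \<Longrightarrow>
      (\<integral>\<^sup>+y. ennreal (U 2 y) \<partial>P t w) \<le> ennreal (lam * U 2 w + c * indicator \<W>\<^sub>0 w)"
    and init: "(\<integral>\<^sup>+x. ennreal (U 2 (W 0 x)) \<partial>\<Omega>) < \<infinity>"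
    and err: "error_process \<Omega> (Gminus \<Omega> \<theta> W \<xi> X) (Gplus \<Omega> \<theta> W \<xi> X) W M B m b"
    and \<Theta>: "compact \<Theta>" "convex \<Theta>" and \<theta>s: "\<theta>s \<in> \<Theta>"
    and D: "\<And>t. t \<in> \<Theta> \<Longrightarrow> norm (t - \<theta>s) \<le> D"
    and C\<^sub>F: "\<And>t w. t \<in> \<Theta> \<Longrightarrow> w \<in> \<W> \<Longrightarrow> norm (F t w) \<le> C\<^sub>F * U 1 w"
    and \<alpha>: "\<And>k. 0 < \<alpha> k"
begin

lemma drift': "t \<in> \<Theta> \<Longrightarrow> w \<in> \<W> \<Longrightarrow> (\<integral>\<^sup>+y. ennreal (U 2 y) \<partial>P t w) \<le> ennreal (lam * U 2 w + c)"
  by (rule order_trans[OF drift]) (use c in \<open>auto intro!: ennreal_leI simp: indicator_def\<close>)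

lemma U_\<kappa>_meas: "x \<in> space \<Omega> \<Longrightarrow> U 2 \<in> borel_measurable (\<kappa> k x)"
  by (simp add: measurable_cong_sets[OF \<kappa>_sets refl] measurable_restrict_space1)

lemma U2_W_meas [measurable]: "(\<lambda>x. U n (W k x)) \<in> borel_measurable \<Omega>"
  by measurable

lemma \<kappa>_integrable: "x \<in> space \<Omega> \<Longrightarrow> integrable (\<kappa> k x) (U 2)"
proof (rule integrableI_nonneg[OF U_\<kappa>_meas])
  assume x: "x \<in> space \<Omega>"
  show "AE y in \<kappa> k x. 0 \<le> U 2 y" by (simp add: U_def)
  show "(\<integral>\<^sup>+y. ennreal (U 2 y) \<partial>\<kappa> k x) < \<infinity>"
    using drift'[OF \<theta>_in[OF x] W_in[OF x], of k k] by (simp add: order_le_less_trans)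
qed

lemma \<kappa>_integral_le:
  assumes x: "x \<in> space \<Omega>" shows "(\<integral>y. U 2 y \<partial>\<kappa> k x) \<le> lam * U 2 (W k x) + c"
proof -
  have "ennreal (\<integral>y. U 2 y \<partial>\<kappa> k x) = (\<integral>\<^sup>+y. ennreal (U 2 y) \<partial>\<kappa> k x)"
    by (rule nn_integral_eq_integral[OF \<kappa>_integrable[OF x], symmetric]) (simp add: U_def)
  also note drift'[OF \<theta>_in[OF x] W_in[OF x], of k k]
  finally have "ennreal (\<integral>y. U 2 y \<partial>\<kappa> k x) \<le> ennreal (lam * U 2 (W k x) + c)" .
  moreover have "0 \<le> lam * U 2 (W k x) + c" using lam c U_ge_1[of 2 "W k x"] by simp
  ultimately show ?thesis by (simp only: ennreal_le_iff)
qed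

lemma integrable_U2: "integrable \<Omega> (\<lambda>x. U 2 (W k x))"
proof (induction k)
  case 0
  show ?case using init by (intro integrableI_nonneg) (auto simp: U_def)
next
  case (Suc k)
  have H: "(\<lambda>(x, y). ennreal (U 2 y)) \<in> borel_measurable (Gp k \<Otimes>\<^sub>M S)"
  proof -
    have [measurable]: "U 2 \<in> borel_measurable S" by (simp add: measurable_restrict_space1)
    show ?thesis by measurable
  qed
  have "(\<integral>\<^sup>+x. ennreal (U 2 (W (Suc k) x)) \<partial>\<Omega>) = (\<integral>\<^sup>+x. \<integral>\<^sup>+y. ennreal (U 2 y) \<partial>\<kappa> k x \<partial>\<Omega>)"
    by (rule nn_integral_next_state[OF H])
  also have "\<dots> \<le> (\<integral>\<^sup>+x. ennreal (lam * U 2 (W k x) + c) \<partial>\<Omega>)"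
    using drift' \<theta>_in W_in by (intro nn_integral_mono) auto
  also have "\<dots> = ennreal (\<integral>x. lam * U 2 (W k x) + c \<partial>\<Omega>)"
    using Suc lam c by (intro nn_integral_eq_integral) (auto simp: U_def)
  also have "\<dots> < \<infinity>" by simp
  finally show ?case by (intro integrableI_nonneg) (auto simp: U_def)
qed

lemma integrable_ind: "A \<in> sets \<Omega> \<Longrightarrow> integrable \<Omega> f \<Longrightarrow> integrable \<Omega> (\<lambda>x. indicator A x * f x :: real)"
  using integrable_mult_indicator[of A \<Omega> f] by simp

text \<open>Conditioning on \<open>Gp 0\<close> is replaced by integrating over an arbitrary event \<open>A\<close> of \<open>Gp 0\<close>, and all bounds
are multiples of \<open>mom A 0\<close>.\<close>

definition mom :: "'a set \<Rightarrow> nat \<Rightarrow> real" where "mom A k = (\<integral>x. indicator A x * U 2 (W k x) \<partial>\<Omega>)"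

lemma mom_step:
  assumes A: "A \<in> sets (Gp k)" shows "mom A (Suc k) \<le> lam * mom A k + c * prob A"
proof -
  have AO: "A \<in> sets \<Omega>" using A by (rule Gp_sets_\<Omega>)
  have [measurable]: "U 2 \<in> borel_measurable S" by (simp add: measurable_restrict_space1)
  have H: "(\<lambda>(x, y). indicator A x * U 2 y) \<in> borel_measurable (Gp k \<Otimes>\<^sub>M S)"
    using A by measurable
  have b: "\<bar>indicator A x * U 2 y\<bar> \<le> U 2 y" for x and y :: 'w by (simp add: indicator_def U_def)
  note n = integral_next_state[OF H b \<kappa>_integrable integrable_U2]
  have "mom A (Suc k) = (\<integral>x. (\<integral>y. indicator A x * U 2 y \<partial>\<kappa> k x) \<partial>\<Omega>)"
    unfolding mom_def by (rule n(3))
  also have "\<dots> \<le> (\<integral>x. lam * (indicator A x * U 2 (W k x)) + c * indicator A x \<partial>\<Omega>)"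
  proof (rule integral_mono[OF n(2)])
    show "integrable \<Omega> (\<lambda>x. lam * (indicator A x * U 2 (W k x)) + c * indicator A x)"
      using AO integrable_ind[OF AO integrable_U2] by (simp add: integrable_real_indicator emeasure_eq_measure)
    show "(\<integral>y. indicator A x * U 2 y \<partial>\<kappa> k x) \<le> lam * (indicator A x * U 2 (W k x)) + c * indicator A x"
      if "x \<in> space \<Omega>" for x using \<kappa>_integral_le[OF that] by (auto simp: indicator_def)
  qed
  also have "\<dots> = lam * mom A k + c * prob A"
    using AO integrable_ind[OF AO integrable_U2, of k] sets.Int_space_eq2[OF AO]
    by (simp add: mom_def integrable_real_indicator emeasure_eq_measure)
  finally show ?thesis .
qed

definition \<beta> :: real where "\<beta> = 1 + c / (1 - lam)"

lemma \<beta>: "1 \<le> \<beta>" using lam c by (simp add: \<beta>_def)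

lemma prob_le_mom: "A \<in> sets \<Omega> \<Longrightarrow> prob A \<le> mom A k"
proof -
  assume A: "A \<in> sets \<Omega>"
  have "(\<integral>x. indicator A x \<partial>\<Omega>) \<le> mom A k"
    unfolding mom_def
  proof (rule integral_mono)
    show "integrable \<Omega> (indicator A :: 'a \<Rightarrow> real)"
      using A by (simp add: integrable_real_indicator emeasure_eq_measure)
    show "indicator A x \<le> indicator A x * U 2 (W k x)" for x
      using U_ge_1[of 2 "W k x"] by (simp add: indicator_def)
  qed (rule integrable_ind[OF A integrable_U2])
  then show ?thesis using A sets.Int_space_eq2[OF A] by simp
qed

lemma mom_nonneg: "0 \<le> mom A k"
  unfolding mom_def by (intro Bochner_Integration.integral_nonneg) (simp add: U_def)

lemma mom_bound:
  assumes A: "A \<in> sets (Gp 0)" shows "mom A k \<le> \<beta> * mom A 0"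
proof (induction k)
  case 0 show ?case using \<beta> mom_nonneg[of A 0] mult_right_mono[of 1 \<beta> "mom A 0"] by simp
next
  case (Suc k)
  have "mom A (Suc k) \<le> lam * mom A k + c * prob A" by (rule mom_step[OF Gp_0_sets[OF A]])
  also have "\<dots> \<le> lam * (\<beta> * mom A 0) + c * mom A 0"
    using Suc lam c prob_le_mom[OF Gp_sets_\<Omega>[OF A]] by (intro add_mono mult_left_mono) auto
  also have "\<dots> = (lam * \<beta> + c) * mom A 0" by (simp add: algebra_simps)
  also have "\<dots> \<le> \<beta> * mom A 0"
  proof (rule mult_right_mono[OF _ mom_nonneg])
    have "lam * c / (1 - lam) + c = c / (1 - lam)" using lam by (simp add: field_simps)
    then show "lam * \<beta> + c \<le> \<beta>" using lam by (simp add: \<beta>_def algebra_simps)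
  qed
  finally show ?case .
qed

subsection \<open>The noise\<close>

lemma noise_sq:
  assumes A: "A \<in> sets (Gm k)"
  shows "integrable \<Omega> (\<lambda>x. (norm (M (Suc k) x))\<^sup>2)"
    and "(\<integral>x. indicator A x * (norm (M (Suc k) x))\<^sup>2 \<partial>\<Omega>) \<le> (m k)\<^sup>2 * mom A k"
proof -
  interpret ce: finite_measure_subalgebra \<Omega> "Gm k" by (rule cond_exp_Gm)
  have le: "(\<integral>\<^sup>+x. indicator E x * ennreal ((norm (M (Suc k) x))\<^sup>2) \<partial>\<Omega>) \<le> ennreal ((m k)\<^sup>2 * mom E k)"
    if E: "E \<in> sets (Gm k)" for E
  proof -
    have EO: "E \<in> sets \<Omega>" using E subalgebra_Gm by (auto simp: subalgebra_def)
    have "(\<integral>\<^sup>+x. indicator E x * ennreal ((norm (M (Suc k) x))\<^sup>2) \<partial>\<Omega>)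
        = (\<integral>\<^sup>+x. indicator E x * nn_cond_exp \<Omega> (Gm k) (\<lambda>x. ennreal ((norm (M (Suc k) x))\<^sup>2)) x \<partial>\<Omega>)"
    proof (rule ce.nn_cond_exp_intg[symmetric])
      show "indicator E \<in> borel_measurable (Gm k)" using E by simp
      show "(\<lambda>x. ennreal ((norm (M (Suc k) x))\<^sup>2)) \<in> borel_measurable \<Omega>" by measurable
    qed
    also have "\<dots> \<le> (\<integral>\<^sup>+x. ennreal ((m k)\<^sup>2 * (indicator E x * U 2 (W k x))) \<partial>\<Omega>)"
    proof (rule nn_integral_mono_AE)
      have "AE x in \<Omega>. nn_cond_exp \<Omega> (Gm k) (\<lambda>x. ennreal ((norm (M (Suc k) x))\<^sup>2)) x \<le> ennreal ((m k)\<^sup>2 * U 2 (W k x))"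
        using err unfolding error_process_def by blast
      then show "AE x in \<Omega>. indicator E x * nn_cond_exp \<Omega> (Gm k) (\<lambda>x. ennreal ((norm (M (Suc k) x))\<^sup>2)) x
          \<le> ennreal ((m k)\<^sup>2 * (indicator E x * U 2 (W k x)))"
        by eventually_elim (auto simp: indicator_def)
    qed
    also have "\<dots> = ennreal (\<integral>x. (m k)\<^sup>2 * (indicator E x * U 2 (W k x)) \<partial>\<Omega>)"
      by (intro nn_integral_eq_integral integrable_mult_right integrable_ind EO integrable_U2) (simp add: U_def)
    finally show ?thesis by (simp add: mom_def)
  qed
  have top: "space \<Omega> \<in> sets (Gm k)" using sets.top[of "Gm k"] by simp
  have "(\<integral>\<^sup>+x. ennreal ((norm (M (Suc k) x))\<^sup>2) \<partial>\<Omega>)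
      = (\<integral>\<^sup>+x. indicator (space \<Omega>) x * ennreal ((norm (M (Suc k) x))\<^sup>2) \<partial>\<Omega>)"
    by (intro nn_integral_cong) simp
  also have "\<dots> < \<infinity>" using le[OF top] by (simp add: order_le_less_trans)
  finally show int: "integrable \<Omega> (\<lambda>x. (norm (M (Suc k) x))\<^sup>2)" by (intro integrableI_nonneg) auto
  have AO: "A \<in> sets \<Omega>" using A subalgebra_Gm by (auto simp: subalgebra_def)
  have "ennreal (\<integral>x. indicator A x * (norm (M (Suc k) x))\<^sup>2 \<partial>\<Omega>)
      = (\<integral>\<^sup>+x. ennreal (indicator A x * (norm (M (Suc k) x))\<^sup>2) \<partial>\<Omega>)"
    by (intro nn_integral_eq_integral[symmetric] integrable_ind AO int) simp
  also have "\<dots> = (\<integral>\<^sup>+x. indicator A x * ennreal ((norm (M (Suc k) x))\<^sup>2) \<partial>\<Omega>)"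
    by (intro nn_integral_cong) (simp add: indicator_def)
  also note le[OF A]
  finally show "(\<integral>x. indicator A x * (norm (M (Suc k) x))\<^sup>2 \<partial>\<Omega>) \<le> (m k)\<^sup>2 * mom A k"
    using mom_nonneg[of A k] by (simp add: ennreal_le_iff)
qed

text \<open>The conditional mean is given coordinatewise, so the inner product is expanded in the standard basis;
each factor \<open>(\<theta> k - \<theta>s) \<bullet> i\<close> is bounded and known before the noise.\<close>

lemma noise_orth:
  assumes A: "A \<in> sets (Gm k)"
  shows "integrable \<Omega> (\<lambda>x. indicator A x * ((\<theta> k x - \<theta>s) \<bullet> M (Suc k) x))"
    and "(\<integral>x. indicator A x * ((\<theta> k x - \<theta>s) \<bullet> M (Suc k) x) \<partial>\<Omega>) = 0"
proof -
  interpret ce: finite_measure_subalgebra \<Omega> "Gm k" by (rule cond_exp_Gm)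
  have AO: "A \<in> sets \<Omega>" using A subalgebra_Gm by (auto simp: subalgebra_def)
  have top: "space \<Omega> \<in> sets (Gm k)" using sets.top[of "Gm k"] by simp
  have [measurable]: "\<theta> k \<in> borel_measurable (Gm k)" using \<theta>_Gm by (simp add: measurable_restrict_space2_iff)
  define f where "f i x = indicator A x * ((\<theta> k x - \<theta>s) \<bullet> i)" for i x
  have f_meas: "f i \<in> borel_measurable (Gm k)" for i unfolding f_def[abs_def] using A by measurable
  have f_meas\<Omega> [measurable]: "f i \<in> borel_measurable \<Omega>" for i
    by (rule measurable_from_subalg[OF subalgebra_Gm f_meas])
  have int: "integrable \<Omega> (\<lambda>x. f i x * (M (Suc k) x \<bullet> i))" if i: "i \<in> Basis" for i
  proof (rule Bochner_Integration.integrable_bound)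
    show "integrable \<Omega> (\<lambda>x. D\<^sup>2 + (norm (M (Suc k) x))\<^sup>2)" using noise_sq(1)[OF top] by simp
    show "(\<lambda>x. f i x * (M (Suc k) x \<bullet> i)) \<in> borel_measurable \<Omega>" by measurable
    show "AE x in \<Omega>. norm (f i x * (M (Suc k) x \<bullet> i)) \<le> norm (D\<^sup>2 + (norm (M (Suc k) x))\<^sup>2)"
    proof (rule AE_I2)
      fix x assume x: "x \<in> space \<Omega>"
      have "\<bar>f i x\<bar> \<le> D"
        using Basis_le_norm[OF i, of "\<theta> k x - \<theta>s"] D[OF \<theta>_in[OF x], of k] norm_ge_zero[of "\<theta> k x - \<theta>s"]
        by (simp add: f_def indicator_def abs_mult del: norm_ge_zero)
      moreover have "\<bar>M (Suc k) x \<bullet> i\<bar> \<le> norm (M (Suc k) x)" by (rule Basis_le_norm[OF i])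
      ultimately have "\<bar>f i x * (M (Suc k) x \<bullet> i)\<bar> \<le> D * norm (M (Suc k) x)"
        unfolding abs_mult by (intro mult_mono) auto
      also have "\<dots> \<le> D\<^sup>2 + (norm (M (Suc k) x))\<^sup>2"
        using sum_squares_bound[of D "norm (M (Suc k) x)"] zero_le_power2[of D] zero_le_power2[of "norm (M (Suc k) x)"]
        by linarith
      finally show "norm (f i x * (M (Suc k) x \<bullet> i)) \<le> norm (D\<^sup>2 + (norm (M (Suc k) x))\<^sup>2)" by simp
    qed
  qed
  have zero: "(\<integral>x. f i x * (M (Suc k) x \<bullet> i) \<partial>\<Omega>) = 0" if i: "i \<in> Basis" for i
  proof -
    have "(\<integral>x. f i x * (M (Suc k) x \<bullet> i) \<partial>\<Omega>) = (\<integral>x. f i x * real_cond_exp \<Omega> (Gm k) (\<lambda>x. M (Suc k) x \<bullet> i) x \<partial>\<Omega>)"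
      by (rule ce.real_cond_exp_intg(2)[OF int[OF i] f_meas, symmetric]) measurable
    also have "\<dots> = (\<integral>x. 0 \<partial>\<Omega>)"
    proof (rule integral_cong_AE)
      have "AE x in \<Omega>. real_cond_exp \<Omega> (Gm k) (\<lambda>x. M (Suc k) x \<bullet> i) x = 0"
        using err i unfolding error_process_def by blast
      then show "AE x in \<Omega>. f i x * real_cond_exp \<Omega> (Gm k) (\<lambda>x. M (Suc k) x \<bullet> i) x = 0" by eventually_elim simp
    qed measurable
    finally show ?thesis by simp
  qed
  have dec: "indicator A x * ((\<theta> k x - \<theta>s) \<bullet> M (Suc k) x) = (\<Sum>i\<in>Basis. f i x * (M (Suc k) x \<bullet> i))" for x
    by (subst euclidean_inner) (simp add: f_def sum_distrib_left mult.assoc)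
  show "integrable \<Omega> (\<lambda>x. indicator A x * ((\<theta> k x - \<theta>s) \<bullet> M (Suc k) x))"
    unfolding dec by (intro Bochner_Integration.integrable_sum int)
  show "(\<integral>x. indicator A x * ((\<theta> k x - \<theta>s) \<bullet> M (Suc k) x) \<partial>\<Omega>) = 0"
    unfolding dec by (subst Bochner_Integration.integral_sum) (auto simp: int zero)
qed

definition dev :: "'a set \<Rightarrow> nat \<Rightarrow> real" where
  "dev A k = (\<integral>x. indicator A x * (norm (\<theta> k x - \<theta>s))\<^sup>2 \<partial>\<Omega>)"

text \<open>\<open>sq_bound k\<close> majorises the squared increment before multiplication by the step size, and
\<open>sq_scale k\<close> is the factor of \<open>mom A 0\<close> in the bound for its mean.\<close>

definition sq_scale :: "nat \<Rightarrow> real" where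
  "sq_scale k = \<beta> * (6 * C\<^sub>F\<^sup>2 + 3 * (m k)\<^sup>2) + 3 * (b k)\<^sup>2"

definition sq_bound :: "nat \<Rightarrow> 'a \<Rightarrow> real" where
  "sq_bound k x = 6 * C\<^sub>F\<^sup>2 * U 2 (W k x) + 3 * (norm (M (Suc k) x))\<^sup>2 + 3 * (b k)\<^sup>2"

lemma dev_integrable: "A \<in> sets \<Omega> \<Longrightarrow> integrable \<Omega> (\<lambda>x. indicator A x * (norm (\<theta> k x - \<theta>s))\<^sup>2)"
proof -
  assume A: "A \<in> sets \<Omega>"
  have "integrable \<Omega> (\<lambda>x. (norm (\<theta> k x - \<theta>s))\<^sup>2)"
    using D[OF \<theta>_in] by (intro integrable_const_bound[where B="D\<^sup>2"] AE_I2) (auto intro!: power_mono)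
  then show ?thesis by (rule integrable_ind[OF A])
qed

lemma dev_le: "A \<in> sets \<Omega> \<Longrightarrow> dev A k \<le> D\<^sup>2 * mom A 0"
proof -
  assume A: "A \<in> sets \<Omega>"
  have "dev A k \<le> (\<integral>x. D\<^sup>2 * (indicator A x * U 2 (W 0 x)) \<partial>\<Omega>)"
    unfolding dev_def
  proof (intro integral_mono dev_integrable A integrable_mult_right integrable_ind integrable_U2)
    fix x assume "x \<in> space \<Omega>"
    then have "(norm (\<theta> k x - \<theta>s))\<^sup>2 \<le> D\<^sup>2" using D[OF \<theta>_in] by (intro power_mono) auto
    also have "\<dots> \<le> D\<^sup>2 * U 2 (W 0 x)" using mult_left_mono[OF U_ge_1, of "D\<^sup>2" 2 "W 0 x"] by simp
    finally show "indicator A x * (norm (\<theta> k x - \<theta>s))\<^sup>2 \<le> D\<^sup>2 * (indicator A x * U 2 (W 0 x))"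
      by (simp add: indicator_def)
  qed
  then show ?thesis by (simp add: mom_def)
qed

lemma sq_bound_integral:
  assumes A: "A \<in> sets (Gp 0)"
  shows "integrable \<Omega> (\<lambda>x. indicator A x * sq_bound (Suc k) x)"
    and "(\<integral>x. indicator A x * sq_bound (Suc k) x \<partial>\<Omega>) \<le> sq_scale (Suc k) * mom A 0"
proof -
  let ?k = "Suc k"
  have AO: "A \<in> sets \<Omega>" by (rule Gp_sets_\<Omega>[OF A])
  have Am: "A \<in> sets (Gm ?k)" by (rule Gp_0_sets_Gm[OF A])
  note iU = integrable_ind[OF AO integrable_U2, of ?k]
    and iM = integrable_ind[OF AO noise_sq(1)[OF Am]]
  have iA: "integrable \<Omega> (indicator A :: 'a \<Rightarrow> real)"
    using AO by (simp add: integrable_real_indicator emeasure_eq_measure)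
  have dec: "indicator A x * sq_bound ?k x = 6 * C\<^sub>F\<^sup>2 * (indicator A x * U 2 (W ?k x))
      + 3 * (indicator A x * (norm (M (Suc ?k) x))\<^sup>2) + 3 * (b ?k)\<^sup>2 * indicator A x" for x
    by (simp add: sq_bound_def algebra_simps)
  show "integrable \<Omega> (\<lambda>x. indicator A x * sq_bound ?k x)"
    unfolding dec using iU iM iA by (intro Bochner_Integration.integrable_add integrable_mult_right)
  have "(\<integral>x. indicator A x * sq_bound ?k x \<partial>\<Omega>) = 6 * C\<^sub>F\<^sup>2 * mom A ?k
      + 3 * (\<integral>x. indicator A x * (norm (M (Suc ?k) x))\<^sup>2 \<partial>\<Omega>) + 3 * (b ?k)\<^sup>2 * prob A"
    unfolding dec mom_def using iU iM iA sets.Int_space_eq2[OF AO] by simp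
  also have "\<dots> \<le> 6 * C\<^sub>F\<^sup>2 * (\<beta> * mom A 0) + 3 * ((m ?k)\<^sup>2 * (\<beta> * mom A 0)) + 3 * (b ?k)\<^sup>2 * mom A 0"
    using mom_bound[OF A, of ?k] prob_le_mom[OF AO, of 0]
      order_trans[OF noise_sq(2)[OF Am] mult_left_mono[OF mom_bound[OF A, of ?k], of "(m ?k)\<^sup>2"]]
    by (intro add_mono mult_left_mono) auto
  also have "\<dots> = sq_scale ?k * mom A 0" by (simp add: sq_scale_def algebra_simps)
  finally show "(\<integral>x. indicator A x * sq_bound ?k x \<partial>\<Omega>) \<le> sq_scale ?k * mom A 0" .
qed

lemma increment_sq: "x \<in> space \<Omega> \<Longrightarrow> norm (B k x) \<le> b k \<Longrightarrow>
  (norm (F (\<theta> k x) (W k x) + M (Suc k) x + B k x))\<^sup>2 \<le> sq_bound k x"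
proof -
  assume x: "x \<in> space \<Omega>" and B: "norm (B k x) \<le> b k"
  let ?f = "norm (F (\<theta> k x) (W k x))" and ?m = "norm (M (Suc k) x)" and ?b = "norm (B k x)"
  have sq: "(p + q + r)\<^sup>2 \<le> 3 * (p\<^sup>2 + q\<^sup>2 + r\<^sup>2)" for p q r :: real
  proof -
    have "0 \<le> (p - q)\<^sup>2 + (q - r)\<^sup>2 + (p - r)\<^sup>2" by simp
    also have "\<dots> = 3 * (p\<^sup>2 + q\<^sup>2 + r\<^sup>2) - (p + q + r)\<^sup>2" by (simp add: power2_eq_square algebra_simps)
    finally show ?thesis by simp
  qed
  have "norm (F (\<theta> k x) (W k x) + M (Suc k) x + B k x) \<le> ?f + ?m + ?b"
    by (intro norm_triangle_le norm_triangle_ineq add_right_mono)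
  then have "(norm (F (\<theta> k x) (W k x) + M (Suc k) x + B k x))\<^sup>2 \<le> (?f + ?m + ?b)\<^sup>2"
    by (intro power_mono) auto
  also have "\<dots> \<le> 3 * (?f\<^sup>2 + ?m\<^sup>2 + ?b\<^sup>2)" by (rule sq)
  finally have *: "(norm (F (\<theta> k x) (W k x) + M (Suc k) x + B k x))\<^sup>2 \<le> 3 * (?f\<^sup>2 + ?m\<^sup>2 + ?b\<^sup>2)" .
  have "?f\<^sup>2 \<le> (C\<^sub>F * U 1 (W k x))\<^sup>2" by (intro power_mono C\<^sub>F \<theta>_in W_in x) auto
  also have "\<dots> \<le> C\<^sub>F\<^sup>2 * (2 * U 2 (W k x))"
    unfolding power_mult_distrib by (intro mult_left_mono U1_sq_le_U2) auto
  finally have "?f\<^sup>2 \<le> 2 * C\<^sub>F\<^sup>2 * U 2 (W k x)" by simp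
  moreover have "?b\<^sup>2 \<le> (b k)\<^sup>2" using B by (intro power_mono) auto
  ultimately show ?thesis using * unfolding sq_bound_def by argo
qed

lemma AE_recursion: "AE x in \<Omega>. \<theta> (Suc k) x =
    closest_point \<Theta> (\<theta> k x + \<alpha> k *\<^sub>R (F (\<theta> k x) (W k x) + M (Suc k) x + B k x)) \<and> norm (B k x) \<le> b k"
proof -
  have "AE x in \<Omega>. \<theta> (Suc k) x =
    closest_point \<Theta> (\<theta> k x + \<alpha> k *\<^sub>R (F (\<theta> k x) (W k x) + M (Suc k) x + B k x))"
    using rec unfolding extended_recursion_def by blast
  moreover have "AE x in \<Omega>. norm (B k x) \<le> b k" using err unfolding error_process_def by blast
  ultimately show ?thesis by eventually_elim simp
qed

text \<open>The hypothesis \<open>u_drift\<close> combines quasi-strong monotonicity with the Poisson equation: the drift towards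
\<open>\<theta>s\<close> at the current state is at least as strong as that of the mean field, up to the fluctuation term
\<open>u t w - P t (u t) w\<close>, whose expectation telescopes along the chain. The number \<open>\<eta>\<close> is the part of the
contraction spent on the bias in Young's inequality.\<close>
context
  fixes u :: "'d \<Rightarrow> 'w \<Rightarrow> real" and L \<zeta> \<eta> :: real
  assumes L: "0 \<le> L"
    and u_meas: "\<And>t. t \<in> \<Theta> \<Longrightarrow> u t \<in> borel_measurable S"
    and u_bound: "\<And>t w. t \<in> \<Theta> \<Longrightarrow> w \<in> \<W> \<Longrightarrow> \<bar>u t w\<bar> \<le> L * U 1 w"
    and u_lip: "\<And>t t' w. t \<in> \<Theta> \<Longrightarrow> t' \<in> \<Theta> \<Longrightarrow> w \<in> \<W> \<Longrightarrow> \<bar>u t w - u t' w\<bar> \<le> L * U 1 w * norm (t - t')"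
    and u_drift: "\<And>t w. t \<in> \<Theta> \<Longrightarrow> w \<in> \<W> \<Longrightarrow>
      (t - \<theta>s) \<bullet> F t w \<le> - \<zeta> * (norm (t - \<theta>s))\<^sup>2 + (u t w - (\<integral>y. u t y \<partial>P t w))"
    and \<eta>: "0 < \<eta>"
begin

definition corr :: "'a set \<Rightarrow> nat \<Rightarrow> real" where
  "corr A k = (\<integral>x. indicator A x * u (\<theta> k x) (W k x) \<partial>\<Omega>)"

lemma u_joint: "(\<lambda>(t, w). u t w) \<in> borel_measurable (restrict_space borel \<Theta> \<Otimes>\<^sub>M S)"
proof (rule borel_measurable_caratheodory[where g="\<lambda>w. L * U 1 w"])
  show "\<bar>u t w - u t' w\<bar> \<le> L * U 1 w * norm (t - t')" if "t \<in> \<Theta>" "t' \<in> \<Theta>" "w \<in> space S" for t t' w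
    using u_lip that space_S by simp
qed (use \<Theta> \<theta>s u_meas compact_imp_closed in auto)

lemma u_le_U2: "t \<in> \<Theta> \<Longrightarrow> w \<in> \<W> \<Longrightarrow> \<bar>u t w\<bar> \<le> 2 * L * U 2 w"
  using u_bound[of t w] mult_left_mono[OF U1_le_U2 L, of w] by simp

lemma u_process_meas [measurable]: "(\<lambda>x. u (\<theta> j x) (W k x)) \<in> borel_measurable \<Omega>"
  using measurable_compose[OF measurable_Pair[OF \<theta>_meas W_meas] u_joint] by simp

lemma u_integrable: "integrable \<Omega> (\<lambda>x. u (\<theta> j x) (W k x))"
  by (rule Bochner_Integration.integrable_bound[OF integrable_mult_right[OF integrable_U2, of "2 * L" k]])
     (use u_le_U2[OF \<theta>_in W_in] L in \<open>auto intro!: AE_I2 intro: order_trans[OF _ abs_ge_self]\<close>)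

lemma corr_bound:
  assumes A: "A \<in> sets (Gp 0)" shows "\<bar>corr A k\<bar> \<le> 2 * L * \<beta> * mom A 0"
proof -
  have AO: "A \<in> sets \<Omega>" by (rule Gp_sets_\<Omega>[OF A])
  have "\<bar>corr A k\<bar> \<le> (\<integral>x. \<bar>indicator A x * u (\<theta> k x) (W k x)\<bar> \<partial>\<Omega>)"
    unfolding corr_def by (rule integral_abs_bound)
  also have "\<dots> \<le> (\<integral>x. 2 * L * (indicator A x * U 2 (W k x)) \<partial>\<Omega>)"
    using u_le_U2[OF \<theta>_in W_in] integrable_ind[OF AO u_integrable] integrable_ind[OF AO integrable_U2]
    by (intro integral_mono) (auto simp: indicator_def)
  also have "\<dots> \<le> 2 * L * (\<beta> * mom A 0)"
    using mult_left_mono[OF mom_bound[OF A, of k], of "2 * L"] L by (simp add: mom_def)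
  finally show ?thesis by (simp add: mult.assoc)
qed

lemma corr_next:
  assumes A: "A \<in> sets (Gp k)"
  shows "integrable \<Omega> (\<lambda>x. indicator A x * (\<integral>y. u (\<theta> k x) y \<partial>\<kappa> k x))"
    and "(\<integral>x. indicator A x * u (\<theta> k x) (W (Suc k) x) \<partial>\<Omega>)
       = (\<integral>x. indicator A x * (\<integral>y. u (\<theta> k x) y \<partial>\<kappa> k x) \<partial>\<Omega>)"
proof -
  have [measurable]: "(\<lambda>(x, y). u (\<theta> k x) y) \<in> borel_measurable (Gp k \<Otimes>\<^sub>M S)"
    using measurable_compose[OF measurable_Pair[OF measurable_compose[OF measurable_fst \<theta>_Gp] measurable_snd] u_joint]
    by (simp add: case_prod_beta')
  have H: "(\<lambda>(x, y). indicator A x * u (\<theta> k x) y) \<in> borel_measurable (Gp k \<Otimes>\<^sub>M S)"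
    using A by measurable
  have b: "\<bar>indicator A x * u (\<theta> k x) y\<bar> \<le> 2 * L * U 2 y" if "x \<in> space \<Omega>" "y \<in> \<W>" for x y
    using u_le_U2[OF \<theta>_in[OF that(1)] that(2)] L U_ge_1[of 2 y] by (auto simp: indicator_def)
  note n = integral_next_state[OF H b integrable_mult_right[OF \<kappa>_integrable] integrable_mult_right[OF integrable_U2]]
  show "integrable \<Omega> (\<lambda>x. indicator A x * (\<integral>y. u (\<theta> k x) y \<partial>\<kappa> k x))" using n(2) by simp
  show "(\<integral>x. indicator A x * u (\<theta> k x) (W (Suc k) x) \<partial>\<Omega>)
       = (\<integral>x. indicator A x * (\<integral>y. u (\<theta> k x) y \<partial>\<kappa> k x) \<partial>\<Omega>)" using n(3) by simp
qed

text \<open>One step moves the parameter by at most the step size times the increment, and the product of the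
increment with \<open>U 1\<close> is split by \<open>2 x y \<le> x\<^sup>2 + y\<^sup>2\<close>.\<close>

lemma AE_corr_increment: "AE x in \<Omega>. u (\<theta> (Suc k) x) (W (Suc k) x) - u (\<theta> k x) (W (Suc k) x)
    \<le> L * \<alpha> k * (U 2 (W (Suc k) x) + sq_bound k x)"
  using AE_recursion[of k] AE_space
proof eventually_elim
  case (elim x)
  then have x: "x \<in> space \<Omega>" and B: "norm (B k x) \<le> b k" by auto
  let ?Y = "F (\<theta> k x) (W k x) + M (Suc k) x + B k x" and ?U = "U 1 (W (Suc k) x)"
  have U0: "0 \<le> ?U" using U_ge_1[of 1 "W (Suc k) x"] by simp
  have ne: "\<Theta> \<noteq> {}" using \<theta>s by blast
  have "norm (\<theta> (Suc k) x - \<theta> k x) \<le> norm (\<alpha> k *\<^sub>R ?Y)"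
    using closest_point_lipschitz[OF \<Theta>(2) compact_imp_closed[OF \<Theta>(1)] ne, of "\<theta> k x + \<alpha> k *\<^sub>R ?Y" "\<theta> k x"]
      closest_point_self[OF \<theta>_in[OF x, of k]] elim by (simp add: dist_norm)
  then have "norm (\<theta> (Suc k) x - \<theta> k x) \<le> \<alpha> k * norm ?Y" using \<alpha>[of k] by simp
  then have "L * ?U * norm (\<theta> (Suc k) x - \<theta> k x) \<le> L * ?U * (\<alpha> k * norm ?Y)"
    using L U0 by (intro mult_left_mono) auto
  moreover have "u (\<theta> (Suc k) x) (W (Suc k) x) - u (\<theta> k x) (W (Suc k) x) \<le> L * ?U * norm (\<theta> (Suc k) x - \<theta> k x)"
    using u_lip[OF \<theta>_in[OF x] \<theta>_in[OF x] W_in[OF x]] by (simp add: abs_le_iff)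
  moreover have "L * ?U * (\<alpha> k * norm ?Y) = L * \<alpha> k * (?U * norm ?Y)" by simp
  moreover have "L * \<alpha> k * (?U * norm ?Y) \<le> L * \<alpha> k * (U 2 (W (Suc k) x) + sq_bound k x)"
  proof (rule mult_left_mono)
    have "2 * ?U * norm ?Y \<le> ?U\<^sup>2 + (norm ?Y)\<^sup>2" by (rule sum_squares_bound)
    moreover have "0 \<le> sq_bound k x" using order_trans[OF zero_le_power2 increment_sq[OF x B]] .
    ultimately show "?U * norm ?Y \<le> U 2 (W (Suc k) x) + sq_bound k x"
      using U1_sq_le_U2[of "W (Suc k) x"] increment_sq[OF x B] by simp
  qed (use L \<alpha>[of k] in simp)
  ultimately show ?case by linarith
qed

lemma AE_one_step: "AE x in \<Omega>. (norm (\<theta> (Suc k) x - \<theta>s))\<^sup>2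
    \<le> (1 - (2 * \<zeta> - \<eta>) * \<alpha> k) * (norm (\<theta> k x - \<theta>s))\<^sup>2
      + 2 * \<alpha> k * (u (\<theta> k x) (W k x) - (\<integral>y. u (\<theta> k x) y \<partial>\<kappa> k x))
      + 2 * \<alpha> k * ((\<theta> k x - \<theta>s) \<bullet> M (Suc k) x)
      + \<alpha> k * ((b k)\<^sup>2 / \<eta>) + (\<alpha> k)\<^sup>2 * sq_bound k x"
  using AE_recursion[of k] AE_space
proof eventually_elim
  case (elim x)
  then have x: "x \<in> space \<Omega>" and B: "norm (B k x) \<le> b k" by auto
  let ?Y = "F (\<theta> k x) (W k x) + M (Suc k) x + B k x" and ?d = "\<theta> k x - \<theta>s" and ?a = "\<alpha> k"
  have ne: "\<Theta> \<noteq> {}" using \<theta>s by blast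
  have "norm (\<theta> (Suc k) x - \<theta>s) \<le> norm (?d + ?a *\<^sub>R ?Y)"
    using closest_point_lipschitz[OF \<Theta>(2) compact_imp_closed[OF \<Theta>(1)] ne, of "\<theta> k x + ?a *\<^sub>R ?Y" \<theta>s]
      closest_point_self[OF \<theta>s] elim by (simp add: dist_norm algebra_simps)
  then have "(norm (\<theta> (Suc k) x - \<theta>s))\<^sup>2 \<le> (norm (?d + ?a *\<^sub>R ?Y))\<^sup>2" by (intro power_mono) auto
  also have "\<dots> = (norm ?d)\<^sup>2 + 2 * ?a * (?d \<bullet> ?Y) + ?a\<^sup>2 * (norm ?Y)\<^sup>2"
    unfolding power2_norm_eq_inner by (simp add: inner_add_left inner_add_right inner_commute power2_eq_square algebra_simps)
  finally have main: "(norm (\<theta> (Suc k) x - \<theta>s))\<^sup>2 \<le> (norm ?d)\<^sup>2 + 2 * ?a * (?d \<bullet> ?Y) + ?a\<^sup>2 * (norm ?Y)\<^sup>2" .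
  have "2 * (?d \<bullet> B k x) \<le> \<eta> * (norm ?d)\<^sup>2 + (b k)\<^sup>2 / \<eta>"
  proof -
    have "?d \<bullet> B k x \<le> norm ?d * b k"
      using norm_cauchy_schwarz[of ?d "B k x"] mult_left_mono[OF B norm_ge_zero[of ?d]] by linarith
    moreover have "2 * (norm ?d * b k) \<le> \<eta> * (norm ?d)\<^sup>2 + (b k)\<^sup>2 / \<eta>"
    proof -
      have "0 \<le> (\<eta> * norm ?d - b k)\<^sup>2 / \<eta>" using \<eta> by simp
      also have "\<dots> = \<eta> * (norm ?d)\<^sup>2 + (b k)\<^sup>2 / \<eta> - 2 * (norm ?d * b k)"
        using \<eta> by (simp add: power2_eq_square field_simps)
      finally show ?thesis by simp
    qed
    ultimately show ?thesis by linarith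
  qed
  moreover have "?d \<bullet> F (\<theta> k x) (W k x) \<le> - \<zeta> * (norm ?d)\<^sup>2 + (u (\<theta> k x) (W k x) - (\<integral>y. u (\<theta> k x) y \<partial>\<kappa> k x))"
    by (rule u_drift[OF \<theta>_in[OF x] W_in[OF x]])
  ultimately have "2 * (?d \<bullet> ?Y) \<le> (\<eta> - 2 * \<zeta>) * (norm ?d)\<^sup>2
      + 2 * (u (\<theta> k x) (W k x) - (\<integral>y. u (\<theta> k x) y \<partial>\<kappa> k x)) + 2 * (?d \<bullet> M (Suc k) x) + (b k)\<^sup>2 / \<eta>"
    unfolding inner_add_right by argo
  from mult_left_mono[OF this, of ?a] \<alpha>[of k]
  have "2 * ?a * (?d \<bullet> ?Y) \<le> ?a * ((\<eta> - 2 * \<zeta>) * (norm ?d)\<^sup>2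
      + 2 * (u (\<theta> k x) (W k x) - (\<integral>y. u (\<theta> k x) y \<partial>\<kappa> k x)) + 2 * (?d \<bullet> M (Suc k) x) + (b k)\<^sup>2 / \<eta>)"
    by (simp add: ac_simps)
  moreover have "?a\<^sup>2 * (norm ?Y)\<^sup>2 \<le> ?a\<^sup>2 * sq_bound k x" by (intro mult_left_mono increment_sq[OF x B]) auto
  ultimately show ?case using main by (simp add: algebra_simps)
qed

text \<open>In the mean, \<open>P (u)\<close> at the current state is \<open>u\<close> at the next state with the old parameter. Exchanging
the old parameter for the new one costs another factor \<open>\<alpha> k\<close> and leaves the telescoping difference of
\<open>corr\<close>. The index starts at \<open>1\<close> because the event \<open>A\<close> may depend on the first noise variable, which is
centred only with respect to the smaller algebra \<open>Gm 0\<close>.\<close>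

lemma one_step:
  assumes A: "A \<in> sets (Gp 0)" and k: "1 \<le> k"
  shows "dev A (Suc k) \<le> (1 - (2 * \<zeta> - \<eta>) * \<alpha> k) * dev A k + 2 * \<alpha> k * (corr A k - corr A (Suc k))
    + \<alpha> k * ((b k)\<^sup>2 / \<eta>) * mom A 0 + (\<alpha> k)\<^sup>2 * (2 * L * \<beta> + (2 * L + 1) * sq_scale k) * mom A 0"
proof -
  obtain j where kj: "k = Suc j" using k by (cases k) auto
  have AO: "A \<in> sets \<Omega>" by (rule Gp_sets_\<Omega>[OF A])
  have Am: "A \<in> sets (Gm k)" unfolding kj by (rule Gp_0_sets_Gm[OF A])
  have Ap: "A \<in> sets (Gp k)" by (rule Gp_0_sets[OF A])
  let ?I = "indicator A :: 'a \<Rightarrow> real"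
  let ?pu = "\<lambda>x. \<integral>y. u (\<theta> k x) y \<partial>\<kappa> k x"
  let ?r = "\<integral>x. ?I x * sq_bound k x \<partial>\<Omega>"
  have iA: "integrable \<Omega> ?I" using AO by (simp add: integrable_real_indicator emeasure_eq_measure)
  have intA: "(\<integral>x. ?I x \<partial>\<Omega>) = prob A" using sets.Int_space_eq2[OF AO] by simp
  note iU = integrable_ind[OF AO u_integrable]
    and iN = noise_orth[OF Am] and iR = sq_bound_integral[OF A, of j, folded kj]
    and iD = dev_integrable[OF AO] and i2 = integrable_ind[OF AO integrable_U2]
  have "dev A (Suc k) \<le> (\<integral>x. (1 - (2 * \<zeta> - \<eta>) * \<alpha> k) * (?I x * (norm (\<theta> k x - \<theta>s))\<^sup>2)
      + 2 * \<alpha> k * (?I x * u (\<theta> k x) (W k x) - ?I x * ?pu x)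
      + 2 * \<alpha> k * (?I x * ((\<theta> k x - \<theta>s) \<bullet> M (Suc k) x))
      + \<alpha> k * ((b k)\<^sup>2 / \<eta>) * ?I x + (\<alpha> k)\<^sup>2 * (?I x * sq_bound k x) \<partial>\<Omega>)" (is "_ \<le> (\<integral>x. ?rhs x \<partial>\<Omega>)")
    unfolding dev_def
  proof (rule integral_mono_AE[OF iD])
    show "integrable \<Omega> ?rhs"
      using iU iN(1) iR(1) iD corr_next(1)[OF Ap] iA
      by (intro Bochner_Integration.integrable_add Bochner_Integration.integrable_diff integrable_mult_right)
    show "AE x in \<Omega>. ?I x * (norm (\<theta> (Suc k) x - \<theta>s))\<^sup>2 \<le> ?rhs x"
      using AE_one_step[of k] by eventually_elim (auto simp: indicator_def)
  qed
  also have "(\<integral>x. ?rhs x \<partial>\<Omega>) = (1 - (2 * \<zeta> - \<eta>) * \<alpha> k) * dev A k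
      + 2 * \<alpha> k * (corr A k - (\<integral>x. ?I x * ?pu x \<partial>\<Omega>)) + \<alpha> k * ((b k)\<^sup>2 / \<eta>) * prob A + (\<alpha> k)\<^sup>2 * ?r"
    unfolding dev_def corr_def
    using iU iN iR(1) iD corr_next(1)[OF Ap] iA by (simp add: intA sets.Int_space_eq2[OF AO])
  finally have step: "dev A (Suc k) \<le> (1 - (2 * \<zeta> - \<eta>) * \<alpha> k) * dev A k
      + 2 * \<alpha> k * (corr A k - (\<integral>x. ?I x * ?pu x \<partial>\<Omega>)) + \<alpha> k * ((b k)\<^sup>2 / \<eta>) * prob A + (\<alpha> k)\<^sup>2 * ?r" .
  have "corr A (Suc k) - (\<integral>x. ?I x * ?pu x \<partial>\<Omega>)
      = (\<integral>x. ?I x * u (\<theta> (Suc k) x) (W (Suc k) x) - ?I x * u (\<theta> k x) (W (Suc k) x) \<partial>\<Omega>)"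
    unfolding corr_next(2)[OF Ap, symmetric] corr_def using iU by simp
  also have "\<dots> \<le> (\<integral>x. L * \<alpha> k * (?I x * U 2 (W (Suc k) x) + ?I x * sq_bound k x) \<partial>\<Omega>)"
  proof (rule integral_mono_AE)
    show "AE x in \<Omega>. ?I x * u (\<theta> (Suc k) x) (W (Suc k) x) - ?I x * u (\<theta> k x) (W (Suc k) x)
        \<le> L * \<alpha> k * (?I x * U 2 (W (Suc k) x) + ?I x * sq_bound k x)"
      using AE_corr_increment[of k] by eventually_elim (auto simp: indicator_def)
  qed (use iU i2 iR(1) in \<open>auto intro!: Bochner_Integration.integrable_add Bochner_Integration.integrable_diff integrable_mult_right\<close>)
  also have "\<dots> = L * \<alpha> k * (mom A (Suc k) + ?r)" using i2 iR(1) by (simp add: mom_def)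
  also have "\<dots> \<le> L * \<alpha> k * (\<beta> * mom A 0 + sq_scale k * mom A 0)"
    using L \<alpha>[of k] mom_bound[OF A, of "Suc k"] iR(2) by (intro mult_left_mono add_mono) auto
  finally have "- (\<integral>x. ?I x * ?pu x \<partial>\<Omega>) \<le> - corr A (Suc k) + L * \<alpha> k * (\<beta> * mom A 0 + sq_scale k * mom A 0)"
    by linarith
  then have "2 * \<alpha> k * (corr A k - (\<integral>x. ?I x * ?pu x \<partial>\<Omega>))
      \<le> 2 * \<alpha> k * (corr A k - corr A (Suc k) + L * \<alpha> k * (\<beta> * mom A 0 + sq_scale k * mom A 0))"
    using \<alpha>[of k] by (intro mult_left_mono) auto
  moreover have "\<alpha> k * ((b k)\<^sup>2 / \<eta>) * prob A \<le> \<alpha> k * ((b k)\<^sup>2 / \<eta>) * mom A 0"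
    using \<alpha>[of k] \<eta> by (intro mult_left_mono prob_le_mom AO) (auto simp: less_imp_le)
  moreover have "(\<alpha> k)\<^sup>2 * ?r \<le> (\<alpha> k)\<^sup>2 * (sq_scale k * mom A 0)" using iR(2) by (intro mult_left_mono) auto
  ultimately have "dev A (Suc k) \<le> (1 - (2 * \<zeta> - \<eta>) * \<alpha> k) * dev A k
      + 2 * \<alpha> k * (corr A k - corr A (Suc k) + L * \<alpha> k * (\<beta> * mom A 0 + sq_scale k * mom A 0))
      + \<alpha> k * ((b k)\<^sup>2 / \<eta>) * mom A 0 + (\<alpha> k)\<^sup>2 * (sq_scale k * mom A 0)"
    using step by linarith
  then show ?thesis by (simp add: algebra_simps power2_eq_square)
qed

text \<open>The scalar recursion is applied to \<open>dev A k + 2 * \<alpha> k * corr A k\<close>, which absorbs the telescoping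
difference. Since the step sizes vary by at most a multiple of \<open>\<alpha> k\<^sup>2\<close>, this costs only further terms of
order \<open>\<alpha> k\<^sup>2\<close>, and the correction itself is of order \<open>\<alpha> k\<close>, hence at most of the order of the rate. By
the choice of \<open>p\<close>, the one rate \<open>k powr (- \<delta> - p)\<close> covers the three sources of error
 \<open>\<alpha> k\<^sup>2\<close>, \<open>\<alpha> k\<^sup>2 * (m k)\<^sup>2\<close> and
\<open>\<alpha> k * (b k)\<^sup>2\<close>.\<close>

lemma dev_rate:
  assumes \<zeta>\<eta>: "0 \<le> 2 * \<zeta> - \<eta>"
    and step: "\<And>k. \<alpha> k = step_size \<alpha>\<^sub>0 \<delta> k" and \<delta>: "0 < \<delta>" "\<delta> \<le> 1"
    and scales: "error_scales m b C\<^sub>M C\<^sub>B \<omega>\<^sub>M \<omega>\<^sub>B" and p: "0 < p" "p \<le> \<delta> - 2 * \<omega>\<^sub>M" "p \<le> 2 * \<omega>\<^sub>B"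
    and conv: "\<And>x y k. 0 \<le> y \<Longrightarrow> (\<And>k. 1 \<le> k \<Longrightarrow> x k \<le> y) \<Longrightarrow>
      (\<And>k. 1 \<le> k \<Longrightarrow> x (Suc k) \<le> (1 - (2 * \<zeta> - \<eta>) * \<alpha>\<^sub>0 * real k powr - \<delta>) * x k + y * real k powr (- \<delta> - p)) \<Longrightarrow>
      K \<le> k \<Longrightarrow> x k \<le> C * y * real k powr - p"
    and K: "1 \<le> K"
    and A: "A \<in> sets (Gp 0)" and k: "K \<le> k"
  shows "dev A k \<le> (C * (4 * L * \<beta> * ((2 * \<zeta> - \<eta>) * \<alpha>\<^sub>0\<^sup>2 + 2 * \<alpha>\<^sub>0) + \<alpha>\<^sub>0 * C\<^sub>B\<^sup>2 / \<eta>
      + \<alpha>\<^sub>0\<^sup>2 * (2 * L * \<beta> + (2 * L + 1) * (\<beta> * (6 * C\<^sub>F\<^sup>2 + 6 * C\<^sub>M\<^sup>2) + 3 * C\<^sub>B\<^sup>2)) + D\<^sup>2)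
      + 4 * L * \<beta> * \<alpha>\<^sub>0) * real k powr - p * mom A 0"
proof -
  define y where "y = mom A 0"
  define z where "z = 2 * \<zeta> - \<eta>"
  define Q where "Q = \<beta> * (6 * C\<^sub>F\<^sup>2 + 6 * C\<^sub>M\<^sup>2) + 3 * C\<^sub>B\<^sup>2"
  define Y where "Y = 4 * L * \<beta> * (z * \<alpha>\<^sub>0\<^sup>2 + 2 * \<alpha>\<^sub>0) + \<alpha>\<^sub>0 * C\<^sub>B\<^sup>2 / \<eta>
      + \<alpha>\<^sub>0\<^sup>2 * (2 * L * \<beta> + (2 * L + 1) * Q) + D\<^sup>2"
  have AO: "A \<in> sets \<Omega>" by (rule Gp_sets_\<Omega>[OF A])
  have y0: "0 \<le> y" by (simp add: y_def mom_nonneg)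
  have \<beta>0: "0 \<le> \<beta>" using \<beta> by simp
  have Q0: "0 \<le> Q" using \<beta>0 by (simp add: Q_def)
  have al: "\<alpha> j = \<alpha>\<^sub>0 * real j powr - \<delta>" if "1 \<le> j" for j using that by (simp add: step step_size_def)
  have \<alpha>0: "0 < \<alpha>\<^sub>0" using \<alpha>[of 0] by (simp add: step step_size_def)
  have z0: "0 \<le> z" using \<zeta>\<eta> by (simp add: z_def)
  have \<omega>: "0 \<le> \<omega>\<^sub>M" "0 \<le> C\<^sub>M" "0 \<le> C\<^sub>B" using scales by (auto simp: error_scales_def)
  have pd: "p \<le> \<delta>" using p \<omega> by simp
  have Y0: "0 \<le> Y" using L \<beta>0 z0 \<alpha>0 \<eta> Q0 by (simp add: Y_def)
  define h where "h j = corr A j" for j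
  have h: "\<bar>h j\<bar> \<le> 2 * L * \<beta> * y" for j unfolding h_def y_def by (rule corr_bound[OF A])
  define x where "x j = dev A j + 2 * \<alpha> j * h j" for j
  have sq_al: "(\<alpha> j)\<^sup>2 = \<alpha>\<^sub>0\<^sup>2 * real j powr (- 2 * \<delta>)" if "1 \<le> j" for j
    by (simp add: al[OF that] power_mult_distrib power2_eq_square powr_add[symmetric])
  have m_le: "(m j)\<^sup>2 \<le> 2 * C\<^sub>M\<^sup>2 * real j powr (2 * \<omega>\<^sub>M)" if j: "1 \<le> j" for j
  proof -
    have "real (j + 1) powr \<omega>\<^sub>M \<le> (2 * real j) powr \<omega>\<^sub>M" using j \<omega> by (intro powr_mono2) auto
    then have "m j \<le> C\<^sub>M * (2 * real j) powr \<omega>\<^sub>M"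
      using scales \<omega> by (auto simp: error_scales_def intro: order_trans mult_left_mono)
    then have "(m j)\<^sup>2 \<le> (C\<^sub>M * (2 * real j) powr \<omega>\<^sub>M)\<^sup>2"
      using scales by (intro power_mono) (auto simp: error_scales_def)
    also have "\<dots> = C\<^sub>M\<^sup>2 * (2 powr (2 * \<omega>\<^sub>M) * real j powr (2 * \<omega>\<^sub>M))"
      by (simp add: power_mult_distrib power2_eq_square powr_add[symmetric] powr_mult[symmetric])
    also have "\<dots> \<le> C\<^sub>M\<^sup>2 * (2 * real j powr (2 * \<omega>\<^sub>M))"
      using powr_mono[of "2 * \<omega>\<^sub>M" 1 2] p \<delta> by (intro mult_left_mono mult_right_mono) auto
    finally show ?thesis by simp
  qed
  have b_le: "(b j)\<^sup>2 \<le> C\<^sub>B\<^sup>2 * real j powr - p" if j: "1 \<le> j" for j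
  proof -
    have "real (j + 1) powr - \<omega>\<^sub>B \<le> real j powr - \<omega>\<^sub>B" using j p by (intro powr_mono2') auto
    then have "b j \<le> C\<^sub>B * real j powr - \<omega>\<^sub>B"
      using scales \<omega> by (auto simp: error_scales_def intro: order_trans mult_left_mono)
    then have "(b j)\<^sup>2 \<le> (C\<^sub>B * real j powr - \<omega>\<^sub>B)\<^sup>2"
      using scales by (intro power_mono) (auto simp: error_scales_def)
    also have "\<dots> = C\<^sub>B\<^sup>2 * real j powr (- 2 * \<omega>\<^sub>B)"
      by (simp add: power_mult_distrib power2_eq_square powr_add[symmetric])
    also have "\<dots> \<le> C\<^sub>B\<^sup>2 * real j powr - p" using j p by (intro mult_left_mono powr_mono) auto
    finally show ?thesis .
  qed
  have scale_le: "sq_scale j \<le> Q * real j powr (2 * \<omega>\<^sub>M)" if j: "1 \<le> j" for j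
  proof -
    have one: "1 \<le> real j powr (2 * \<omega>\<^sub>M)" using j \<omega> by (simp add: ge_one_powr_ge_zero)
    have "(b j)\<^sup>2 \<le> C\<^sub>B\<^sup>2 * 1"
      using b_le[OF j] mult_left_mono[of "real j powr - p" 1 "C\<^sub>B\<^sup>2"] powr_mono[of "- p" 0 "real j"] j p by simp
    also have "\<dots> \<le> C\<^sub>B\<^sup>2 * real j powr (2 * \<omega>\<^sub>M)" by (rule mult_left_mono[OF one]) simp
    finally have b: "(b j)\<^sup>2 \<le> C\<^sub>B\<^sup>2 * real j powr (2 * \<omega>\<^sub>M)" .
    have "6 * C\<^sub>F\<^sup>2 * 1 \<le> 6 * C\<^sub>F\<^sup>2 * real j powr (2 * \<omega>\<^sub>M)" by (rule mult_left_mono[OF one]) simp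
    then have "\<beta> * (6 * C\<^sub>F\<^sup>2 + 3 * (m j)\<^sup>2) \<le> \<beta> * ((6 * C\<^sub>F\<^sup>2 + 6 * C\<^sub>M\<^sup>2) * real j powr (2 * \<omega>\<^sub>M))"
      using m_le[OF j] \<beta>0 by (intro mult_left_mono) (auto simp: algebra_simps)
    then show ?thesis using b unfolding sq_scale_def Q_def by (simp add: algebra_simps)
  qed
  have al_diff: "\<bar>\<alpha> j - \<alpha> (Suc j)\<bar> \<le> \<alpha>\<^sub>0 * real j powr (- \<delta> - p)" if j: "1 \<le> j" for j
  proof -
    let ?q = "real j powr - \<delta>"
    have "real (Suc j) powr - \<delta> \<le> ?q" using j \<delta> by (intro powr_mono2') auto
    moreover have "?q - real (Suc j) powr - \<delta> \<le> real j powr (- \<delta> - p)"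
    proof -
      have "?q - real (Suc j) powr - \<delta> \<le> ?q * (\<delta> / real j)" using powr_succ_ge[OF j, of \<delta>] \<delta> by (simp add: algebra_simps)
      also have "\<dots> \<le> ?q * (1 / real j)" using \<delta> by (intro mult_left_mono divide_right_mono) auto
      also have "\<dots> = real j powr (- \<delta> - 1)" using j by (simp add: powr_diff)
      also have "\<dots> \<le> real j powr (- \<delta> - p)" using j pd \<delta> by (intro powr_mono) auto
      finally show ?thesis .
    qed
    ultimately have "\<bar>?q - real (Suc j) powr - \<delta>\<bar> \<le> real j powr (- \<delta> - p)" by simp
    from mult_left_mono[OF this, of \<alpha>\<^sub>0] \<alpha>0
    have "\<bar>\<alpha>\<^sub>0 * (?q - real (Suc j) powr - \<delta>)\<bar> \<le> \<alpha>\<^sub>0 * real j powr (- \<delta> - p)" by (simp add: abs_mult)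
    then show ?thesis using al[OF j] al[of "Suc j"] by (simp add: algebra_simps)
  qed
  have x_bound: "x j \<le> Y * y" if j: "1 \<le> j" for j
  proof -
    have "\<alpha> j \<le> \<alpha>\<^sub>0 * 1"
      unfolding al[OF j] using j \<delta> \<alpha>0 powr_mono[of "- \<delta>" 0 "real j"] by (intro mult_left_mono) auto
    then have "2 * \<alpha> j * h j \<le> 2 * \<alpha>\<^sub>0 * (2 * L * \<beta> * y)"
      using h[of j] \<alpha>[of j] L \<beta>0 y0
      by (intro order_trans[OF mult_left_mono[of "h j" "2 * L * \<beta> * y"]] mult_right_mono) (auto simp: abs_le_iff less_imp_le)
    then have "x j \<le> D\<^sup>2 * y + 4 * L * \<beta> * \<alpha>\<^sub>0 * y" using dev_le[OF AO, of j] by (simp add: x_def y_def mult.commute mult.left_commute)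
    also have "\<dots> = (4 * L * \<beta> * \<alpha>\<^sub>0 + D\<^sup>2) * y" by (simp add: algebra_simps)
    also have "\<dots> \<le> Y * y"
    proof (rule mult_right_mono[OF _ y0])
      have "4 * L * \<beta> * \<alpha>\<^sub>0 \<le> 4 * L * \<beta> * (z * \<alpha>\<^sub>0\<^sup>2 + 2 * \<alpha>\<^sub>0)"
        using L \<beta>0 z0 \<alpha>0 by (intro mult_left_mono) auto
      moreover have "0 \<le> \<alpha>\<^sub>0 * C\<^sub>B\<^sup>2 / \<eta> + \<alpha>\<^sub>0\<^sup>2 * (2 * L * \<beta> + (2 * L + 1) * Q)"
        using L \<beta>0 \<alpha>0 \<eta> Q0 by simp
      ultimately show "4 * L * \<beta> * \<alpha>\<^sub>0 + D\<^sup>2 \<le> Y" by (simp add: Y_def)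
    qed
    finally show ?thesis .
  qed
  have x_step: "x (Suc j) \<le> (1 - z * \<alpha>\<^sub>0 * real j powr - \<delta>) * x j + Y * y * real j powr (- \<delta> - p)"
    if j: "1 \<le> j" for j
  proof -
    let ?g = "real j powr (- \<delta> - p)"
    have g0: "0 \<le> ?g" by simp
    have sq_al_g: "(\<alpha> j)\<^sup>2 \<le> \<alpha>\<^sub>0\<^sup>2 * ?g"
      unfolding sq_al[OF j] using j pd by (intro mult_left_mono powr_mono) auto
    have sq_al_scale: "(\<alpha> j)\<^sup>2 * sq_scale j \<le> \<alpha>\<^sub>0\<^sup>2 * Q * ?g"
    proof -
      have "(\<alpha> j)\<^sup>2 * sq_scale j \<le> (\<alpha> j)\<^sup>2 * (Q * real j powr (2 * \<omega>\<^sub>M))" by (rule mult_left_mono[OF scale_le[OF j]]) simp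
      also have "\<dots> = \<alpha>\<^sub>0\<^sup>2 * Q * real j powr (- 2 * \<delta> + 2 * \<omega>\<^sub>M)"
        unfolding sq_al[OF j] powr_add by simp
      also have "\<dots> \<le> \<alpha>\<^sub>0\<^sup>2 * Q * ?g" using j p Q0 by (intro mult_left_mono powr_mono) auto
      finally show ?thesis .
    qed
    have al_b: "\<alpha> j * ((b j)\<^sup>2 / \<eta>) \<le> \<alpha>\<^sub>0 * C\<^sub>B\<^sup>2 / \<eta> * ?g"
    proof -
      have "\<alpha> j * ((b j)\<^sup>2 / \<eta>) \<le> \<alpha> j * ((C\<^sub>B\<^sup>2 * real j powr - p) / \<eta>)"
        using b_le[OF j] \<alpha>[of j] \<eta> by (intro mult_left_mono divide_right_mono) auto
      also have "\<dots> = \<alpha>\<^sub>0 * C\<^sub>B\<^sup>2 / \<eta> * (real j powr - \<delta> * real j powr - p)" by (simp add: al[OF j])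
      also have "real j powr - \<delta> * real j powr - p = ?g" by (simp add: powr_add[symmetric])
      finally show ?thesis .
    qed
    have c1: "2 * z * (\<alpha> j)\<^sup>2 * h j \<le> 2 * z * (\<alpha>\<^sub>0\<^sup>2 * ?g) * (2 * L * \<beta> * y)"
    proof -
      have "2 * z * (\<alpha> j)\<^sup>2 * h j \<le> 2 * z * (\<alpha> j)\<^sup>2 * (2 * L * \<beta> * y)"
        using h[of j] z0 by (intro mult_left_mono) (auto simp: abs_le_iff)
      also have "\<dots> \<le> 2 * z * (\<alpha>\<^sub>0\<^sup>2 * ?g) * (2 * L * \<beta> * y)"
        using sq_al_g z0 L \<beta>0 y0 by (intro mult_left_mono mult_right_mono) auto
      finally show ?thesis .
    qed
    have c2: "2 * (\<alpha> (Suc j) - \<alpha> j) * h (Suc j) \<le> 2 * (\<alpha>\<^sub>0 * ?g) * (2 * L * \<beta> * y)"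
    proof -
      have "(\<alpha> (Suc j) - \<alpha> j) * h (Suc j) \<le> \<bar>\<alpha> (Suc j) - \<alpha> j\<bar> * \<bar>h (Suc j)\<bar>"
        by (metis abs_ge_self abs_mult)
      also have "\<dots> \<le> (\<alpha>\<^sub>0 * ?g) * (2 * L * \<beta> * y)"
        using al_diff[OF j] h[of "Suc j"] \<alpha>0 by (intro mult_mono) (auto simp: abs_minus_commute)
      finally have "2 * ((\<alpha> (Suc j) - \<alpha> j) * h (Suc j)) \<le> 2 * ((\<alpha>\<^sub>0 * ?g) * (2 * L * \<beta> * y))"
        by (rule mult_left_mono) simp
      then show ?thesis by (simp only: mult.assoc)
    qed
    have d: "dev A (Suc j) \<le> (1 - z * \<alpha> j) * dev A j + 2 * \<alpha> j * (h j - h (Suc j))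
        + \<alpha> j * ((b j)\<^sup>2 / \<eta>) * y + (\<alpha> j)\<^sup>2 * (2 * L * \<beta> + (2 * L + 1) * sq_scale j) * y"
      unfolding h_def y_def z_def by (rule one_step[OF A j])
    have "x (Suc j) \<le> (1 - z * \<alpha> j) * x j + 2 * z * (\<alpha> j)\<^sup>2 * h j + 2 * (\<alpha> (Suc j) - \<alpha> j) * h (Suc j)
        + \<alpha> j * ((b j)\<^sup>2 / \<eta>) * y + ((\<alpha> j)\<^sup>2 * (2 * L * \<beta>) + (2 * L + 1) * ((\<alpha> j)\<^sup>2 * sq_scale j)) * y"
      using d unfolding x_def by (simp add: algebra_simps power2_eq_square)
    also have "\<dots> \<le> (1 - z * \<alpha> j) * x j + 2 * z * (\<alpha>\<^sub>0\<^sup>2 * ?g) * (2 * L * \<beta> * y) + 2 * (\<alpha>\<^sub>0 * ?g) * (2 * L * \<beta> * y)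
        + \<alpha>\<^sub>0 * C\<^sub>B\<^sup>2 / \<eta> * ?g * y + (\<alpha>\<^sub>0\<^sup>2 * ?g * (2 * L * \<beta>) + (2 * L + 1) * (\<alpha>\<^sub>0\<^sup>2 * Q * ?g)) * y"
      using L \<beta>0
      by (intro add_mono c1 c2 mult_right_mono[OF _ y0] al_b mult_right_mono[OF sq_al_g]
          mult_left_mono[OF sq_al_scale] order_refl) auto
    also have "\<dots> = (1 - z * \<alpha> j) * x j + (4 * L * \<beta> * (z * \<alpha>\<^sub>0\<^sup>2 + \<alpha>\<^sub>0) + \<alpha>\<^sub>0 * C\<^sub>B\<^sup>2 / \<eta>
        + \<alpha>\<^sub>0\<^sup>2 * (2 * L * \<beta> + (2 * L + 1) * Q)) * y * ?g"
      by (simp add: algebra_simps)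
    also have "\<dots> \<le> (1 - z * \<alpha> j) * x j + Y * y * ?g"
    proof (intro add_left_mono mult_right_mono[OF _ g0] mult_right_mono[OF _ y0])
      have "4 * L * \<beta> * (z * \<alpha>\<^sub>0\<^sup>2 + \<alpha>\<^sub>0) \<le> 4 * L * \<beta> * (z * \<alpha>\<^sub>0\<^sup>2 + 2 * \<alpha>\<^sub>0)"
        using L \<beta>0 \<alpha>0 by (intro mult_left_mono) auto
      then show "4 * L * \<beta> * (z * \<alpha>\<^sub>0\<^sup>2 + \<alpha>\<^sub>0) + \<alpha>\<^sub>0 * C\<^sub>B\<^sup>2 / \<eta>
        + \<alpha>\<^sub>0\<^sup>2 * (2 * L * \<beta> + (2 * L + 1) * Q) \<le> Y"
        unfolding Y_def using zero_le_power2[of D] by linarith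
    qed
    finally show ?thesis by (simp add: al[OF j] mult.assoc)
  qed
  have k1: "1 \<le> k" using K k by simp
  have "x k \<le> C * (Y * y) * real k powr - p"
  proof (rule conv[OF _ x_bound _ k])
    show "0 \<le> Y * y" using Y0 y0 by simp
    show "x (Suc j) \<le> (1 - (2 * \<zeta> - \<eta>) * \<alpha>\<^sub>0 * real j powr - \<delta>) * x j + Y * y * real j powr (- \<delta> - p)"
      if "1 \<le> j" for j using x_step[OF that] by (simp add: z_def)
  qed
  moreover have "- (2 * \<alpha> k * h k) \<le> 4 * L * \<beta> * \<alpha>\<^sub>0 * real k powr - p * y"
  proof -
    have "- (2 * \<alpha> k * h k) \<le> 2 * \<alpha> k * (2 * L * \<beta> * y)"
      using mult_left_mono[of "- h k" "2 * L * \<beta> * y" "2 * \<alpha> k"] h[of k] \<alpha>[of k] by (simp add: abs_le_iff less_imp_le)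
    also have "\<dots> = 4 * L * \<beta> * y * \<alpha>\<^sub>0 * real k powr - \<delta>" by (simp add: al[OF k1])
    also have "\<dots> \<le> 4 * L * \<beta> * y * \<alpha>\<^sub>0 * real k powr - p"
      using L \<beta>0 y0 \<alpha>0 k1 pd by (intro mult_left_mono powr_mono) auto
    finally show ?thesis by (simp add: ac_simps)
  qed
  ultimately have "dev A k \<le> C * (Y * y) * real k powr - p + 4 * L * \<beta> * \<alpha>\<^sub>0 * real k powr - p * y"
    unfolding x_def by linarith
  also have "\<dots> = (C * Y + 4 * L * \<beta> * \<alpha>\<^sub>0) * real k powr - p * y" by (simp add: algebra_simps)
  finally show ?thesis by (simp only: Y_def Q_def z_def y_def)
qed

end

end

section \<open>The convergence rate\<close>

text \<open>Test the hypothesis on the event where the conditional expectation exceeds \<open>g\<close>.\<close>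
lemma (in finite_measure_subalgebra) real_cond_exp_le_of_integrals:
  assumes f: "integrable M f" and g: "integrable M g" "g \<in> borel_measurable F"
    and le: "\<And>A. A \<in> sets F \<Longrightarrow> (\<integral>x. indicator A x * f x \<partial>M) \<le> (\<integral>x. indicator A x * g x \<partial>M)"
  shows "AE x in M. real_cond_exp M F f x \<le> g x"
proof -
  let ?r = "real_cond_exp M F f"
  define A where "A = {x \<in> space F. g x < ?r x}"
  have A: "A \<in> sets F" unfolding A_def using g(2) by measurable
  then have AM [measurable]: "A \<in> sets M" using subalg by (auto simp: subalgebra_def)
  have iF: "indicator A \<in> borel_measurable F" using A by simp
  have if': "integrable M (\<lambda>x. indicator A x * f x)" and ig: "integrable M (\<lambda>x. indicator A x * g x)"
    using integrable_mult_indicator[OF AM f] integrable_mult_indicator[OF AM g(1)] by simp_all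
  note r = real_cond_exp_intg[OF if' iF borel_measurable_integrable[OF f]]
  have sp: "space F = space M" using subalg by (simp add: subalgebra_def)
  have nn: "0 \<le> indicator A x * ?r x - indicator A x * g x" for x by (simp add: A_def indicator_def)
  have i: "integrable M (\<lambda>x. indicator A x * ?r x - indicator A x * g x)" using r(1) ig by simp
  have "(\<integral>x. indicator A x * ?r x - indicator A x * g x \<partial>M) \<le> 0" using r ig le[OF A] by simp
  then have "(\<integral>x. indicator A x * ?r x - indicator A x * g x \<partial>M) = 0"
    using Bochner_Integration.integral_nonneg[of M "\<lambda>x. indicator A x * ?r x - indicator A x * g x", OF nn]
    by linarith
  then have "AE x in M. indicator A x * ?r x - indicator A x * g x = 0"
    using integral_nonneg_eq_0_iff_AE[OF i] nn by simp
  then show ?thesis using AE_space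
    by eventually_elim (auto simp: A_def sp indicator_def split: if_splits)
qed

theorem proposition2:
  fixes \<Theta> :: "'d::euclidean_space set"
    and \<W> \<W>\<^sub>0 :: "'w::euclidean_space set"
    and F :: "'d \<Rightarrow> 'w \<Rightarrow> 'd"
    and P :: "'d \<Rightarrow> 'w \<Rightarrow> 'w measure"
    and \<phi> :: "'w measure"
    and \<theta>star :: 'd
    and m b :: "nat \<Rightarrow> real"
    and \<alpha>\<^sub>0 \<delta> \<epsilon>\<^sub>0 lam c L\<^sub>P L\<^sub>F C\<^sub>F \<zeta> C\<^sub>M C\<^sub>B \<omega>\<^sub>M \<omega>\<^sub>B :: real
    and N :: nat
  assumes "model \<Theta> \<W> F P"
    and "\<alpha>\<^sub>0 > 0" and "0 < \<delta>" and "\<delta> \<le> 1"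
    and "\<Theta> \<noteq> {}" and "compact \<Theta>" and "convex \<Theta>"
    and "uniform_ergodicity \<Theta> \<W> P N \<W>\<^sub>0 \<epsilon>\<^sub>0 \<phi> lam c"
    and "kernel_continuity \<Theta> \<W> P L\<^sub>P"
    and "growth \<Theta> \<W> F L\<^sub>F C\<^sub>F"
    and "\<theta>star \<in> interior \<Theta>" and "mean_field \<W> F P \<theta>star = 0"
    and "\<zeta> > 0"
    and "\<forall>\<theta>\<in>\<Theta>. (\<theta> - \<theta>star) \<bullet> mean_field \<W> F P \<theta> \<le> - \<zeta> * (norm (\<theta> - \<theta>star))\<^sup>2"
    and "error_scales m b C\<^sub>M C\<^sub>B \<omega>\<^sub>M \<omega>\<^sub>B"
    and "\<delta> = 1 \<Longrightarrow> 2 * \<zeta> * \<alpha>\<^sub>0 > 1"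
    and "0 \<le> \<omega>\<^sub>M" and "\<omega>\<^sub>M < \<delta> / 2" and "\<omega>\<^sub>B > 0"
  shows "\<exists>C > 0. \<exists>K > (0::nat).
    \<forall>(\<Omega> :: 'a measure) \<theta> W (\<xi> :: nat \<Rightarrow> 'a \<Rightarrow> 'c) X M B.
      extended_recursion \<Omega> \<Theta> \<W> F P (step_size \<alpha>\<^sub>0 \<delta>) \<theta> W \<xi> X M B \<longrightarrow>
      (\<integral>\<^sup>+x. ennreal (U 2 (W 0 x)) \<partial>\<Omega>) < \<infinity> \<longrightarrow>
      error_process \<Omega> (Gminus \<Omega> \<theta> W \<xi> X) (Gplus \<Omega> \<theta> W \<xi> X) W M B m b \<longrightarrow>
      (\<forall>k\<ge>K. AE x in \<Omega>.
         real_cond_exp \<Omega> (Gplus \<Omega> \<theta> W \<xi> X 0) (\<lambda>x'. (norm (\<theta> k x' - \<theta>star))\<^sup>2) x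
           \<le> C * U 2 (W 0 x) *
               ((1 + ln (real k)) * real k powr (- \<delta>)
                + (1 + ln (real k)) * real k powr (- \<delta> + 2 * \<omega>\<^sub>M)
                + real k powr (- 2 * \<omega>\<^sub>B)))"
proof -
  note model = assms(1) and erg = assms(8) and cont = assms(9)
  let ?S = "restrict_space borel \<W>"
  let ?\<nu> = "\<lambda>t. stationary_distr ?S (P t)"
  have \<theta>s: "\<theta>star \<in> \<Theta>" using assms(11) interior_subset by blast
  have gr: "0 < L\<^sub>F" "0 < C\<^sub>F"
    "\<And>t t' w. t \<in> \<Theta> \<Longrightarrow> t' \<in> \<Theta> \<Longrightarrow> w \<in> \<W> \<Longrightarrow> norm (F t w - F t' w) \<le> L\<^sub>F * U 1 w * norm (t - t')"
    "\<And>t w. t \<in> \<Theta> \<Longrightarrow> w \<in> \<W> \<Longrightarrow> norm (F t w) \<le> C\<^sub>F * U 1 w"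
    using assms(10) by (auto simp: growth_def U_def)
  obtain R where R: "\<And>t. t \<in> \<Theta> \<Longrightarrow> norm t \<le> R"
    using compact_imp_bounded[OF \<open>compact \<Theta>\<close>] by (auto simp: bounded_iff)
  define D where "D = 2 * R"
  have D: "norm (t - \<theta>star) \<le> D" if "t \<in> \<Theta>" for t
    using norm_triangle_ineq4[of t \<theta>star] R[OF that] R[OF \<theta>s] by (simp add: D_def)
  have D0: "0 \<le> D" using D[OF \<theta>s] by simp
  have UN: "0 \<le> U 1 w" for w :: 'w using U_ge_1[of 1 w] by simp
  have S_sp: "space ?S = \<W>" by (simp add: space_restrict_space)
  define f where "f t w = (t - \<theta>star) \<bullet> F t w" for t w
  obtain u L where L: "0 \<le> L"
    and u_meas: "\<And>t. t \<in> \<Theta> \<Longrightarrow> u t \<in> borel_measurable ?S"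
    and u_bound: "\<And>t w. t \<in> \<Theta> \<Longrightarrow> w \<in> \<W> \<Longrightarrow> \<bar>u t w\<bar> \<le> L * U 1 w"
    and u_lip: "\<And>t t' w. t \<in> \<Theta> \<Longrightarrow> t' \<in> \<Theta> \<Longrightarrow> w \<in> \<W> \<Longrightarrow> \<bar>u t w - u t' w\<bar> \<le> L * U 1 w * norm (t - t')"
    and u_eq: "\<And>t w. t \<in> \<Theta> \<Longrightarrow> w \<in> \<W> \<Longrightarrow> u t w - (\<integral>y. u t y \<partial>P t w) = f t w - (\<integral>y. f t y \<partial>?\<nu> t)"
  proof (rule poisson_family[OF model erg cont, of f "D * C\<^sub>F" "C\<^sub>F + D * L\<^sub>F"])
    show "f t \<in> borel_measurable ?S" if "t \<in> \<Theta>" for t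
      unfolding f_def[abs_def] using kernel_section(2)[OF model that] by measurable
    show "\<bar>f t w\<bar> \<le> D * C\<^sub>F * U 1 w" if "t \<in> \<Theta>" "w \<in> \<W>" for t w
    proof -
      have "\<bar>f t w\<bar> \<le> norm (t - \<theta>star) * norm (F t w)" unfolding f_def by (rule Cauchy_Schwarz_ineq2)
      also have "\<dots> \<le> D * (C\<^sub>F * U 1 w)" using D[OF that(1)] gr(4)[OF that] D0 by (intro mult_mono) auto
      finally show ?thesis by simp
    qed
    show "\<bar>f t w - f t' w\<bar> \<le> (C\<^sub>F + D * L\<^sub>F) * U 1 w * norm (t - t')"
      if "t \<in> \<Theta>" "t' \<in> \<Theta>" "w \<in> \<W>" for t t' w
    proof -
      have "f t w - f t' w = (t - t') \<bullet> F t w + (t' - \<theta>star) \<bullet> (F t w - F t' w)"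
        by (simp add: f_def inner_diff_left inner_diff_right)
      also have "\<bar>\<dots>\<bar> \<le> norm (t - t') * norm (F t w) + norm (t' - \<theta>star) * norm (F t w - F t' w)"
        by (intro order_trans[OF abs_triangle_ineq] add_mono Cauchy_Schwarz_ineq2)
      also have "\<dots> \<le> norm (t - t') * (C\<^sub>F * U 1 w) + D * (L\<^sub>F * U 1 w * norm (t - t'))"
        using gr(3)[OF that] gr(4)[OF that(1,3)] D[OF that(2)] D0
        by (intro add_mono mult_left_mono mult_mono) auto
      finally show ?thesis by (simp add: algebra_simps)
    qed
    show "0 \<le> D * C\<^sub>F" "0 \<le> C\<^sub>F + D * L\<^sub>F" using D0 gr by auto
  qed blast
  have u_drift: "(t - \<theta>star) \<bullet> F t w \<le> - \<zeta> * (norm (t - \<theta>star))\<^sup>2 + (u t w - (\<integral>y. u t y \<partial>P t w))"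
    if t: "t \<in> \<Theta>" and w: "w \<in> \<W>" for t w
  proof -
    note \<nu> = stationary_integrable_U1[OF model erg t]
    have sp: "space (?\<nu> t) = \<W>" using sets_eq_imp_space_eq[OF \<nu>(2)] S_sp by simp
    have "integrable (?\<nu> t) (F t)"
    proof (rule Bochner_Integration.integrable_bound[OF integrable_mult_right[OF \<nu>(1), of C\<^sub>F]])
      show "F t \<in> borel_measurable (?\<nu> t)"
        using kernel_section(2)[OF model t] by (simp add: measurable_cong_sets[OF \<nu>(2) refl])
      show "AE w in ?\<nu> t. norm (F t w) \<le> norm (C\<^sub>F * U 1 w)"
        using gr(4)[OF t] by (intro AE_I2) (auto simp: sp intro: order_trans[OF _ abs_ge_self])
    qed
    then have "(\<integral>y. f t y \<partial>?\<nu> t) = (t - \<theta>star) \<bullet> mean_field \<W> F P t"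
      unfolding f_def mean_field_def by simp
    also have "\<dots> \<le> - \<zeta> * (norm (t - \<theta>star))\<^sup>2" using assms(14) t by blast
    finally show ?thesis using u_eq[OF t w] by (simp add: f_def)
  qed
  \<comment> \<open>The slowest of the three rates; the rate \<open>\<delta>\<close> is at least \<open>\<delta> - 2 * \<omega>\<^sub>M\<close>.\<close>
  define p where "p = min (\<delta> - 2 * \<omega>\<^sub>M) (2 * \<omega>\<^sub>B)"
  have p: "0 < p" "p \<le> \<delta> - 2 * \<omega>\<^sub>M" "p \<le> 2 * \<omega>\<^sub>B" using assms(18,19) by (auto simp: p_def)
  \<comment> \<open>For \<open>\<delta> = 1\<close> the bias may use up only so much of the contraction that \<open>a > 1\<close> is kept.\<close>
  define \<eta> where "\<eta> = (if \<delta> = 1 then \<zeta> - 1 / (2 * \<alpha>\<^sub>0) else \<zeta>)"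
  define a where "a = (2 * \<zeta> - \<eta>) * \<alpha>\<^sub>0"
  have \<eta>: "0 < \<eta>" using assms(2,13,16) by (auto simp: \<eta>_def field_simps)
  have "\<eta> \<le> \<zeta>" using assms(2) by (simp add: \<eta>_def)
  then have \<zeta>\<eta>: "0 < 2 * \<zeta> - \<eta>" using assms(13) by simp
  have crit: "p < a" if "\<delta> = 1"
  proof -
    have "a = \<zeta> * \<alpha>\<^sub>0 + 1 / 2" using that assms(2) by (simp add: a_def \<eta>_def field_simps)
    then have "1 < a" using assms(16)[OF that] by simp
    then show ?thesis using p(2) assms(17) that by simp
  qed
  have a: "0 < a" using \<zeta>\<eta> assms(2) by (simp add: a_def)
  obtain C K where C: "0 < C" and K: "1 \<le> K"
    and conv: "\<And>x y k. 0 \<le> y \<Longrightarrow> (\<And>k. 1 \<le> k \<Longrightarrow> x k \<le> y) \<Longrightarrow>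
      (\<And>k. 1 \<le> k \<Longrightarrow> x (Suc k) \<le> (1 - a * real k powr - \<delta>) * x k + y * real k powr (- \<delta> - p)) \<Longrightarrow>
      K \<le> k \<Longrightarrow> x k \<le> C * y * real k powr - p"
    using recursion_rate[OF a p(1) assms(3,4) crit] by metis
  define b\<^sub>U where "b\<^sub>U = 1 + c / (1 - lam)"
  define C' where "C' = C * (4 * L * b\<^sub>U * ((2 * \<zeta> - \<eta>) * \<alpha>\<^sub>0\<^sup>2 + 2 * \<alpha>\<^sub>0) + \<alpha>\<^sub>0 * C\<^sub>B\<^sup>2 / \<eta>
      + \<alpha>\<^sub>0\<^sup>2 * (2 * L * b\<^sub>U + (2 * L + 1) * (b\<^sub>U * (6 * C\<^sub>F\<^sup>2 + 6 * C\<^sub>M\<^sup>2) + 3 * C\<^sub>B\<^sup>2)) + D\<^sup>2)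
      + 4 * L * b\<^sub>U * \<alpha>\<^sub>0"
  define C'' where "C'' = max C' 1"
  show ?thesis
  proof (intro exI[of _ C''] exI[of _ K] conjI allI impI)
    show "0 < C''" by (simp add: C''_def)
    show "0 < K" using K by simp
    fix \<Omega> :: "'a measure" and \<theta> W and \<xi> :: "nat \<Rightarrow> 'a \<Rightarrow> 'c" and X M B k
    assume rec: "extended_recursion \<Omega> \<Theta> \<W> F P (step_size \<alpha>\<^sub>0 \<delta>) \<theta> W \<xi> X M B"
      and init: "(\<integral>\<^sup>+x. ennreal (U 2 (W 0 x)) \<partial>\<Omega>) < \<infinity>"
      and err: "error_process \<Omega> (Gminus \<Omega> \<theta> W \<xi> X) (Gplus \<Omega> \<theta> W \<xi> X) W M B m b"
      and k: "K \<le> k"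
    interpret sa_assumptions \<Omega> \<Theta> \<W> F P "step_size \<alpha>\<^sub>0 \<delta>" \<theta> W \<xi> X M B lam c C\<^sub>F \<W>\<^sub>0 m b \<theta>star D
    proof
      show "0 < step_size \<alpha>\<^sub>0 \<delta> k" for k using assms(2) by (simp add: step_size_def)
    qed (use rec model erg init err assms(6,7) \<theta>s D gr(4) in \<open>auto simp: uniform_ergodicity_def Let_def\<close>)
    have k1: "1 \<le> k" using K k by simp
    have dev: "dev A k \<le> C' * real k powr - p * mom A 0" if "A \<in> sets (Gp 0)" for A
      unfolding C'_def b\<^sub>U_def \<beta>_def[symmetric]
      by (rule dev_rate[OF L u_meas u_bound u_lip u_drift \<eta> less_imp_le[OF \<zeta>\<eta>] refl assms(3,4) assms(15) p _ K that k])
         (use conv in \<open>auto simp: a_def\<close>)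
    interpret ce: finite_measure_subalgebra \<Omega> "Gp 0" by (rule cond_exp_Gp)
    have "AE x in \<Omega>. real_cond_exp \<Omega> (Gp 0) (\<lambda>x. (norm (\<theta> k x - \<theta>star))\<^sup>2) x \<le> C' * real k powr - p * U 2 (W 0 x)"
    proof (rule ce.real_cond_exp_le_of_integrals)
      show "integrable \<Omega> (\<lambda>x. (norm (\<theta> k x - \<theta>star))\<^sup>2)"
        using D[OF \<theta>_in] by (intro integrable_const_bound[where B="D\<^sup>2"] AE_I2) (auto intro!: power_mono)
      show "integrable \<Omega> (\<lambda>x. C' * real k powr - p * U 2 (W 0 x))" by (intro integrable_mult_right integrable_U2)
      have "W 0 \<in> borel_measurable (Gp 0)" using W_Gp by (simp add: measurable_restrict_space2_iff)
      then show "(\<lambda>x. C' * real k powr - p * U 2 (W 0 x)) \<in> borel_measurable (Gp 0)" by measurable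
      show "(\<integral>x. indicator A x * (norm (\<theta> k x - \<theta>star))\<^sup>2 \<partial>\<Omega>)
          \<le> (\<integral>x. indicator A x * (C' * real k powr - p * U 2 (W 0 x)) \<partial>\<Omega>)" if "A \<in> sets (Gp 0)" for A
        using dev[OF that] by (simp add: dev_def mom_def mult.left_commute[of "indicator A _"])
    qed
    then show "AE x in \<Omega>. real_cond_exp \<Omega> (Gplus \<Omega> \<theta> W \<xi> X 0) (\<lambda>x'. (norm (\<theta> k x' - \<theta>star))\<^sup>2) x
           \<le> C'' * U 2 (W 0 x) *
               ((1 + ln (real k)) * real k powr (- \<delta>)
                + (1 + ln (real k)) * real k powr (- \<delta> + 2 * \<omega>\<^sub>M)
                + real k powr (- 2 * \<omega>\<^sub>B))"
    proof eventually_elim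
      case (elim x)
      have ln: "0 \<le> ln (real k)" using k1 by simp
      have pos: "0 \<le> (1 + ln (real k)) * real k powr (- \<delta>)" using ln by simp
      have "real k powr - p \<le> (1 + ln (real k)) * real k powr (- \<delta> + 2 * \<omega>\<^sub>M) + real k powr (- 2 * \<omega>\<^sub>B)"
      proof (cases "\<delta> - 2 * \<omega>\<^sub>M \<le> 2 * \<omega>\<^sub>B")
        case True
        then have "- p = - \<delta> + 2 * \<omega>\<^sub>M" by (simp add: p_def)
        then show ?thesis using mult_right_mono[of 1 "1 + ln (real k)" "real k powr (- \<delta> + 2 * \<omega>\<^sub>M)"] ln
          by (simp add: add_increasing2)
      next
        case False
        then have "- p = - 2 * \<omega>\<^sub>B" by (simp add: p_def)
        then show ?thesis using ln by (simp add: add_increasing)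
      qed
      then have rate: "real k powr - p \<le> (1 + ln (real k)) * real k powr (- \<delta>)
                + (1 + ln (real k)) * real k powr (- \<delta> + 2 * \<omega>\<^sub>M) + real k powr (- 2 * \<omega>\<^sub>B)"
        using pos by linarith
      have U0: "0 \<le> U 2 (W 0 x)" by (simp add: U_def)
      have "C' * real k powr - p * U 2 (W 0 x) = C' * (U 2 (W 0 x) * real k powr - p)" by simp
      also have "\<dots> \<le> C'' * (U 2 (W 0 x) * real k powr - p)"
        using U0 by (intro mult_right_mono) (auto simp: C''_def)
      also have "\<dots> \<le> C'' * (U 2 (W 0 x) * ((1 + ln (real k)) * real k powr (- \<delta>)
                + (1 + ln (real k)) * real k powr (- \<delta> + 2 * \<omega>\<^sub>M) + real k powr (- 2 * \<omega>\<^sub>B)))"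
        using rate U0 by (intro mult_left_mono) (auto simp: C''_def)
      finally show ?case using elim by (simp add: mult.assoc)
    qed
  qed
qed

end
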